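(* Let $r\ge0$, $q=r+1$, $p\ge1$, $\rho_h>0$, $d_h\ge0$ ($1\le h\le r$), $\widehat a_*\in\mathbb R$. Suppose that the real column nodes $\xi_1,\dots,\xi_p$ are pairwise distinct, that $\xi_i+\rho_h>0$ for all $i,h$, and let $\boldsymbol\lambda=(\boldsymbol n,\eta)\in\mathbb N_0^r\times\mathbb N_0$ be any Laguerre-admissible row index (entries pairwise differing by at most one), $N=|\boldsymbol\lambda|$, such that the rates $\rho_h$ with $n_h>0$ are pairwise distinct. Then, for the Hermite system with rows $U_j^{\mathrm H}$ and columns $\mathrm e^{\xi_it}$, the $A$-problem in the balance $|\boldsymbol m|=N+1$ is strongly normal, and the $B$-problem in the balance $|\boldsymbol m|=N-1$, $N\ge1$, is weakly normal. Their normalized component vectors are, respectively, the components $(A^{(i),\mathrm H}_{\boldsymbol\lambda,\boldsymbol m})_i$ of the contour form $\mathcal A^{\mathrm H}_{\boldsymbol\lambda,\boldsymbol m}$ and the unique polynomial components of the Rodrigues function $\mathcal B^{\mathrm H}_{\boldsymbol\lambda,\boldsymbol m}$ (see context). Strong normality of the $B$-problem holds if and only if $$\det C[(j,\lambda_j-1)\leftarrow\mathbf p]\ne0\qquad\text{for every }j\text{ with }\lambda_j>0.$$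
   Context: $\phi_a(t)=\pi^{-1/2}\mathrm e^{-(t-a)^2}$; $(K_{\rho,d}f)(t)=\int_0^\infty\frac{\rho^d}{\Gamma(d)}u^{d-1}\mathrm e^{-\rho u}f(t+u)\,\mathrm du$ ($\rho,d>0$), $K_{\rho,0}=I$; $F=K_{\rho_1,d_1}\cdots K_{\rho_r,d_r}\phi_{\widehat a_*}$; rows $U_h^{\mathrm H}=K_{\rho_h,1}F$ ($1\le h\le r$), $U_q^{\mathrm H}=F$; $\lambda_h=n_h$ ($h\le r$), $\lambda_q=\eta$. $L_F(z)=\int_{\mathbb R}\mathrm e^{zt}F(t)\,\mathrm dt=\mathrm e^{\widehat a_*z+z^2/4}\prod_h(\rho_h/(\rho_h+z))^{d_h}$. $A$-problem ($|\boldsymbol m|=N+1$): polynomial vectors $(A_i)_{i=1}^p$, $\deg A_i\le m_i-1$, with $\int_{\mathbb R}t^kU_j^{\mathrm H}\sum_iA_i\mathrm e^{\xi_it}\,\mathrm dt=0$ for $0\le k<\lambda_j$, $1\le j\le q$. $B$-problem ($|\boldsymbol m|=N-1$): $(B_j)_{j=1}^q$, $\deg B_j\le\lambda_j-1$, with $\int_{\mathbb R}t^k\mathrm e^{\xi_it}\sum_jB_jU_j^{\mathrm H}\,\mathrm dt=0$ for $0\le k<m_i$, $1\le i\le p$. (A zero index means a zero component.) Weakly normal: the solution space of component vectors is one-dimensional. Strongly normal: in addition every component with positive index attains its maximal prescribed degree. Contour form: $\mathcal A^{\mathrm H}_{\boldsymbol\lambda,\boldsymbol m}(t)=\frac1{2\pi\mathrm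 i}\oint_{\Sigma_\xi}\frac{\mathrm e^{zt}\prod_h(\rho_h+z)^{n_h}}{L_F(z)\prod_i(\xi_i-z)^{m_i}}\mathrm dz=\sum_iA^{(i),\mathrm H}_{\boldsymbol\lambda,\boldsymbol m}(t)\mathrm e^{\xi_it}$, $\Sigma_\xi$ a positively oriented contour around the $\xi_i$ in $\operatorname{Re}z>-\min_h\rho_h$ (no restriction if $r=0$). Rodrigues function: $\mathcal B^{\mathrm H}_{\boldsymbol\lambda,\boldsymbol m}=\prod_i(\xi_i+\partial_t)^{m_i}\prod_h\rho_h^{-n_h}K_{\rho_h,n_h}F$. Connection matrix: $D_{\boldsymbol n}(z)=\prod_h(\rho_h+z)^{n_h}$, $\Lambda_h=\frac{\rho_h}{\rho_h+z}L_F$ ($h\le r$), $\Lambda_q=L_F$; monic Hermite polynomials $\mathrm e^{uz-z^2/4}=\sum_\ell H_\ell(u)z^\ell/\ell!$; $\Phi_{j,k}=\frac{D_{\boldsymbol n}}{L_F}H_k(\partial_z)\Lambda_j$ for $1\le j\le q$, $0\le k<\lambda_j$ (polynomials of degree $\le N-1$); $C_{\nu,(j,k)}=[z^\nu]\Phi_{j,k}$, $0\le\nu\le N-1$, columns ordered lexicographically; $\mathbf p$ is the vector $p_\nu=[z^\nu]\prod_i(\xi_i-z)^{m_i}$; $C[(j,k)\leftarrow\mathbf p]$ is $C$ with column $(j,k)$ replaced by $\mathbf p$. *)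

theory Defs
  imports
    "HOL-Complex_Analysis.Complex_Analysis"
    "HOL-Library.Function_Algebras"
    "Jordan_Normal_Form.Determinant"
begin

text \<open>
  Families indexed by \<open>1, \<dots>, r\<close> (rates \<open>rho\<close>, exponents \<open>d\<close>), by \<open>1, \<dots>, p\<close> (column nodes
  \<open>xi\<close>, column index \<open>m\<close>) and by \<open>1, \<dots>, q\<close> with \<open>q = Suc r\<close> (row index \<open>lam\<close>) are functions on
  \<^typ>\<open>nat\<close>, whose values outside these ranges are irrelevant.  The row index
  \<open>lam = (n, \<eta>)\<close> is kept as a single function: \<open>n\<^sub>h\<close> is \<open>lam h\<close> for \<open>1 \<le> h \<le> r\<close>, and
  \<open>\<eta>\<close> is \<open>lam (Suc r)\<close>.
\<close>

section \<open>The Hermite system\<close>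

definition gaussian :: "real \<Rightarrow> real \<Rightarrow> real" where
  "gaussian a t = exp (- (t - a)\<^sup>2) / sqrt pi"

definition Kop :: "real \<Rightarrow> real \<Rightarrow> (real \<Rightarrow> real) \<Rightarrow> real \<Rightarrow> real" where
  "Kop \<rho> d f t =
     (if d = 0 then f t
      else (LBINT u:{0<..}. \<rho> powr d / Gamma d * u powr (d - 1) * exp (- \<rho> * u) * f (t + u)))"

definition generatorF :: "nat \<Rightarrow> (nat \<Rightarrow> real) \<Rightarrow> (nat \<Rightarrow> real) \<Rightarrow> real \<Rightarrow> real \<Rightarrow> real" where
  "generatorF r rho d a = foldr (\<lambda>h. Kop (rho h) (d h)) [1..<Suc r] (gaussian a)"

definition hermite_row ::
  "nat \<Rightarrow> (nat \<Rightarrow> real) \<Rightarrow> (nat \<Rightarrow> real) \<Rightarrow> real \<Rightarrow> nat \<Rightarrow> real \<Rightarrow> real" where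
  "hermite_row r rho d a j =
     (if j \<le> r then Kop (rho j) 1 (generatorF r rho d a) else generatorF r rho d a)"

definition laplaceF ::
  "nat \<Rightarrow> (nat \<Rightarrow> real) \<Rightarrow> (nat \<Rightarrow> real) \<Rightarrow> real \<Rightarrow> complex \<Rightarrow> complex" where
  "laplaceF r rho d a z = (LBINT t. exp (z * of_real t) * of_real (generatorF r rho d a t))"

section \<open>Polynomial vectors, the two problems, normality\<close>

global_interpretation poly_vec:
  vector_space "\<lambda>(c::real) (A :: nat \<Rightarrow> real poly) i. Polynomial.smult c (A i)"
  by unfold_locales (auto simp: fun_eq_iff smult_add_right smult_add_left)

text \<open>Component vectors of the polynomials with index set \<open>I\<close> and \<open>deg (A i) \<le> m i - 1\<close>; the
  strict inequality forces \<open>A i = 0\<close> when \<open>m i = 0\<close>.\<close>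

definition poly_vectors :: "nat set \<Rightarrow> (nat \<Rightarrow> nat) \<Rightarrow> (nat \<Rightarrow> real poly) set" where
  "poly_vectors I m = {A. \<forall>i. A i \<noteq> 0 \<longrightarrow> i \<in> I \<and> Polynomial.degree (A i) < m i}"

text \<open>\<^const>\<open>has_bochner_integral\<close> makes integrability part of the orthogonality relations.\<close>

definition A_solutions ::
  "nat \<Rightarrow> (nat \<Rightarrow> real \<Rightarrow> real) \<Rightarrow> (nat \<Rightarrow> nat) \<Rightarrow> nat \<Rightarrow> (nat \<Rightarrow> real) \<Rightarrow> (nat \<Rightarrow> nat)
     \<Rightarrow> (nat \<Rightarrow> real poly) set" where
  "A_solutions q U lam p xi m =
     {A \<in> poly_vectors {1..p} m.
        \<forall>j\<in>{1..q}. \<forall>k<lam j.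
          has_bochner_integral lborel
            (\<lambda>t. t ^ k * U j t * (\<Sum>i=1..p. poly (A i) t * exp (xi i * t))) 0}"

definition B_solutions ::
  "nat \<Rightarrow> (nat \<Rightarrow> real \<Rightarrow> real) \<Rightarrow> (nat \<Rightarrow> nat) \<Rightarrow> nat \<Rightarrow> (nat \<Rightarrow> real) \<Rightarrow> (nat \<Rightarrow> nat)
     \<Rightarrow> (nat \<Rightarrow> real poly) set" where
  "B_solutions q U lam p xi m =
     {B \<in> poly_vectors {1..q} lam.
        \<forall>i\<in>{1..p}. \<forall>k<m i.
          has_bochner_integral lborel
            (\<lambda>t. t ^ k * exp (xi i * t) * (\<Sum>j=1..q. poly (B j) t * U j t)) 0}"

definition weakly_normal :: "(nat \<Rightarrow> real poly) set \<Rightarrow> bool" where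
  "weakly_normal S \<longleftrightarrow> poly_vec.dim S = 1"

definition strongly_normal ::
  "nat set \<Rightarrow> (nat \<Rightarrow> nat) \<Rightarrow> (nat \<Rightarrow> real poly) set \<Rightarrow> bool" where
  "strongly_normal I m S \<longleftrightarrow> weakly_normal S \<and>
     (\<forall>A\<in>S. A \<noteq> 0 \<longrightarrow> (\<forall>i\<in>I. m i > 0 \<longrightarrow> A i \<noteq> 0 \<and> Polynomial.degree (A i) = m i - 1))"

definition laguerre_admissible :: "nat \<Rightarrow> (nat \<Rightarrow> nat) \<Rightarrow> bool" where
  "laguerre_admissible q lam \<longleftrightarrow> (\<forall>j\<in>{1..q}. \<forall>k\<in>{1..q}. lam j \<le> lam k + 1)"

section \<open>Contour form and Rodrigues function\<close>

definition Dpoly :: "nat \<Rightarrow> (nat \<Rightarrow> real) \<Rightarrow> (nat \<Rightarrow> nat) \<Rightarrow> complex \<Rightarrow> complex" where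
  "Dpoly r rho lam z = (\<Prod>h=1..r. (of_real (rho h) + z) ^ lam h)"

definition positive_contour ::
  "nat \<Rightarrow> (nat \<Rightarrow> real) \<Rightarrow> nat \<Rightarrow> (nat \<Rightarrow> real) \<Rightarrow> (real \<Rightarrow> complex) \<Rightarrow> bool" where
  "positive_contour r rho p xi \<gamma> \<longleftrightarrow>
     valid_path \<gamma> \<and> simple_path \<gamma> \<and> pathfinish \<gamma> = pathstart \<gamma> \<and>
     path_image \<gamma> \<subseteq> {z. \<forall>h\<in>{1..r}. Re z > - rho h} \<and>
     (\<forall>i\<in>{1..p}. of_real (xi i) \<notin> path_image \<gamma> \<and> winding_number \<gamma> (of_real (xi i)) = 1)"

definition contour_form ::
  "nat \<Rightarrow> (nat \<Rightarrow> real) \<Rightarrow> (nat \<Rightarrow> real) \<Rightarrow> real \<Rightarrow> (nat \<Rightarrow> nat) \<Rightarrow> nat \<Rightarrow> (nat \<Rightarrow> real)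
     \<Rightarrow> (nat \<Rightarrow> nat) \<Rightarrow> (real \<Rightarrow> complex) \<Rightarrow> real \<Rightarrow> complex" where
  "contour_form r rho d a lam p xi m \<gamma> t =
     1 / (2 * of_real pi * \<i>) *
     contour_integral \<gamma>
       (\<lambda>z. exp (z * of_real t) * Dpoly r rho lam z /
            (laplaceF r rho d a z * (\<Prod>i=1..p. (of_real (xi i) - z) ^ m i)))"

text \<open>No degree bound is imposed on the components here.\<close>

definition contour_components ::
  "nat \<Rightarrow> (nat \<Rightarrow> real) \<Rightarrow> (nat \<Rightarrow> real) \<Rightarrow> real \<Rightarrow> (nat \<Rightarrow> nat) \<Rightarrow> nat \<Rightarrow> (nat \<Rightarrow> real)
     \<Rightarrow> (nat \<Rightarrow> nat) \<Rightarrow> (nat \<Rightarrow> real poly) \<Rightarrow> bool" where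
  "contour_components r rho d a lam p xi m A \<longleftrightarrow>
     (\<forall>i. i \<notin> {1..p} \<longrightarrow> A i = 0) \<and>
     (\<forall>\<gamma>. positive_contour r rho p xi \<gamma> \<longrightarrow>
        (\<forall>t. contour_form r rho d a lam p xi m \<gamma> t =
             of_real (\<Sum>i=1..p. poly (A i) t * exp (xi i * t))))"

definition rodrigues ::
  "nat \<Rightarrow> (nat \<Rightarrow> real) \<Rightarrow> (nat \<Rightarrow> real) \<Rightarrow> real \<Rightarrow> (nat \<Rightarrow> nat) \<Rightarrow> nat \<Rightarrow> (nat \<Rightarrow> real)
     \<Rightarrow> (nat \<Rightarrow> nat) \<Rightarrow> real \<Rightarrow> real" where
  "rodrigues r rho d a lam p xi m =
     foldr (\<lambda>i. (\<lambda>f t. xi i * f t + deriv f t) ^^ m i) [1..<Suc p]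
       (foldr (\<lambda>h f t. Kop (rho h) (real (lam h)) f t / rho h ^ lam h) [1..<Suc r]
         (generatorF r rho d a))"

text \<open>Unlike for the contour form, the prescribed degrees are needed for uniqueness: the rows
  \<open>h\<close> with \<open>lam h = 0\<close> may coincide with other rows.\<close>

definition rodrigues_components ::
  "nat \<Rightarrow> (nat \<Rightarrow> real) \<Rightarrow> (nat \<Rightarrow> real) \<Rightarrow> real \<Rightarrow> (nat \<Rightarrow> nat) \<Rightarrow> nat \<Rightarrow> (nat \<Rightarrow> real)
     \<Rightarrow> (nat \<Rightarrow> nat) \<Rightarrow> (nat \<Rightarrow> real poly) \<Rightarrow> bool" where
  "rodrigues_components r rho d a lam p xi m B \<longleftrightarrow>
     B \<in> poly_vectors {1..Suc r} lam \<and>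
     (\<forall>t. rodrigues r rho d a lam p xi m t =
          (\<Sum>j=1..Suc r. poly (B j) t * hermite_row r rho d a j t))"

section \<open>The connection matrix\<close>

fun hermite :: "nat \<Rightarrow> complex poly" where
  "hermite 0 = 1"
| "hermite (Suc 0) = [:0, 1:]"
| "hermite (Suc (Suc k)) = [:0, 1:] * hermite (Suc k) - Polynomial.smult (of_nat (Suc k) / 2) (hermite k)"

lemma hermite_generating_function:
  "(\<lambda>l. poly (hermite l) u * z ^ l / fact l) sums exp (u * z - z\<^sup>2 / 4)"
proof -
  define f where "f = (\<lambda>z::complex. exp (u * z - z\<^sup>2 / 4))"
  define G where "G = fps_expansion f 0"
  have f: "f has_fps_expansion G"
    unfolding G_def
    by (rule has_fps_expansion_fps_expansion[of UNIV]) (auto simp: f_def intro!: holomorphic_intros)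
  have "deriv f has_fps_expansion fps_deriv G"
    by (rule has_fps_expansion_deriv[OF f])
  moreover have "deriv f = (\<lambda>z. (u - (1/2) * z) * f z)"
    unfolding f_def
    by (rule ext, rule DERIV_imp_deriv) (auto intro!: derivative_eq_intros simp: field_simps)
  moreover have "(\<lambda>z. (u - (1/2) * z) * f z) has_fps_expansion
                   (fps_const u - fps_const (1/2) * fps_X) * G"
    by (intro fps_expansion_intros f)
  ultimately have ode: "fps_deriv G = (fps_const u - fps_const (1/2) * fps_X) * G"
    using fps_expansion_unique_complex by metis
  have G0: "fps_nth G 0 = 1"
    using has_fps_expansion_imp_0_eq_fps_nth_0[OF f] by (simp add: f_def)
  have rec: "of_nat (Suc k) * fps_nth G (Suc k) =
               u * fps_nth G k - (if k = 0 then 0 else fps_nth G (k - 1) / 2)" for k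
    using arg_cong[OF ode, of "\<lambda>F. fps_nth F k"]
    by (auto simp: ring_distribs mult.assoc left_diff_distrib simp del: of_nat_Suc)
  have "poly (hermite l) u = fact l * fps_nth G l" for l
  proof (induction l rule: hermite.induct)
    case 1
    then show ?case by (simp add: G0)
  next
    case 2
    then show ?case using rec[of 0] by (simp add: G0)
  next
    case (3 k)
    have "fact (Suc (Suc k)) * fps_nth G (Suc (Suc k)) =
            fact (Suc k) * (of_nat (Suc (Suc k)) * fps_nth G (Suc (Suc k)))"
      by (simp add: algebra_simps)
    also have "\<dots> = fact (Suc k) * (u * fps_nth G (Suc k) - fps_nth G k / 2)"
      using rec[of "Suc k"] by simp
    finally show ?case using 3 by (simp add: algebra_simps add_divide_distrib)
  qed
  moreover have "(\<lambda>l. fps_nth G l * z ^ l) sums f z"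
  proof (rule has_fps_expansion_imp_sums_complex[OF f, of \<infinity>])
    show "f holomorphic_on eball 0 \<infinity>"
      by (auto simp: f_def intro!: holomorphic_intros)
  qed auto
  ultimately show ?thesis by (simp add: f_def)
qed

definition diff_op :: "complex poly \<Rightarrow> (complex \<Rightarrow> complex) \<Rightarrow> complex \<Rightarrow> complex" where
  "diff_op P f z = (\<Sum>l\<le>Polynomial.degree P. Polynomial.coeff P l * (deriv ^^ l) f z)"

definition Lambda ::
  "nat \<Rightarrow> (nat \<Rightarrow> real) \<Rightarrow> (nat \<Rightarrow> real) \<Rightarrow> real \<Rightarrow> nat \<Rightarrow> complex \<Rightarrow> complex" where
  "Lambda r rho d a j z =
     (if j \<le> r then of_real (rho j) / (of_real (rho j) + z) * laplaceF r rho d a z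
      else laplaceF r rho d a z)"

definition Phi ::
  "nat \<Rightarrow> (nat \<Rightarrow> real) \<Rightarrow> (nat \<Rightarrow> real) \<Rightarrow> real \<Rightarrow> (nat \<Rightarrow> nat) \<Rightarrow> nat \<Rightarrow> nat \<Rightarrow> complex \<Rightarrow> complex"
  where
  "Phi r rho d a lam j k z =
     Dpoly r rho lam z / laplaceF r rho d a z * diff_op (hermite k) (Lambda r rho d a j) z"

definition lex_columns :: "nat \<Rightarrow> (nat \<Rightarrow> nat) \<Rightarrow> (nat \<times> nat) list" where
  "lex_columns q lam = concat (map (\<lambda>j. map (Pair j) [0..<lam j]) [1..<Suc q])"

definition column_pos :: "(nat \<Rightarrow> nat) \<Rightarrow> nat \<Rightarrow> nat \<Rightarrow> nat" where
  "column_pos lam j k = (\<Sum>i=1..<j. lam i) + k"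

lemma length_lex_columns: "length (lex_columns q lam) = (\<Sum>j=1..q. lam j)"
  by (induction q) (auto simp: lex_columns_def)

lemma lex_columns_nth_column_pos:
  assumes "j \<in> {1..q}" "k < lam j"
  shows "lex_columns q lam ! column_pos lam j k = (j, k)"
  using assms
proof (induction q)
  case (Suc q)
  have eq: "lex_columns (Suc q) lam = lex_columns q lam @ map (Pair (Suc q)) [0..<lam (Suc q)]"
    by (simp add: lex_columns_def)
  show ?case
  proof (cases "j = Suc q")
    case True
    then have "column_pos lam j k = length (lex_columns q lam) + k"
      by (simp add: column_pos_def length_lex_columns atLeastLessThanSuc_atLeastAtMost)
    then show ?thesis using Suc.prems True by (simp add: eq nth_append)
  next
    case False
    then have j: "j \<in> {1..q}" using Suc.prems by auto
    have "column_pos lam j k < (\<Sum>i=1..<Suc j. lam i)"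
      using j Suc.prems by (simp add: column_pos_def)
    also have "\<dots> \<le> (\<Sum>i=1..q. lam i)"
      using j by (intro sum_mono2) auto
    finally show ?thesis
      using Suc.IH[OF j] Suc.prems by (simp add: eq nth_append length_lex_columns)
  qed
qed simp

text \<open>The coefficient \<open>[z\<^sup>\<nu>] \<Phi>\<close> is the Taylor coefficient at \<open>0\<close>, a point of the half-plane where
  \<^const>\<open>laplaceF\<close> is given by a convergent integral.\<close>

definition connection_matrix ::
  "nat \<Rightarrow> (nat \<Rightarrow> real) \<Rightarrow> (nat \<Rightarrow> real) \<Rightarrow> real \<Rightarrow> (nat \<Rightarrow> nat) \<Rightarrow> complex mat" where
  "connection_matrix r rho d a lam =
     (let N = \<Sum>j=1..Suc r. lam j in
      Matrix.mat N N (\<lambda>(\<nu>, c). case lex_columns (Suc r) lam ! c of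
        (j, k) \<Rightarrow> fps_nth (fps_expansion (Phi r rho d a lam j k) 0) \<nu>))"

definition p_vector :: "nat \<Rightarrow> nat \<Rightarrow> (nat \<Rightarrow> real) \<Rightarrow> (nat \<Rightarrow> nat) \<Rightarrow> complex Matrix.vec" where
  "p_vector N p xi m = Matrix.vec N (Polynomial.coeff (\<Prod>i=1..p. [:of_real (xi i), -1:] ^ m i))"

end

theory Submission
  imports Defs "HOL-Probability.Probability"
begin

text \<open>
  The Laplace transform turns \<open>\<Sum>\<^sub>j B\<^sub>j U\<^sub>j\<close>, where \<open>deg B\<^sub>j < \<lambda>\<^sub>j\<close>, into \<open>(L\<^sub>F / D\<^sub>n) \<Psi>(B)\<close> with a polynomial
  \<open>\<Psi>(B)\<close> of degree less than \<open>N\<close>, and \<open>\<Psi>\<close> is a linear bijection: a nonzero \<open>B\<close> is detected either by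
  the order of \<open>\<Psi>(B)\<close> at some \<open>- \<rho>\<^sub>h\<close> or by its degree.  The \<open>B\<close>-problem then asks that
  \<open>p(z) = \<Prod>\<^sub>i (\<xi>\<^sub>i - z)^m\<^sub>i\<close> divide \<open>\<Psi>(B)\<close>, which for degree reasons means \<open>\<Psi>(B) = c p\<close>; the Rodrigues function
  has the transform \<open>(L\<^sub>F / D\<^sub>n) p\<close>.  The connection matrix is the matrix of \<open>\<Psi>\<close> in the Hermite basis, so Cramer's
  rule expresses the leading coefficients of \<open>\<Psi>\<^sup>-\<^sup>1(p)\<close> by the determinants of the criterion.  The \<open>A\<close>-problem
  asks that the functional \<open>f \<mapsto> \<Sum>\<^sub>i A\<^sub>i(\<partial>) f(\<xi>\<^sub>i)\<close> annihilate \<open>(L\<^sub>F / D\<^sub>n) P\<close> whenever \<open>deg P < N\<close>.  Choosing \<open>P\<close>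
  with prescribed zeros at the nodes shows that a nonzero solution has full degrees, and the sum of the
  residues of \<open>f D\<^sub>n / (L\<^sub>F p)\<close> is such a functional, because \<open>P / p\<close> decays like \<open>z\<^sup>-\<^sup>2\<close>.
\<close>

text \<open>Admissibility enters twice. The exponents of the poles \<open>rho h + z\<close> must
  survive \<open>k\<close> differentiations, which compares \<open>lam j\<close> with
  \<open>lam h\<close>; and the numerators must have degree below \<open>N\<close>, which compares
  \<open>lam j\<close> with the last entry. Rates are known to differ only where
  \<open>lam h > 0\<close>. If some derivative of a row \<open>h\<close> with \<open>h\<close> at
  most \<open>r\<close> occurs, then \<open>lam h\<close> is at least two and admissibility makes
  all entries positive, so all rates differ; otherwise the numerators of these rows are 1.
  Transforms are computed for real exponents by Fubini and carried to the half-plane by the identity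
  theorem; equality of transforms returns to equality of functions through characteristic functions.
  The derivatives in the Rodrigues function are controlled by a module over the polynomials in
  \<open>t\<close>, generated by the rows and closed under differentiation. That the product of
  \<open>K\<close>-operators inside the Rodrigues function lies in this module rests on the
  surjectivity of \<open>Psi\<close>. The exponent 2 in the decay of \<open>P / p\<close> is the gap
  between \<open>N + 1\<close> and \<open>N - 1\<close>.\<close>

hide_const (open) Module.module.smult

abbreviation pole_factor :: "real \<Rightarrow> real poly" where
  "pole_factor c \<equiv> [:c, 1:]"

section \<open>Numerators of the derivatives of the transformed rows\<close>

lemma degree_prod_pole_factor_power:
  "finite S \<Longrightarrow> degree (\<Prod>h\<in>S. pole_factor (c h) ^ k h) = (\<Sum>h\<in>S. k h)"
  by (subst degree_prod_eq_sum_degree) (auto simp: degree_power_eq)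

lemma monic_prod_pole_factor: "lead_coeff (\<Prod>h\<in>S. pole_factor (c h) ^ k h) = 1"
  by (simp add: lead_coeff_prod lead_coeff_power)

locale hermite_system =
  fixes r :: nat and rho d :: "nat \<Rightarrow> real" and a :: real
  assumes rho_pos: "\<And>h. h \<in> {1..r} \<Longrightarrow> rho h > 0"
    and d_nonneg: "\<And>h. h \<in> {1..r} \<Longrightarrow> d h \<ge> 0"
begin

definition pole_poly :: "real poly" where
  "pole_poly = (\<Prod>h=1..r. pole_factor (rho h))"

definition pole_cofactor :: "nat \<Rightarrow> real poly" where
  "pole_cofactor h = (\<Prod>h'\<in>{1..r}-{h}. pole_factor (rho h'))"

definition row_const :: "nat \<Rightarrow> real" where
  "row_const j = (if j \<le> r then rho j else 1)"

definition row_pole :: "nat \<Rightarrow> real poly" where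
  "row_pole j = (if j \<le> r then pole_factor (rho j) else 1)"

text \<open>\<open>log_deriv_poly / pole_poly\<close> is the logarithmic derivative of \<open>L\<^sub>F\<close>.\<close>

definition log_deriv_poly :: "real poly" where
  "log_deriv_poly = [:a, 1/2:] * pole_poly - (\<Sum>h=1..r. smult (d h) (pole_cofactor h))"

text \<open>Numerators of the derivatives of the rows:
  \<open>\<Lambda>\<^sub>j\<^sup>(\<^sup>k\<^sup>) = row_const j * L\<^sub>F * deriv_numerator j k / (row_pole j * pole_poly ^ k)\<close>.\<close>

fun deriv_numerator :: "nat \<Rightarrow> nat \<Rightarrow> real poly" where
  "deriv_numerator j 0 = 1"
| "deriv_numerator j (Suc k) = pole_poly * pderiv (deriv_numerator j k) +
     (log_deriv_poly - (if j \<le> r then pole_cofactor j else 0) - smult (real k) (pderiv pole_poly))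
       * deriv_numerator j k"

lemma pole_poly_split: "h \<in> {1..r} \<Longrightarrow> pole_poly = pole_factor (rho h) * pole_cofactor h"
  unfolding pole_poly_def pole_cofactor_def by (rule prod.remove) simp_all

lemma degree_pole_poly: "degree pole_poly = r"
  using degree_prod_pole_factor_power[of "{1..r}" rho "\<lambda>_. 1"] by (simp add: pole_poly_def)

lemma monic_pole_poly: "coeff pole_poly r = 1"
  using monic_prod_pole_factor[of rho "\<lambda>_. 1" "{1..r}"] degree_pole_poly by (simp add: pole_poly_def)

lemma degree_pole_cofactor: "degree (pole_cofactor h) \<le> r"
proof -
  have "degree (pole_cofactor h) = card ({1..r} - {h})"
    using degree_prod_pole_factor_power[of "{1..r}-{h}" rho "\<lambda>_. 1"] by (simp add: pole_cofactor_def)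
  also have "\<dots> \<le> card {1..r}" by (rule card_mono) auto
  finally show ?thesis by simp
qed

text \<open>Only the summand \<open>z / 2\<close> of the logarithmic derivative, which comes from
  the Gaussian factor \<open>exp (z^2 / 4)\<close>, reaches degree \<open>Suc r\<close> after
  multiplication by \<open>pole_poly\<close>. This makes the growth of
  \<open>deriv_numerator\<close> independent of the rates and exponents.\<close>

lemma log_deriv_step:
  fixes j k :: nat
  defines "Q \<equiv> log_deriv_poly - (if j \<le> r then pole_cofactor j else 0) - smult (real k) (pderiv pole_poly)"
  shows "degree Q = Suc r" "coeff Q (Suc r) = 1/2"
proof -
  have c: "coeff (pole_cofactor h) (Suc r) = 0" for h
    using degree_pole_cofactor[of h] by (intro coeff_eq_0) auto
  have p: "coeff (pderiv pole_poly) (Suc r) = 0"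
    by (intro coeff_eq_0) (auto simp: degree_pderiv degree_pole_poly)
  have w: "coeff pole_poly (Suc r) = 0" by (intro coeff_eq_0) (simp add: degree_pole_poly)
  show 1: "coeff Q (Suc r) = 1/2"
    using c p w monic_pole_poly by (simp add: Q_def log_deriv_poly_def coeff_sum)
  have "degree ([:a, 1/2:] * pole_poly) \<le> Suc r"
    using degree_mult_le[of "[:a,1/2:]" pole_poly] by (simp add: degree_pole_poly)
  moreover have "degree (\<Sum>h=1..r. smult (d h) (pole_cofactor h)) \<le> Suc r"
    by (intro degree_sum_le) (auto intro!: le_trans[OF degree_smult_le] le_SucI degree_pole_cofactor)
  moreover have "degree (smult (real k) (pderiv pole_poly)) \<le> Suc r"
    by (rule le_trans[OF degree_smult_le]) (simp add: degree_pderiv degree_pole_poly)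
  moreover have "degree (if j \<le> r then pole_cofactor j else 0) \<le> Suc r"
    using degree_pole_cofactor[of j] by auto
  ultimately have "degree Q \<le> Suc r"
    unfolding Q_def log_deriv_poly_def by (intro degree_diff_le)
  with 1 show "degree Q = Suc r"
    by (metis le_antisym le_degree zero_neq_numeral div_0 divide_eq_0_iff zero_neq_one)
qed

text \<open>The summand with \<open>pderiv\<close> loses a degree, so each step multiplies the
  leading term by \<open>z ^ Suc r / 2\<close>.\<close>

lemma degree_deriv_numerator:
  "degree (deriv_numerator j k) = k * Suc r" "coeff (deriv_numerator j k) (k * Suc r) = (1/2) ^ k"
proof (induction k)
  case (Suc k)
  define Q where "Q = log_deriv_poly - (if j \<le> r then pole_cofactor j else 0)
    - smult (real k) (pderiv pole_poly)"
  note Q = log_deriv_step[where j = j and k = k, folded Q_def]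
  have R: "deriv_numerator j (Suc k) = pole_poly * pderiv (deriv_numerator j k) + Q * deriv_numerator j k"
    by (simp add: Q_def)
  have l: "degree (pole_poly * pderiv (deriv_numerator j k)) < Suc k * Suc r"
    using degree_mult_le[of pole_poly "pderiv (deriv_numerator j k)"] Suc.IH(1)
    by (simp add: degree_pderiv degree_pole_poly)
  have c: "coeff (Q * deriv_numerator j k) (Suc k * Suc r) = (1/2) ^ Suc k"
  proof -
    have "Suc k * Suc r = degree Q + degree (deriv_numerator j k)" using Suc.IH(1) Q(1) by simp
    then have "coeff (Q * deriv_numerator j k) (Suc k * Suc r) =
        coeff Q (degree Q) * coeff (deriv_numerator j k) (degree (deriv_numerator j k))"
      by (simp only: coeff_mult_degree_sum)
    then show ?thesis unfolding Q(1) Suc.IH(1) Q(2) Suc.IH(2) by simp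
  qed
  have "degree (Q * deriv_numerator j k) \<le> Suc k * Suc r"
    using degree_mult_le[of Q "deriv_numerator j k"] Suc.IH(1) Q(1) by simp
  then have le: "degree (deriv_numerator j (Suc k)) \<le> Suc k * Suc r"
    unfolding R using l by (intro degree_add_le) auto
  show *: "coeff (deriv_numerator j (Suc k)) (Suc k * Suc r) = (1/2) ^ Suc k"
    unfolding R coeff_add c using coeff_eq_0[OF l] by simp
  have "coeff (deriv_numerator j (Suc k)) (Suc k * Suc r) \<noteq> 0" unfolding * by simp
  with le show "degree (deriv_numerator j (Suc k)) = Suc k * Suc r"
    by (intro antisym le_degree)
qed auto

lemma pole_cofactor_nonzero:
  assumes "inj_on rho {1..r}" "h \<in> {1..r}"
  shows "poly (pole_cofactor h) (- rho h) \<noteq> 0"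
proof -
  have "poly (pole_factor (rho i)) (- rho h) \<noteq> 0" if i: "i \<in> {1..r} - {h}" for i
    using inj_onD[OF assms(1), of i h] i assms(2) by auto
  then show ?thesis unfolding pole_cofactor_def poly_prod by (subst prod_zero_iff) blast+
qed

text \<open>The transform of row \<open>h\<close> behaves at \<open>- rho h\<close> like
  \<open>(rho h + z) powr - (d h + 1)\<close>. Passing from the derivative \<open>k\<close> to
  \<open>Suc k\<close> therefore multiplies the leading coefficient by
  \<open>- (d h + 1 + k)\<close>, which is nonzero because \<open>d h\<close> is nonnegative;
  distinct rates keep the other factors nonzero there.\<close>

lemma deriv_numerator_nonzero:
  assumes inj: "inj_on rho {1..r}" and h: "h \<in> {1..r}"
  shows "poly (deriv_numerator h k) (- rho h) \<noteq> 0"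
proof (induction k)
  case (Suc k)
  define w where "w = poly (pole_cofactor h) (- rho h)"
  have W: "poly pole_poly (- rho h) = 0" by (simp add: pole_poly_split[OF h])
  have "poly (pderiv pole_poly) (- rho h) = w"
    unfolding pole_poly_split[OF h] pderiv_mult w_def by (simp add: pderiv_pCons)
  moreover have "poly (pole_cofactor i) (- rho h) = (if i = h then w else 0)" if "i \<in> {1..r}" for i
  proof (cases "i = h")
    case False
    then have "\<exists>x\<in>{1..r}-{i}. poly (pole_factor (rho x)) (- rho h) = 0" using h by (intro bexI[of _ h]) auto
    then have "poly (pole_cofactor i) (- rho h) = 0"
      unfolding pole_cofactor_def poly_prod by (intro prod_zero) blast+
    then show ?thesis using False by simp
  qed (simp add: w_def)
  then have "(\<Sum>i=1..r. d i * poly (pole_cofactor i) (- rho h)) = d h * w"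
    using h by (simp add: if_distrib[of "\<lambda>x. _ * x"] sum.delta cong: if_cong)
  ultimately have "poly (deriv_numerator h (Suc k)) (- rho h)
      = - (d h + 1 + real k) * w * poly (deriv_numerator h k) (- rho h)"
    using h W by (simp add: log_deriv_poly_def poly_sum w_def algebra_simps)
  moreover have "d h + 1 + real k > 0" using d_nonneg[OF h] by simp
  moreover have "w \<noteq> 0" using pole_cofactor_nonzero[OF inj h] by (simp add: w_def)
  ultimately show ?case using Suc by simp
qed simp

end

lemma smult_sum_right: "smult c (sum f A) = (\<Sum>x\<in>A. smult c (f x))"
  by (induction A rule: infinite_finite_induct) (auto simp: smult_add_right)

section \<open>The map \<open>Psi\<close> on polynomial vectors and its injectivity\<close>

locale hermite_index = hermite_system +
  fixes lam :: "nat \<Rightarrow> nat"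
  assumes admissible: "laguerre_admissible (Suc r) lam"
    and rho_distinct: "inj_on rho {h \<in> {1..r}. lam h > 0}"
begin

abbreviation (input) "row_indices \<equiv> {1..Suc r}"

definition N :: nat where "N = (\<Sum>j\<in>row_indices. lam j)"

text \<open>The power of \<open>rho h + z\<close> left over when \<open>D_n\<close> clears the
  denominator of the \<open>k\<close>-th derivative of \<open>Lambda_j\<close>: each differentiation
  costs one power at every pole, and row \<open>j\<close> itself has one more pole at its own rate.
  The truncated subtraction is exact by \<open>exponent_sum\<close>.\<close>

definition pole_exponent :: "nat \<Rightarrow> nat \<Rightarrow> nat \<Rightarrow> nat" where
  "pole_exponent j k h = lam h - k - (if h = j then 1 else 0)"

definition index_poly :: "real poly" where
  "index_poly = (\<Prod>h=1..r. pole_factor (rho h) ^ lam h)"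

definition index_cofactor :: "nat \<Rightarrow> nat \<Rightarrow> real poly" where
  "index_cofactor j k = (\<Prod>h=1..r. pole_factor (rho h) ^ pole_exponent j k h)"

text \<open>For \<open>k < lam j\<close> this is \<open>D_n / L_F\<close> times the
  \<open>k\<close>-th derivative of \<open>Lambda_j\<close>, as
  \<open>transform_power_U_row_poly\<close> will show.\<close>

definition row_poly :: "nat \<Rightarrow> nat \<Rightarrow> real poly" where
  "row_poly j k = smult (row_const j) (index_cofactor j k * deriv_numerator j k)"

definition Psi :: "(nat \<Rightarrow> real poly) \<Rightarrow> real poly" where
  "Psi B = (\<Sum>j\<in>row_indices. \<Sum>k<lam j. smult (coeff (B j) k) (row_poly j k))"

lemma lam_le: "j \<in> row_indices \<Longrightarrow> h \<in> row_indices \<Longrightarrow> lam j \<le> lam h + 1"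
  using admissible unfolding laguerre_admissible_def by blast

text \<open>For \<open>h = j\<close> this is \<open>k < lam j\<close>; for \<open>h\<close>
  different from \<open>j\<close> it is admissibility, as \<open>k\<close> is at most
  \<open>lam j - 1\<close> and hence at most \<open>lam h\<close>.\<close>

lemma exponent_sum:
  assumes "j \<in> row_indices" "k < lam j" "h \<in> {1..r}"
  shows "pole_exponent j k h + k + (if h = j then 1 else 0) = lam h"
  using assms lam_le[of j h] by (auto simp: pole_exponent_def)

lemma row_const_nonzero: "j \<in> row_indices \<Longrightarrow> row_const j \<noteq> 0"
  using rho_pos[of j] by (auto simp: row_const_def)

lemma index_cofactor_mult:
  assumes "j \<in> row_indices" "k < lam j"
  shows "index_cofactor j k * (row_pole j * pole_poly ^ k) = index_poly"
proof -
  have "row_pole j = (\<Prod>h=1..r. pole_factor (rho h) ^ (if h = j then 1 else 0))"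
  proof (cases "j \<le> r")
    case True
    then have "(\<Prod>h=1..r. pole_factor (rho h) ^ (if h = j then 1 else 0)) =
        (\<Prod>h=1..r. if h = j then pole_factor (rho h) else 1)" by (intro prod.cong) auto
    then show ?thesis using True assms by (simp add: row_pole_def)
  qed (auto simp: row_pole_def intro!: prod.neutral[symmetric])
  then have "index_cofactor j k * (row_pole j * pole_poly ^ k) =
     (\<Prod>h=1..r. pole_factor (rho h) ^ (pole_exponent j k h + k + (if h = j then 1 else 0)))"
    by (simp add: index_cofactor_def pole_poly_def prod_power_distrib power_add prod.distrib mult_ac)
  also have "\<dots> = index_poly"
    unfolding index_poly_def by (intro prod.cong refl) (use exponent_sum[OF assms] in auto)
  finally show ?thesis .
qed

lemma row_poly_nonzero: "j \<in> row_indices \<Longrightarrow> row_poly j k \<noteq> 0"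
  using degree_deriv_numerator(2)[of j k]
  by (auto simp: row_poly_def row_const_nonzero index_cofactor_def)

text \<open>The \<open>k\<close> differentiations take \<open>k\<close> powers from each of the
  \<open>r\<close> poles and give the numerator \<open>k * Suc r\<close> degrees, a net gain of
  \<open>k\<close>; a row \<open>j\<close> with \<open>j\<close> at most \<open>r\<close> has spent
  one further pole factor.\<close>

lemma degree_row_poly:
  assumes "j \<in> row_indices" "k < lam j"
  shows "degree (row_poly j k) + (if j \<le> r then 1 else 0) = (\<Sum>h=1..r. lam h) + k"
proof -
  have "deriv_numerator j k \<noteq> 0" using degree_deriv_numerator(2)[of j k] by auto
  moreover have "index_cofactor j k \<noteq> 0" by (simp add: index_cofactor_def)
  ultimately have "degree (row_poly j k) = (\<Sum>h=1..r. pole_exponent j k h) + k * Suc r"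
    using row_const_nonzero[OF assms(1)]
    by (simp add: row_poly_def degree_mult_eq degree_deriv_numerator index_cofactor_def
        degree_prod_pole_factor_power)
  moreover have "(\<Sum>h=1..r. lam h) = (\<Sum>h=1..r. pole_exponent j k h + k + (if h = j then 1 else 0))"
    by (intro sum.cong refl) (use exponent_sum[OF assms] in auto)
  moreover have "(\<Sum>h=1..r. if h = j then 1 else 0) = (if j \<le> r then 1 else (0::nat))"
    using assms by (simp add: sum.delta)
  ultimately show ?thesis by (simp add: sum.distrib algebra_simps)
qed

lemma N_split: "N = (\<Sum>h=1..r. lam h) + lam (Suc r)"
  by (simp add: N_def)

text \<open>For \<open>j\<close> at most \<open>r\<close>, admissibility allows \<open>lam j\<close>
  to exceed the last entry by one; the extra pole factor spent in \<open>degree_row_poly\<close>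
  pays for exactly this one.\<close>

lemma degree_row_poly_less:
  assumes "j \<in> row_indices" "k < lam j"
  shows "degree (row_poly j k) < N"
proof (cases "j \<le> r")
  case True
  then have "lam j \<le> lam (Suc r) + 1" using assms lam_le[of j "Suc r"] by auto
  then show ?thesis using degree_row_poly[OF assms] assms True by (simp add: N_split)
next
  case False
  then have "j = Suc r" using assms by auto
  then show ?thesis using degree_row_poly[OF assms] assms by (simp add: N_split)
qed

lemma Psi_add: "Psi (\<lambda>j. A j + B j) = Psi A + Psi B"
  by (simp add: Psi_def sum.distrib smult_add_left)

lemma Psi_smult: "Psi (\<lambda>j. smult c (B j)) = smult c (Psi B)"
  unfolding Psi_def smult_sum_right coeff_smult smult_smult ..

lemma degree_Psi_less: "N \<ge> 1 \<Longrightarrow> degree (Psi B) < N"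
  unfolding Psi_def
  by (intro degree_sum_less)
     (auto intro!: le_less_trans[OF degree_smult_le] degree_row_poly_less)

text \<open>For \<open>k > 0\<close> the entry \<open>lam h\<close> is at least 2, so admissibility
  makes every entry positive and \<open>rho_distinct\<close> covers all rates; for
  \<open>k = 0\<close> the numerator is 1.\<close>

lemma row_numerator_nonzero:
  assumes h: "h \<in> {1..r}" and k: "k < lam h"
  shows "poly (deriv_numerator h k) (- rho h) \<noteq> 0"
proof (cases "k = 0")
  case False
  then have "lam h \<ge> 2" using k by simp
  then have "lam i > 0" if "i \<in> {1..r}" for i using lam_le[of h i] that h by auto
  then have "{i \<in> {1..r}. lam i > 0} = {1..r}" by blast
  then have "inj_on rho {1..r}" using rho_distinct by simp
  then show ?thesis using h by (rule deriv_numerator_nonzero)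
qed simp

text \<open>A nonzero \<open>B\<close> of maximal component length \<open>M\<close>: if row \<open>h \<le> r\<close> attains it, then
  \<open>row_poly h (M - 1)\<close> alone has the smallest order of vanishing at \<open>- rho h\<close>; if only the last row does,
  then \<open>row_poly (Suc r) (M - 1)\<close> alone has the largest degree.\<close>

lemma Psi_eq_0_imp:
  assumes B: "B \<in> poly_vectors row_indices lam" and Psi: "Psi B = 0"
  shows "B = 0"
proof (rule ccontr)
  assume "B \<noteq> 0"
  \<comment> \<open>The number of coefficients, so that a zero component is told apart from a
    constant one.\<close>
  define len where "len j = (if B j = 0 then 0 else Suc (degree (B j)))" for j
  define M where "M = Max (len ` row_indices)"
  define S where "S = (SIGMA j:row_indices. {..<lam j})"
  define T where "T = (\<lambda>(j, k). smult (coeff (B j) k) (row_poly j k))"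
  have finS: "finite S" by (simp add: S_def)
  have sumT: "(\<Sum>x\<in>S. T x) = 0"
    using Psi unfolding Psi_def S_def T_def by (subst sum.Sigma[symmetric]) auto
  have len_le: "len j \<le> M" if "j \<in> row_indices" for j using that by (auto simp: M_def)
  have "\<exists>j. B j \<noteq> 0" using \<open>B \<noteq> 0\<close> by (auto simp: fun_eq_iff)
  then obtain j0 where j0: "B j0 \<noteq> 0" "j0 \<in> row_indices" using B by (auto simp: poly_vectors_def)
  then have M: "M > 0" using len_le[of j0] by (auto simp: len_def)
  have less_len: "k < len j" if "coeff (B j) k \<noteq> 0" for j k
    using that le_degree[OF that] by (auto simp: len_def)
  have len_lam: "len j \<le> lam j" for j
    using B by (auto simp: poly_vectors_def len_def Suc_le_eq)
  have attained: "T (j, M - 1) \<noteq> 0" "(j, M - 1) \<in> S" if "len j = M" "j \<in> row_indices" for j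
  proof -
    have "B j \<noteq> 0" "M - 1 = degree (B j)" using that M by (auto simp: len_def split: if_splits)
    then show "T (j, M - 1) \<noteq> 0" using row_poly_nonzero[OF that(2)] by (simp add: T_def)
    show "(j, M - 1) \<in> S" using len_lam[of j] that M by (simp add: S_def)
  qed
  have remove: "T x = - (\<Sum>y\<in>S - {x}. T y)" if "x \<in> S" for x
    using sumT sum.remove[OF finS that, of T] by (simp add: eq_neg_iff_add_eq_0)
  show False
  proof (cases "\<exists>h\<in>{1..r}. len h = M")
    case True
    then obtain h where h: "h \<in> {1..r}" "len h = M" by blast
    then have hr: "h \<in> row_indices" and lamh: "M \<le> lam h" using len_lam[of h] by auto
    \<comment> \<open>The order at \<open>- rho h\<close> of the index cofactor of
      \<open>row_poly h (M - 1)\<close>. Every other nonzero term has \<open>k < M - 1\<close>, or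
      \<open>k = M - 1\<close> in another row, and so keeps at least one more factor.\<close>
    define e where "e = lam h - M"
    have div: "pole_factor (rho h) ^ Suc e dvd T x" if "x \<in> S - {(h, M - 1)}" for x
    proof -
      obtain j k where x: "x = (j, k)" by force
      show ?thesis
      proof (cases "coeff (B j) k = 0")
        case False
        have jk: "j \<in> row_indices" using that x by (auto simp: S_def)
        have "k < M" using less_len[OF False] len_le[OF jk] by simp
        then have "Suc e \<le> pole_exponent j k h"
          using that lamh by (auto simp: x e_def pole_exponent_def)
        then have "pole_factor (rho h) ^ Suc e dvd pole_factor (rho h) ^ pole_exponent j k h"
          by (rule le_imp_power_dvd)
        also have "\<dots> dvd index_cofactor j k"
          unfolding index_cofactor_def by (rule dvd_prodI) (use h in auto)
        finally show ?thesis by (simp add: x T_def row_poly_def dvd_smult)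
      qed (simp add: x T_def)
    qed
    have "pole_factor (rho h) ^ Suc e dvd T (h, M - 1)"
      unfolding remove[OF attained(2)[OF h(2) hr]] dvd_minus_iff by (rule dvd_sum) (use div in auto)
    then have dvd1: "pole_factor (rho h) ^ Suc e dvd index_cofactor h (M - 1) * deriv_numerator h (M - 1)"
      using attained(1)[OF h(2) hr] row_const_nonzero[OF hr]
      by (auto simp: T_def row_poly_def dvd_smult_iff)
    define rest where "rest = (\<Prod>i\<in>{1..r}-{h}. pole_factor (rho i) ^ pole_exponent h (M - 1) i)"
    have "pole_exponent h (M - 1) h = e" using M by (simp add: pole_exponent_def e_def)
    then have "index_cofactor h (M - 1) = pole_factor (rho h) ^ e * rest"
      unfolding index_cofactor_def rest_def by (subst prod.remove[of _ h]) (use h in auto)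
    with dvd1 have "pole_factor (rho h) ^ e * pole_factor (rho h) dvd pole_factor (rho h) ^ e * (rest * deriv_numerator h (M - 1))"
      by (simp only: power_Suc2 mult.assoc)
    then have "pole_factor (rho h) dvd rest * deriv_numerator h (M - 1)"
      by (subst (asm) dvd_mult_cancel_left) simp
    then have "poly (rest * deriv_numerator h (M - 1)) (- rho h) = 0"
      unfolding poly_eq_0_iff_dvd by (simp only: minus_minus)
    moreover have "poly rest (- rho h) \<noteq> 0"
    proof -
      have "poly (pole_factor (rho i) ^ pole_exponent h (M - 1) i) (- rho h) \<noteq> 0" if i: "i \<in> {1..r} - {h}" for i
      \<comment> \<open>A rate with \<open>lam i = 0\<close> may coincide with \<open>rho h\<close>,
        but its exponent here is 0.\<close>
      proof (cases "lam i > 0")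
        case True
        have "lam h > 0" using M lamh by simp
        then have "rho i \<noteq> rho h" using True i h inj_onD[OF rho_distinct, of i h] by auto
        then show ?thesis by simp
      qed (simp add: pole_exponent_def)
      then show ?thesis by (simp add: rest_def poly_prod)
    qed
    moreover have "poly (deriv_numerator h (M - 1)) (- rho h) \<noteq> 0"
      using M lamh by (intro row_numerator_nonzero[OF h(1)]) simp
    ultimately show False by simp
  next
    case False
    have "M \<in> len ` row_indices" unfolding M_def by (rule Max_in) auto
    then obtain j1 where "j1 \<in> row_indices" "len j1 = M" by auto
    with False have last: "len (Suc r) = M" by (cases "j1 = Suc r") auto
    \<comment> \<open>The degree of \<open>row_poly (Suc r) (M - 1)\<close>. Rows \<open>j\<close>
      with \<open>j\<close> at most \<open>r\<close> stay below it because their length is less than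
      \<open>M\<close> in this case.\<close>
    define D where "D = (\<Sum>h=1..r. lam h) + (M - 1)"
    have c: "coeff (T x) D = 0" if x: "x \<in> S - {(Suc r, M - 1)}" for x
    proof -
      obtain j k where jk: "x = (j, k)" by force
      have j: "j \<in> row_indices" and k: "k < lam j" using x jk by (auto simp: S_def)
      show ?thesis
      proof (cases "coeff (B j) k = 0")
        case nz: False
        have "k < len j" using less_len[OF nz] .
        moreover have "len j < M" if "j \<le> r" using False len_le[of j] j that by (force simp: le_less)
        ultimately have "degree (row_poly j k) < D"
          using degree_row_poly[OF j k]
        proof (cases "j \<le> r")
          case False
          then have "j = Suc r" using j by simp
          then have "k < M - 1" using x jk last \<open>k < len j\<close> by auto
          then show ?thesis using degree_row_poly[OF j k] False by (simp add: D_def)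
        qed (auto simp: D_def)
        then show ?thesis by (simp add: jk T_def coeff_eq_0)
      qed (simp add: jk T_def)
    qed
    have "coeff (T (Suc r, M - 1)) D = - (\<Sum>y\<in>S - {(Suc r, M - 1)}. coeff (T y) D)"
      by (subst remove[OF attained(2)[OF last]]) (auto simp: coeff_sum)
    also have "\<dots> = 0" using c by (simp add: sum.neutral)
    finally have 0: "coeff (T (Suc r, M - 1)) D = 0" .
    have "M - 1 < lam (Suc r)" using last M len_lam[of "Suc r"] by auto
    then have "degree (row_poly (Suc r) (M - 1)) = D"
      using degree_row_poly[of "Suc r" "M - 1"] by (simp add: D_def)
    then have "coeff (T (Suc r, M - 1)) D = coeff (B (Suc r)) (M - 1) * lead_coeff (row_poly (Suc r) (M - 1))"
      by (simp add: T_def)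
    moreover have "T (Suc r, M - 1) \<noteq> 0" using attained(1)[OF last] by simp
    ultimately show False using 0 by (auto simp: T_def)
  qed
qed

end

section \<open>Hermite polynomials over the reals and the numbering of the columns\<close>

fun hermite_real :: "nat \<Rightarrow> real poly" where
  "hermite_real 0 = 1"
| "hermite_real (Suc 0) = [:0, 1:]"
| "hermite_real (Suc (Suc k)) =
     [:0, 1:] * hermite_real (Suc k) - smult (real (Suc k) / 2) (hermite_real k)"

lemma hermite_of_real: "hermite k = map_poly of_real (hermite_real k)"
proof (induction k rule: hermite.induct)
  case (3 k)
  have "hermite (Suc (Suc k)) =
      [:0, 1:] * map_poly of_real (hermite_real (Suc k)) -
      smult (of_real (real (Suc k) / 2)) (map_poly of_real (hermite_real k))"
    using 3 by simp
  also have "\<dots> = map_poly of_real (hermite_real (Suc (Suc k)))"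
    by (rule poly_eqI) (simp add: coeff_map_poly coeff_pCons split: nat.split)
  finally show ?case .
qed (auto simp: poly_eq_iff coeff_map_poly coeff_pCons split: nat.split)

lemma hermite_real_monic: "degree (hermite_real k) = k \<and> coeff (hermite_real k) k = 1"
proof (induction k rule: hermite_real.induct)
  case (3 k)
  have l: "degree (smult (real (Suc k) / 2) (hermite_real k)) < Suc (Suc k)"
    by (rule le_less_trans[OF degree_smult_le]) (use 3 in simp)
  have "degree ([:0, 1:] * hermite_real (Suc k)) \<le> Suc (Suc k)"
    using degree_mult_le[of "[:0, 1::real:]" "hermite_real (Suc k)"] 3 by simp
  then have le: "degree (hermite_real (Suc (Suc k))) \<le> Suc (Suc k)"
    unfolding hermite_real.simps using l by (intro degree_diff_le) auto
  have c: "coeff (hermite_real (Suc (Suc k))) (Suc (Suc k)) = 1"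
    unfolding hermite_real.simps coeff_diff using coeff_eq_0[OF l] 3 by simp
  then have "Suc (Suc k) \<le> degree (hermite_real (Suc (Suc k)))"
    by (intro le_degree) simp
  with le show ?case by (intro conjI antisym[of "degree _"] c)
qed auto

text \<open>Since the Hermite polynomials are monic, the top coefficient of a component is its last
  Hermite coordinate. This is why the criterion replaces the columns
  \<open>(j, lam j - 1)\<close>.\<close>

lemma coeff_hermite_sum_top:
  "coeff (\<Sum>k<Suc n. smult (b k) (hermite_real k)) n = b n"
proof -
  have "coeff (hermite_real k) n = 0" if "k < n" for k
    using hermite_real_monic[of k] that by (intro coeff_eq_0) simp
  then show ?thesis using hermite_real_monic[of n] by (simp add: coeff_sum)
qed

lemma hermite_real_independent:
  "(\<Sum>k<n. smult (b k) (hermite_real k)) = 0 \<Longrightarrow> k < n \<Longrightarrow> b k = 0"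
proof (induction n)
  case (Suc n)
  have "b n = 0" using coeff_hermite_sum_top[of b n] unfolding Suc.prems(1) by simp
  then show ?case using Suc by (auto simp: less_Suc_eq)
qed simp

lemma degree_hermite_sum: "n > 0 \<Longrightarrow> degree (\<Sum>k<n. smult (b k) (hermite_real k)) < n"
  by (intro degree_sum_less) (auto intro!: le_less_trans[OF degree_smult_le] simp: hermite_real_monic)

lemma sum_column_pos:
  fixes g :: "nat \<Rightarrow> 'a::comm_monoid_add"
  shows "(\<Sum>c<(\<Sum>j=1..q. lam j). g c) = (\<Sum>j=1..q. \<Sum>k<lam j. g (column_pos lam j k))"
proof (induction q)
  case (Suc q)
  have split: "(\<Sum>c<s + l. g c) = (\<Sum>c<s. g c) + (\<Sum>k<l. g (s + k))" for s l
    by (induction l) (auto simp: add.assoc)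
  show ?case
    using Suc by (simp add: split column_pos_def atLeastLessThanSuc_atLeastAtMost)
qed simp

lemma column_pos_less:
  assumes "j \<in> {1..q}" "k < lam j"
  shows "column_pos lam j k < (\<Sum>j=1..q. lam j)"
proof -
  have "column_pos lam j k < (\<Sum>i=1..<Suc j. lam i)"
    using assms by (simp add: column_pos_def)
  also have "\<dots> \<le> (\<Sum>i=1..q. lam i)"
    using assms by (intro sum_mono2) auto
  finally show ?thesis .
qed

lemma column_pos_surj:
  assumes "c < (\<Sum>j=1..q. lam j)"
  obtains j k where "j \<in> {1..q}" "k < lam j" "c = column_pos lam j k"
  using assms
proof (induction q arbitrary: thesis)
  case (Suc q)
  show ?case
  proof (cases "c < (\<Sum>j=1..q. lam j)")
    case True
    then show ?thesis using Suc.IH Suc.prems(1) by (metis atLeastAtMost_iff le_SucI)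
  next
    case False
    then have "c = column_pos lam (Suc q) (c - (\<Sum>j=1..q. lam j))"
      by (simp add: column_pos_def atLeastLessThanSuc_atLeastAtMost)
    then show ?thesis using Suc.prems False by (intro Suc.prems(1)[of "Suc q"]) auto
  qed
qed simp

section \<open>Surjectivity of \<open>Psi\<close> and Cramer's rule\<close>

context hermite_index
begin

text \<open>For \<open>P\<close> of degree below \<open>lam j\<close> this is
  \<open>D_n / L_F\<close> times \<open>P(d/dz) Lambda_j\<close>; for the Hermite polynomial of
  index \<open>k\<close> it is \<open>Phi_{j,k}\<close>.\<close>

definition row_map :: "nat \<Rightarrow> real poly \<Rightarrow> real poly" where
  "row_map j P = (\<Sum>k<lam j. smult (coeff P k) (row_poly j k))"

text \<open>The connection matrix has real entries (\<open>connection_matrix_eq\<close>). Working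
  with this real version keeps the linear algebra on the real polynomial vectors in which the two
  problems are posed.\<close>

definition real_matrix :: "real mat" where
  "real_matrix = Matrix.mat N N (\<lambda>(\<nu>, c). case lex_columns (Suc r) lam ! c of
     (j, k) \<Rightarrow> coeff (row_map j (hermite_real k)) \<nu>)"

definition combine :: "real Matrix.vec \<Rightarrow> nat \<Rightarrow> real poly" where
  "combine v j = (if j \<in> row_indices
     then \<Sum>k<lam j. smult (vec_index v (column_pos lam j k)) (hermite_real k) else 0)"

lemma Psi_row_map: "Psi B = (\<Sum>j\<in>row_indices. row_map j (B j))"
  by (simp add: Psi_def row_map_def)

lemma row_map_sum: "row_map j (\<Sum>x\<in>A. smult (c x) (P x)) = (\<Sum>x\<in>A. smult (c x) (row_map j (P x)))"
proof -
  have "row_map j (\<Sum>x\<in>A. smult (c x) (P x)) =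
      (\<Sum>k<lam j. \<Sum>x\<in>A. smult (c x) (smult (coeff (P x) k) (row_poly j k)))"
    unfolding row_map_def coeff_sum by (simp add: smult_sum)
  also have "\<dots> = (\<Sum>x\<in>A. smult (c x) (row_map j (P x)))"
    unfolding row_map_def smult_sum_right by (rule sum.swap)
  finally show ?thesis .
qed

lemma combine_in: "combine v \<in> poly_vectors row_indices lam"
  unfolding poly_vectors_def
proof (clarify, intro conjI)
  fix j assume nz: "combine v j \<noteq> 0"
  then show "j \<in> row_indices" unfolding combine_def by presburger
  then have "lam j > 0" using nz by (auto simp: combine_def intro: Nat.gr0I)
  then show "degree (combine v j) < lam j"
    using degree_hermite_sum[of "lam j"] \<open>j \<in> row_indices\<close> by (simp add: combine_def)
qed

lemma real_matrix_carrier [simp]: "real_matrix \<in> carrier_mat N N"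
  by (simp add: real_matrix_def)

lemma real_matrix_mult_vec:
  assumes v: "v \<in> carrier_vec N" and nu: "\<nu> < N"
  shows "vec_index (real_matrix *\<^sub>v v) \<nu> = coeff (Psi (combine v)) \<nu>"
proof -
  let ?g = "\<lambda>c. real_matrix $$ (\<nu>, c) * vec_index v c"
  have "vec_index (real_matrix *\<^sub>v v) \<nu> = (\<Sum>c<N. ?g c)"
    using v nu by (simp add: real_matrix_def scalar_prod_def atLeast0LessThan)
  also have "\<dots> = (\<Sum>j\<in>row_indices. \<Sum>k<lam j. ?g (column_pos lam j k))"
    unfolding N_def by (rule sum_column_pos)
  also have "\<dots> = (\<Sum>j\<in>row_indices. \<Sum>k<lam j.
      coeff (row_map j (hermite_real k)) \<nu> * vec_index v (column_pos lam j k))"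
  proof (intro sum.cong refl, goal_cases)
    case (1 j k)
    then have jk: "j \<in> {1..Suc r}" "k < lam j" by auto
    have "real_matrix $$ (\<nu>, column_pos lam j k) = coeff (row_map j (hermite_real k)) \<nu>"
      using nu column_pos_less[of j "Suc r" k lam, OF jk] lex_columns_nth_column_pos[of j "Suc r" k lam, OF jk]
      by (simp add: real_matrix_def N_def)
    then show ?case by simp
  qed
  also have "\<dots> = (\<Sum>j\<in>row_indices. coeff (row_map j (combine v j)) \<nu>)"
    by (intro sum.cong refl) (simp add: combine_def row_map_sum coeff_sum mult.commute)
  finally show ?thesis by (simp only: Psi_row_map coeff_sum)
qed

lemma coeff_Psi_eq_0: "i \<ge> N \<Longrightarrow> coeff (Psi B) i = 0"
proof (cases "N \<ge> 1")
  \<comment> \<open>For \<open>N = 0\<close> a degree cannot be below \<open>N\<close>, since the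
    zero polynomial has degree 0; but then all \<open>lam j\<close> vanish and \<open>Psi B\<close>
    is an empty sum.\<close>
  case False
  have "lam j = 0" if "j \<in> row_indices" for j
    using False that member_le_sum[of j row_indices lam] by (auto simp: N_def)
  then show ?thesis by (simp add: Psi_def del: sum.cl_ivl_Suc)
next
  case True
  assume "i \<ge> N"
  then show ?thesis using degree_Psi_less[OF True, of B] by (intro coeff_eq_0) simp
qed

text \<open>A kernel vector is the list of Hermite coordinates of some \<open>B\<close> with
  \<open>Psi B = 0\<close>, so injectivity of \<open>Psi\<close> and independence of the Hermite
  polynomials make it zero.\<close>

lemma det_real_matrix: "det real_matrix \<noteq> 0"
proof
  assume "det real_matrix = 0"
  then obtain v where v: "v \<in> carrier_vec N" "v \<noteq> 0\<^sub>v N" "real_matrix *\<^sub>v v = 0\<^sub>v N"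
    using det_0_iff_vec_prod_zero_field[OF real_matrix_carrier] by blast
  have "Psi (combine v) = 0"
  proof (rule poly_eqI)
    fix i show "coeff (Psi (combine v)) i = coeff 0 i"
      using real_matrix_mult_vec[OF v(1), of i] v(3) coeff_Psi_eq_0[of i] by (cases "i < N") auto
  qed
  then have 0: "combine v = 0" using Psi_eq_0_imp combine_in by blast
  have "vec_index v c = 0" if "c < N" for c
  proof -
    have "c < (\<Sum>j\<in>row_indices. lam j)" using that by (simp only: N_def)
    then obtain j k where jk: "j \<in> row_indices" "k < lam j" "c = column_pos lam j k"
      using column_pos_surj by blast
    have "(\<Sum>k<lam j. smult (vec_index v (column_pos lam j k)) (hermite_real k)) = 0"
      using fun_cong[OF 0, of j] jk(1) by (simp add: combine_def)
    from hermite_real_independent[OF this jk(2)] show ?thesis using jk(3) by simp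
  qed
  then have "v = 0\<^sub>v N" using v(1) by (intro eq_vecI) auto
  with v(2) show False by simp
qed

text \<open>The inverse matrix is written through the adjugate. The bound on \<open>P\<close> is put
  on the coefficients instead of the degree so that \<open>N = 0\<close> is covered as well.\<close>

lemma Psi_combine_surj:
  assumes P: "\<And>i. i \<ge> N \<Longrightarrow> coeff P i = 0"
  obtains v where "v \<in> carrier_vec N" "real_matrix *\<^sub>v v = Matrix.vec N (coeff P)" "Psi (combine v) = P"
proof
  define p where "p = Matrix.vec N (coeff P)"
  have p: "p \<in> carrier_vec N" by (simp add: p_def)
  define v where "v = (1 / det real_matrix) \<cdot>\<^sub>v (adj_mat real_matrix *\<^sub>v p)"
  note adj = adj_mat[OF real_matrix_carrier]
  have w: "adj_mat real_matrix *\<^sub>v p \<in> carrier_vec N" using adj(1) p by simp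
  then show v: "v \<in> carrier_vec N" by (simp add: v_def)
  have "real_matrix *\<^sub>v v = (1 / det real_matrix) \<cdot>\<^sub>v (real_matrix *\<^sub>v (adj_mat real_matrix *\<^sub>v p))"
    unfolding v_def using real_matrix_carrier w by (rule mult_mat_vec)
  also have "real_matrix *\<^sub>v (adj_mat real_matrix *\<^sub>v p) = (det real_matrix \<cdot>\<^sub>m 1\<^sub>m N) *\<^sub>v p"
    using assoc_mult_mat_vec[OF real_matrix_carrier adj(1) p] adj(2) by simp
  also have "\<dots> = det real_matrix \<cdot>\<^sub>v p" using p by (intro eq_vecI) auto
  finally show eq: "real_matrix *\<^sub>v v = Matrix.vec N (coeff P)"
    using det_real_matrix p by (simp add: smult_smult_assoc p_def)
  show "Psi (combine v) = P"
  proof (rule poly_eqI)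
    fix i show "coeff (Psi (combine v)) i = coeff P i"
      using real_matrix_mult_vec[OF v, of i] eq P[of i] coeff_Psi_eq_0[of i] by (cases "i < N") auto
  qed
qed

lemma Psi_inj:
  assumes "A \<in> poly_vectors row_indices lam" "B \<in> poly_vectors row_indices lam" "Psi A = Psi B"
  shows "A = B"
proof -
  have "degree (A i - B i) < lam i \<and> i \<in> row_indices" if "A i - B i \<noteq> 0" for i
  proof -
    have "i \<in> row_indices \<and> 0 < lam i" using assms(1,2) that unfolding poly_vectors_def
      by (cases "A i = 0") (auto intro: Nat.gr0I)
    moreover have "degree (A i) < lam i" "degree (B i) < lam i"
      using assms(1,2) calculation unfolding poly_vectors_def by (cases "A i = 0"; cases "B i = 0"; auto)+
    ultimately show ?thesis using degree_diff_less by blast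
  qed
  then have "(\<lambda>i. A i - B i) \<in> poly_vectors row_indices lam" by (auto simp: poly_vectors_def)
  moreover have "Psi (\<lambda>i. A i - B i) = 0"
    using Psi_add[of "\<lambda>i. A i - B i" B] assms(3) by simp
  ultimately have "(\<lambda>i. A i - B i) = 0" by (rule Psi_eq_0_imp)
  then show ?thesis by (auto simp: fun_eq_iff)
qed

lemma Psi_surj:
  assumes "\<And>i. i \<ge> N \<Longrightarrow> coeff P i = 0"
  obtains B where "B \<in> poly_vectors row_indices lam" "Psi B = P"
  using Psi_combine_surj[of P] assms combine_in by metis

text \<open>Cramer's rule for the Hermite coordinates of \<open>B\<close>; the coordinate at the
  replaced column is the top coefficient by \<open>coeff_hermite_sum_top\<close>.\<close>

lemma det_replace_col_real_matrix:
  assumes B: "B \<in> poly_vectors row_indices lam" and j: "j \<in> row_indices" "lam j > 0"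
  shows "det (replace_col real_matrix (Matrix.vec N (coeff (Psi B))) (column_pos lam j (lam j - 1)))
     = coeff (B j) (lam j - 1) * det real_matrix"
proof -
  obtain v where v: "v \<in> carrier_vec N" "real_matrix *\<^sub>v v = Matrix.vec N (coeff (Psi B))"
      "Psi (combine v) = Psi B"
    using Psi_combine_surj[of "Psi B"] coeff_Psi_eq_0 by metis
  have "B = combine v" using Psi_inj[OF B combine_in] v(3) by simp
  then have "coeff (B j) (lam j - 1) = vec_index v (column_pos lam j (lam j - 1))"
    using coeff_hermite_sum_top[of "\<lambda>k. vec_index v (column_pos lam j k)" "lam j - 1"] j by (simp add: combine_def)
  moreover have "column_pos lam j (lam j - 1) < N"
    using column_pos_less[of j "Suc r" "lam j - 1" lam] j by (simp add: N_def)
  ultimately show ?thesis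
    using cramer_lemma_mat[OF real_matrix_carrier v(1), of "column_pos lam j (lam j - 1)"] v(2) by simp
qed

end

section \<open>Two-sided Laplace transforms\<close>

definition transform :: "(real \<Rightarrow> real) \<Rightarrow> complex \<Rightarrow> complex" where
  "transform f z = (LBINT t. exp (z * of_real t) * of_real (f t))"

text \<open>Absolute convergence of the transform at \<open>z\<close> depends on \<open>Re z\<close>
  only, so it is demanded on a set of real exponents; the transform then lives on the strip over
  that set.\<close>

definition transformable :: "real set \<Rightarrow> (real \<Rightarrow> real) \<Rightarrow> bool" where
  "transformable X f \<longleftrightarrow> f \<in> borel_measurable borel \<and> (\<forall>x\<in>X. integrable lborel (\<lambda>t. exp (x * t) * f t))"

lemma transformable_measurable: "transformable X f \<Longrightarrow> f \<in> borel_measurable borel"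
  by (simp add: transformable_def)

lemma transformable_integrable: "transformable X f \<Longrightarrow> x \<in> X \<Longrightarrow> integrable lborel (\<lambda>t. exp (x * t) * f t)"
  by (simp add: transformable_def)

lemma transform_integrable:
  assumes f: "transformable X f" and z: "Re z \<in> X"
  shows "integrable lborel (\<lambda>t. exp (z * of_real t) * of_real (f t))"
proof (rule Bochner_Integration.integrable_bound)
  show "integrable lborel (\<lambda>t. exp (Re z * t) * f t)" by (rule transformable_integrable[OF f z])
  note [measurable] = transformable_measurable[OF f]
  show "(\<lambda>t. exp (z * of_real t) * of_real (f t)) \<in> borel_measurable lborel" by measurable
qed (auto simp: norm_mult)

lemma transform_of_real:
  "transform f (of_real x) = of_real (LBINT t. exp (x * t) * f t)"
proof -
  have "transform f (of_real x) = (LBINT t. of_real (exp (x * t) * f t))"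
    unfolding transform_def by (simp only: exp_of_real of_real_mult[symmetric])
  then show ?thesis by (simp only: integral_complex_of_real)
qed

lemma transformable_add:
  "transformable X f \<Longrightarrow> transformable X g \<Longrightarrow> transformable X (\<lambda>t. f t + g t)"
  by (auto simp: transformable_def distrib_left)

lemma transform_add:
  "transformable X f \<Longrightarrow> transformable X g \<Longrightarrow> Re z \<in> X \<Longrightarrow>
    transform (\<lambda>t. f t + g t) z = transform f z + transform g z"
  using Bochner_Integration.integral_add[OF transform_integrable transform_integrable, of X f z X g z]
  by (simp add: transform_def distrib_left)

lemma transformable_scale: "transformable X f \<Longrightarrow> transformable X (\<lambda>t. c * f t)"
  by (auto simp: transformable_def mult.left_commute[of _ c])

lemma transform_scale: "transform (\<lambda>t. c * f t) z = of_real c * transform f z"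
  by (simp add: transform_def mult.left_commute[of _ "of_real c"])

lemma transformable_zero [simp]: "transformable X (\<lambda>_. 0)"
  by (simp add: transformable_def)

lemma transform_zero [simp]: "transform (\<lambda>_. 0) z = 0"
  by (simp add: transform_def)

lemma transformable_sum:
  "(\<And>i. i \<in> I \<Longrightarrow> transformable X (f i)) \<Longrightarrow> transformable X (\<lambda>t. \<Sum>i\<in>I. f i t)"
  by (induction I rule: infinite_finite_induct) (auto intro: transformable_add)

lemma transform_sum:
  "(\<And>i. i \<in> I \<Longrightarrow> transformable X (f i)) \<Longrightarrow> Re z \<in> X \<Longrightarrow>
    transform (\<lambda>t. \<Sum>i\<in>I. f i t) z = (\<Sum>i\<in>I. transform (f i) z)"
proof (induction I rule: infinite_finite_induct)
  case (insert i I)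
  then show ?case
    using transform_add[of X "f i" "\<lambda>t. \<Sum>i\<in>I. f i t" z] by (simp add: transformable_sum)
qed auto

text \<open>Since \<open>X\<close> is open, both \<open>x + e\<close> and \<open>x - e\<close>
  belong to it, and the two exponentials together dominate \<open>exp (e * |t|)\<close>. The spare
  factor absorbs the powers of \<open>t\<close> produced by differentiation.\<close>

lemma transformable_exp_abs:
  assumes "open X" "transformable X f" "x \<in> X"
  obtains e where "e > 0" "integrable lborel (\<lambda>t. exp (x * t) * exp (e * \<bar>t\<bar>) * f t)"
proof -
  from assms obtain e where e: "e > 0" "cball x e \<subseteq> X" by (auto simp: open_contains_cball)
  then have X: "x + e \<in> X" "x - e \<in> X" by (auto simp: dist_real_def subset_iff)
  note [measurable] = transformable_measurable[OF assms(2)]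
  have "integrable lborel (\<lambda>t. exp ((x + e) * t) * \<bar>f t\<bar> + exp ((x - e) * t) * \<bar>f t\<bar>)"
    using transformable_integrable[OF assms(2) X(1), THEN integrable_abs]
      transformable_integrable[OF assms(2) X(2), THEN integrable_abs]
    by (simp add: abs_mult)
  then have "integrable lborel (\<lambda>t. exp (x * t) * exp (e * \<bar>t\<bar>) * f t)"
  proof (rule Bochner_Integration.integrable_bound)
    show "AE t in lborel. norm (exp (x * t) * exp (e * \<bar>t\<bar>) * f t)
        \<le> norm (exp ((x + e) * t) * \<bar>f t\<bar> + exp ((x - e) * t) * \<bar>f t\<bar>)"
    proof (rule AE_I2)
      fix t
      have "exp (x * t) * exp (e * \<bar>t\<bar>) \<le> exp ((x + e) * t) + exp ((x - e) * t)"
        by (cases "t \<ge> 0") (auto simp: exp_add[symmetric] algebra_simps)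
      then have "exp (x * t) * exp (e * \<bar>t\<bar>) * \<bar>f t\<bar> \<le> (exp ((x + e) * t) + exp ((x - e) * t)) * \<bar>f t\<bar>"
        by (rule mult_right_mono) simp
      then show "norm (exp (x * t) * exp (e * \<bar>t\<bar>) * f t)
          \<le> norm (exp ((x + e) * t) * \<bar>f t\<bar> + exp ((x - e) * t) * \<bar>f t\<bar>)"
        by (simp add: abs_mult distrib_right)
    qed
  qed measurable
  with e show ?thesis using that by blast
qed

lemma transformable_times:
  assumes "open X" "transformable X f"
  shows "transformable X (\<lambda>t. t * f t)"
  unfolding transformable_def
proof (intro conjI ballI)
  note [measurable] = transformable_measurable[OF assms(2)]
  show "(\<lambda>t. t * f t) \<in> borel_measurable borel" by measurable
  fix x assume "x \<in> X"
  then obtain e where e: "e > 0" "integrable lborel (\<lambda>t. exp (x * t) * exp (e * \<bar>t\<bar>) * f t)"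
    using transformable_exp_abs[OF assms] by blast
  have "integrable lborel (\<lambda>t. (1 / e) * (exp (x * t) * exp (e * \<bar>t\<bar>) * f t))"
    using e(2) by simp
  then show "integrable lborel (\<lambda>t. exp (x * t) * (t * f t))"
  proof (rule Bochner_Integration.integrable_bound)
    show "AE t in lborel. norm (exp (x * t) * (t * f t)) \<le> norm ((1 / e) * (exp (x * t) * exp (e * \<bar>t\<bar>) * f t))"
    proof (rule AE_I2)
      fix t
      have "\<bar>t\<bar> \<le> (1 / e) * exp (e * \<bar>t\<bar>)"
        using e(1) by (simp add: field_simps) (use exp_ge_add_one_self[of "e * \<bar>t\<bar>"] in linarith)
      then have "\<bar>t\<bar> * (exp (x * t) * \<bar>f t\<bar>) \<le> (1 / e) * exp (e * \<bar>t\<bar>) * (exp (x * t) * \<bar>f t\<bar>)"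
        by (rule mult_right_mono) simp
      then show "norm (exp (x * t) * (t * f t)) \<le> norm ((1 / e) * (exp (x * t) * exp (e * \<bar>t\<bar>) * f t))"
        using e(1) by (simp add: abs_mult mult_ac)
    qed
  qed measurable
qed

text \<open>Differentiation under the integral sign with an explicit error
  \<open>C * norm h\<close>: the remainder of \<open>exp (h * t)\<close> after two Taylor terms is
  at most \<open>exp |Re (h * t)| * |h * t|^2\<close>, and the spare exponential of
  \<open>transformable_exp_abs\<close>, applied to \<open>t * (t * f t)\<close>, makes this
  integrable.\<close>

lemma has_field_derivative_transform:
  assumes X: "open X" and f: "transformable X f" and z: "Re z \<in> X"
  shows "(transform f has_field_derivative transform (\<lambda>t. t * f t) z) (at z)"
proof -
  define x where "x = Re z"
  have x: "x \<in> X" using z by (simp add: x_def)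
  have f2: "transformable X (\<lambda>t. t * (t * f t))" by (intro transformable_times X f)
  obtain e where e: "e > 0" and int: "integrable lborel (\<lambda>t. exp (x * t) * exp (e * \<bar>t\<bar>) * (t * (t * f t)))"
    using transformable_exp_abs[OF X f2 x] by blast
  obtain e' where e': "e' > 0" "ball x e' \<subseteq> X" using X x by (auto simp: open_contains_ball)
  define C where "C = (LBINT t. \<bar>exp (x * t) * exp (e * \<bar>t\<bar>) * (t * (t * f t))\<bar>)"
  \<comment> \<open>\<open>norm h < e\<close> lets the spare exponential absorb
    \<open>exp |Re (h * t)|\<close>, and \<open>norm h < e'\<close> keeps \<open>z + h\<close> in
    the strip.\<close>
  have bound: "norm ((transform f (z + h) - transform f z) / h - transform (\<lambda>t. t * f t) z) \<le> C * norm h"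
    if h: "norm h < min e e'" "h \<noteq> 0" for h
  proof -
    have "\<bar>Re h\<bar> < e'" using abs_Re_le_cmod[of h] h by linarith
    then have zh: "Re (z + h) \<in> X" using e'(2) by (auto simp: x_def dist_real_def subset_iff)
    let ?g = "\<lambda>t. exp (z * of_real t) * (exp (h * of_real t) - 1 - h * of_real t) * of_real (f t)"
    have i1: "integrable lborel (\<lambda>t. exp ((z + h) * of_real t) * of_real (f t))"
      by (rule transform_integrable[OF f zh])
    have i2: "integrable lborel (\<lambda>t. exp (z * of_real t) * of_real (f t))"
      by (rule transform_integrable[OF f z])
    have i3: "integrable lborel (\<lambda>t. exp (z * of_real t) * of_real (t * f t))"
      by (rule transform_integrable[OF transformable_times[OF X f] z])
    have eq: "exp ((z + h) * of_real t) * of_real (f t) - exp (z * of_real t) * of_real (f t)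
        - h * (exp (z * of_real t) * of_real (t * f t)) = ?g t" for t
      by (simp add: distrib_right exp_add algebra_simps)
    have "transform f (z + h) - transform f z - h * transform (\<lambda>t. t * f t) z = (LBINT t. ?g t)"
      unfolding transform_def eq[symmetric] using i1 i2 i3 by simp
    also have "norm \<dots> \<le> (LBINT t. norm (?g t))" by (rule integral_norm_bound)
    also have "\<dots> \<le> (LBINT t. (norm h)\<^sup>2 * \<bar>exp (x * t) * exp (e * \<bar>t\<bar>) * (t * (t * f t))\<bar>)"
    proof (rule integral_mono)
      show "integrable lborel (\<lambda>t. norm (?g t))"
        unfolding eq[symmetric] using i1 i2 i3 by (intro integrable_norm) simp
      show "integrable lborel (\<lambda>t. (norm h)\<^sup>2 * \<bar>exp (x * t) * exp (e * \<bar>t\<bar>) * (t * (t * f t))\<bar>)"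
        using int by simp
      fix t :: real
      have "norm (exp (h * of_real t) - 1 - h * of_real t) \<le> exp \<bar>Re (h * of_real t)\<bar> * (norm (h * of_real t))\<^sup>2"
        using Taylor_exp[of "h * of_real t" 1] by (simp add: numeral_2_eq_2 diff_diff_eq)
      also have "\<dots> \<le> exp (e * \<bar>t\<bar>) * (norm (h * of_real t))\<^sup>2"
      proof (intro mult_right_mono)
        have "\<bar>Re h\<bar> \<le> e" using abs_Re_le_cmod[of h] h by linarith
        then show "exp \<bar>Re (h * of_real t)\<bar> \<le> exp (e * \<bar>t\<bar>)" by (simp add: abs_mult mult_right_mono)
      qed simp
      finally have "norm (exp (h * of_real t) - 1 - h * of_real t) * (exp (x * t) * \<bar>f t\<bar>)
          \<le> exp (e * \<bar>t\<bar>) * (norm (h * of_real t))\<^sup>2 * (exp (x * t) * \<bar>f t\<bar>)"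
        by (rule mult_right_mono) simp
      then show "norm (?g t) \<le> (norm h)\<^sup>2 * \<bar>exp (x * t) * exp (e * \<bar>t\<bar>) * (t * (t * f t))\<bar>"
        by (simp add: norm_mult abs_mult x_def power2_eq_square mult_ac)
    qed
    also have "\<dots> = (norm h)\<^sup>2 * C" by (simp add: C_def)
    finally have main: "norm (transform f (z + h) - transform f z - h * transform (\<lambda>t. t * f t) z) \<le> (norm h)\<^sup>2 * C" .
    have "(transform f (z + h) - transform f z) / h - transform (\<lambda>t. t * f t) z =
        (transform f (z + h) - transform f z - h * transform (\<lambda>t. t * f t) z) / h"
      using h by (simp add: field_simps)
    then show ?thesis using main h by (simp add: norm_divide field_simps power2_eq_square)
  qed
  have "((\<lambda>h. (transform f (z + h) - transform f z) / h - transform (\<lambda>t. t * f t) z) \<longlongrightarrow> 0) (at 0)"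
  proof (rule Lim_null_comparison)
    show "\<forall>\<^sub>F h in at 0. norm ((transform f (z + h) - transform f z) / h - transform (\<lambda>t. t * f t) z) \<le> C * norm h"
      unfolding eventually_at using bound e e' by (intro exI[of _ "min e e'"]) auto
    show "((\<lambda>h. C * norm h) \<longlongrightarrow> 0) (at (0::complex))" by (auto intro!: tendsto_eq_intros)
  qed
  then show ?thesis unfolding DERIV_def by (simp add: LIM_zero_iff)
qed

definition strip :: "real set \<Rightarrow> complex set" where
  "strip X = {z. Re z \<in> X}"

lemma open_strip: "open X \<Longrightarrow> open (strip X)"
  unfolding strip_def using open_vimage[of X Re] by (simp add: vimage_def continuous_on_Re)

lemma convex_strip: "convex X \<Longrightarrow> convex (strip X)"
  unfolding strip_def convex_def by simp

lemma transform_holomorphic: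
  "open X \<Longrightarrow> transformable X f \<Longrightarrow> transform f holomorphic_on strip X"
  using has_field_derivative_transform unfolding holomorphic_on_def strip_def
  by (meson field_differentiable_at_within field_differentiable_def mem_Collect_eq)

text \<open>Through this the powers \<open>t ^ k\<close> in the orthogonality relations become
  derivatives of transforms at the nodes.\<close>

lemma transform_power_eq_higher_deriv:
  assumes X: "open X" and f: "transformable X f"
  shows "transformable X (\<lambda>t. t ^ k * f t) \<and>
    (\<forall>z\<in>strip X. transform (\<lambda>t. t ^ k * f t) z = (deriv ^^ k) (transform f) z)"
proof (induction k)
  case (Suc k)
  then have tr: "transformable X (\<lambda>t. t ^ k * f t)" by simp
  have eq: "(\<lambda>t. t ^ Suc k * f t) = (\<lambda>t. t * (t ^ k * f t))" by (simp add: mult.assoc)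
  show ?case
  proof (intro conjI ballI)
    show "transformable X (\<lambda>t. t ^ Suc k * f t)" unfolding eq by (rule transformable_times[OF X tr])
    fix z assume z: "z \<in> strip X"
    then have "deriv (transform (\<lambda>t. t ^ k * f t)) z = transform (\<lambda>t. t ^ Suc k * f t) z"
      unfolding eq by (intro DERIV_imp_deriv has_field_derivative_transform[OF X tr]) (simp add: strip_def)
    moreover have "deriv (transform (\<lambda>t. t ^ k * f t)) z = deriv ((deriv ^^ k) (transform f)) z"
      using Suc z open_strip[OF X] by (intro deriv_cong_ev) (auto simp: eventually_nhds)
    ultimately show "transform (\<lambda>t. t ^ Suc k * f t) z = (deriv ^^ Suc k) (transform f) z" by simp
  qed
qed (use f in auto)

text \<open>Allows a transform to be computed for real exponents only, where the integrals are real
  and Fubini is easy, and then extended to complex arguments.\<close>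

lemma identity_on_strip:
  assumes X: "open X" "convex X" "x0 \<in> X"
    and hol: "f holomorphic_on strip X" "g holomorphic_on strip X"
    and eq: "\<And>x. x \<in> X \<Longrightarrow> f (of_real x) = g (of_real x)"
    and z: "z \<in> strip X"
  shows "f z = g z"
proof -
  have "f z - g z = 0"
  proof (rule analytic_continuation[of "\<lambda>z. f z - g z" "strip X" "of_real ` X" "of_real x0"])
    show "connected (strip X)" by (intro convex_connected convex_strip X)
    show "complex_of_real x0 islimpt complex_of_real ` X"
      unfolding islimpt_approachable
    proof (intro allI impI)
      fix e :: real assume "e > 0"
      obtain e' where e': "e' > 0" "cball x0 e' \<subseteq> X" using X by (auto simp: open_contains_cball)
      define y where "y = x0 + min e' (e / 2)"
      have "y \<in> X" using e' \<open>e > 0\<close> by (auto simp: y_def dist_real_def subset_iff)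
      moreover have "dist (complex_of_real y) (of_real x0) < e" "y \<noteq> x0"
        using e' \<open>e > 0\<close> by (auto simp: y_def dist_norm simp flip: of_real_diff)
      ultimately show "\<exists>x'\<in>complex_of_real ` X. x' \<noteq> of_real x0 \<and> dist x' (of_real x0) < e" by auto
    qed
    show "(\<lambda>z. f z - g z) holomorphic_on strip X" by (intro holomorphic_intros hol)
    show "of_real ` X \<subseteq> strip X" "complex_of_real x0 \<in> strip X" using X by (auto simp: strip_def)
  qed (use X z eq in \<open>auto intro: open_strip\<close>)
  then show ?thesis by simp
qed

text \<open>The set where \<open>f\<close> is nonzero is open, and a nonempty open set is not a null
  set.\<close>

lemma continuous_AE_zero:
  fixes f :: "real \<Rightarrow> real"
  assumes "continuous_on UNIV f" "AE t in lborel. f t = 0"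
  shows "f t = 0"
proof (rule ccontr)
  assume "f t \<noteq> 0"
  have "open (f -` (- {0}))" using assms(1) by (intro open_vimage) auto
  moreover have "t \<in> f -` (- {0})" using \<open>f t \<noteq> 0\<close> by simp
  moreover have "f -` (- {0}) \<in> null_sets lborel"
  proof -
    have "f \<in> borel_measurable borel" using assms(1) by (rule borel_measurable_continuous_onI)
    then have "f -` (- {0}) \<in> sets lborel" using measurable_sets_borel[of f borel "- {0}"] by simp
    moreover have "emeasure lborel {t. f t \<noteq> 0} = 0"
      using assms(2) by (subst (asm) AE_iff_measurable[OF _ refl]) (use calculation in \<open>auto simp: vimage_def\<close>)
    ultimately show ?thesis by (auto simp: null_sets_def vimage_def)
  qed
  ultimately show False
    using open_not_negligible negligible_iff_null_sets null_sets_completionI by (metis empty_iff)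
qed

text \<open>Adding the standard normal density to the positive and negative parts of \<open>f\<close> turns them into
  probability densities with equal characteristic functions.\<close>

lemma transform_injective:
  assumes f: "continuous_on UNIV f" "integrable lborel f"
    and zero: "\<And>y. transform f (\<i> * of_real y) = 0"
  shows "f t = 0"
proof -
  define g where "g = std_normal_density"
  define pos neg where "pos t = max 0 (f t) + g t" and "neg t = max 0 (- f t) + g t" for t
  have g: "integrable lborel g" "(LBINT t. g t) = 1" "\<And>t. g t \<ge> 0"
    using integrable_std_normal_moment[of 0] integral_std_normal_moment_even[of 0]
    by (auto simp: g_def)
  have [measurable]: "f \<in> borel_measurable borel" "g \<in> borel_measurable borel"
    using f(1) by (auto intro: borel_measurable_continuous_onI simp: g_def)
  have [measurable]: "pos \<in> borel_measurable borel" "neg \<in> borel_measurable borel"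
    by (simp_all add: pos_def[abs_def] neg_def[abs_def])
  have ipos: "integrable lborel pos" and ineg: "integrable lborel neg"
    using f(2) g(1) by (auto simp: pos_def[abs_def] neg_def[abs_def])
  have fpn: "f t = pos t - neg t" for t by (auto simp: pos_def neg_def)
  have nn: "pos t \<ge> 0" "neg t \<ge> 0" for t using g(3) by (auto simp: pos_def neg_def)
  have char_eq: "(LBINT t. exp (\<i> * of_real y * of_real t) * of_real (pos t)) =
      (LBINT t. exp (\<i> * of_real y * of_real t) * of_real (neg t))" for y
  proof -
    have i: "integrable lborel (\<lambda>t. exp (\<i> * of_real y * of_real t) * complex_of_real (h t))"
      if "integrable lborel h" for h :: "real \<Rightarrow> real"
    proof (rule Bochner_Integration.integrable_bound[OF that])
      have [measurable]: "h \<in> borel_measurable borel" using that by auto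
      show "(\<lambda>t. exp (\<i> * of_real y * of_real t) * complex_of_real (h t)) \<in> borel_measurable lborel"
        by measurable
    qed (auto simp: norm_mult)
    have "0 = (LBINT t. exp (\<i> * of_real y * of_real t) * of_real (pos t)
        - exp (\<i> * of_real y * of_real t) * of_real (neg t))"
      using zero[of y] unfolding transform_def fpn by (simp add: right_diff_distrib)
    then show ?thesis using i[OF ipos] i[OF ineg] by simp
  qed
  \<comment> \<open>The common mass of both parts, by the equality of transforms at 0. It is at
    least the mass 1 of the normal density, so division by it is legitimate even if \<open>f\<close>
    vanishes.\<close>
  define c where "c = (LBINT t. pos t)"
  have c2: "(LBINT t. neg t) = c"
    using char_eq[of 0] by (simp add: c_def)
  have "(LBINT t. g t) \<le> c"
    unfolding c_def by (rule integral_mono[OF g(1) ipos]) (simp add: pos_def)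
  then have c: "c > 0" using g(2) by simp
  define M where "M h = density lborel (\<lambda>t. ennreal (h t / c))" for h :: "real \<Rightarrow> real"
  have prob: "real_distribution (M h)"
    if [measurable]: "h \<in> borel_measurable borel" and h: "integrable lborel h" "\<And>t. h t \<ge> 0" "(LBINT t. h t) = c" for h
  proof -
    have "emeasure (M h) UNIV = (\<integral>\<^sup>+t. ennreal (h t / c) \<partial>lborel)"
      unfolding M_def by (subst emeasure_density) (auto intro!: nn_integral_cong)
    also have "\<dots> = ennreal (LBINT t. h t / c)"
      using h c by (intro nn_integral_eq_integral) auto
    also have "\<dots> = 1" using h c by simp
    finally have "prob_space (M h)" by (intro prob_spaceI) (simp add: M_def)
    then show ?thesis by (intro real_distribution.intro real_distribution_axioms.intro) (simp_all add: M_def)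
  qed
  have ch: "char (M h) y = (LBINT t. exp (\<i> * of_real y * of_real t) * of_real (h t)) / of_real c"
    if [measurable]: "h \<in> borel_measurable borel" and h: "\<And>t. h t \<ge> 0" for h y
  proof -
    have "char (M h) y = (LBINT t. (h t / c) *\<^sub>R exp (\<i> * of_real y * of_real t))"
      unfolding char_def M_def using h c
      by (subst integral_density) (auto simp: mult.assoc)
    also have "\<dots> = (LBINT t. exp (\<i> * of_real y * of_real t) * of_real (h t) / of_real c)"
      by (intro Bochner_Integration.integral_cong) (auto simp: scaleR_conv_of_real)
    finally show ?thesis by simp
  qed
  have "M pos = M neg"
  proof (rule Levy_uniqueness)
    show "real_distribution (M pos)" "real_distribution (M neg)"
      using prob[of pos] prob[of neg] nn ipos ineg c2 by (auto simp: c_def)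
    show "char (M pos) = char (M neg)" using ch[of pos] ch[of neg] nn char_eq by (auto simp: fun_eq_iff)
  qed
  then have "AE t in lborel. ennreal (pos t / c) = ennreal (neg t / c)"
    unfolding M_def by (subst (asm) sigma_finite_measure.density_unique_iff[OF sigma_finite_lborel]) auto
  then have "AE t in lborel. f t = 0"
    by eventually_elim (use nn c in \<open>auto simp: fpn\<close>)
  then show ?thesis by (rule continuous_AE_zero[OF f(1)])
qed

section \<open>The operators \<open>K\<close>\<close>

text \<open>The density of the Gamma distribution with shape \<open>d\<close> and rate
  \<open>rho\<close>, extended by 0 to the whole line; the operator \<open>K\<close> averages
  translates of \<open>f\<close> against it.\<close>

definition gamma_kernel :: "real \<Rightarrow> real \<Rightarrow> real \<Rightarrow> real" where
  "gamma_kernel \<rho> d u = indicator {0<..} u * (\<rho> powr d / Gamma d * u powr (d - 1) * exp (- \<rho> * u))"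

lemma gamma_kernel_measurable [measurable]: "gamma_kernel \<rho> d \<in> borel_measurable borel"
  unfolding gamma_kernel_def[abs_def] by measurable

lemma Kop_eq: "d \<noteq> 0 \<Longrightarrow> Kop \<rho> d f t = (LBINT u. gamma_kernel \<rho> d u * f (t + u))"
  unfolding Kop_def gamma_kernel_def set_lebesgue_integral_def
  by (auto intro!: Bochner_Integration.integral_cong simp: indicator_def)

lemma gamma_kernel_nonneg: "d > 0 \<Longrightarrow> gamma_kernel \<rho> d u \<ge> 0"
  by (simp add: gamma_kernel_def Gamma_real_pos less_imp_le)

lemma has_bochner_integral_Gamma:
  assumes "s > 0" "d > (0::real)"
  shows "has_bochner_integral lborel (\<lambda>u. indicator {0<..} u * (u powr (d - 1) * exp (- s * u))) (Gamma d / s powr d)"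
proof -
  let ?g = "\<lambda>t. indicator {0..} t * t powr (d - 1) / exp t"
  have "has_bochner_integral lborel ?g (Gamma d)"
    using Gamma_conv_nn_integral_real[OF assms(2)] assms(2)
    by (intro has_bochner_integral_nn_integral) (auto simp: Gamma_real_pos less_imp_le)
  then have "has_bochner_integral lborel (\<lambda>u. ?g (0 + s * u)) (Gamma d /\<^sub>R \<bar>s\<bar>)"
    using assms by (subst (asm) lborel_has_bochner_integral_real_affine_iff[of s _ _ 0]) auto
  then have "has_bochner_integral lborel (\<lambda>u. s powr (1 - d) * ?g (0 + s * u)) (s powr (1 - d) * (Gamma d /\<^sub>R \<bar>s\<bar>))"
    by (rule has_bochner_integral_mult_right)
  moreover have "s powr (1 - d) * ?g (0 + s * u) = indicator {0<..} u * (u powr (d - 1) * exp (- s * u))" for u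
  proof (cases "u > 0")
    case True
    have "s powr (1 - d) * s powr (d - 1) = 1" using assms by (simp flip: powr_add)
    then show ?thesis using True assms by (simp add: powr_mult exp_minus field_simps)
  next
    case False
    \<comment> \<open>At \<open>u = 0\<close> the two indicators differ, but
      \<open>0 powr (d - 1)\<close> is 0.\<close>
    then show ?thesis using assms by (cases "u = 0") (auto simp: zero_le_mult_iff)
  qed
  moreover have "s powr (1 - d) * (Gamma d /\<^sub>R \<bar>s\<bar>) = Gamma d / s powr d"
    using assms by (simp add: powr_diff field_simps)
  ultimately show ?thesis by simp
qed

lemma has_bochner_integral_gamma_kernel:
  assumes "\<rho> > 0" "d > 0" "x > - \<rho>"
  shows "has_bochner_integral lborel (\<lambda>u. gamma_kernel \<rho> d u * exp (- x * u)) ((\<rho> / (\<rho> + x)) powr d)"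
proof -
  have "has_bochner_integral lborel (\<lambda>u. \<rho> powr d / Gamma d *
      (indicator {0<..} u * (u powr (d - 1) * exp (- (\<rho> + x) * u)))) (\<rho> powr d / Gamma d * (Gamma d / (\<rho> + x) powr d))"
    by (intro has_bochner_integral_mult_right has_bochner_integral_Gamma) (use assms in auto)
  moreover have "\<rho> powr d / Gamma d * (Gamma d / (\<rho> + x) powr d) = (\<rho> / (\<rho> + x)) powr d"
    using assms Gamma_real_pos[OF assms(2), THEN less_imp_neq] by (simp add: powr_divide)
  moreover have "(\<lambda>u. \<rho> powr d / Gamma d * (indicator {0<..} u * (u powr (d - 1) * exp (- (\<rho> + x) * u))))
      = (\<lambda>u. gamma_kernel \<rho> d u * exp (- x * u))"
    by (rule ext) (simp add: gamma_kernel_def exp_add[symmetric] algebra_simps)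
  ultimately show ?thesis by simp
qed

lemma Kop_measurable:
  assumes [measurable]: "f \<in> borel_measurable borel"
  shows "Kop \<rho> d f \<in> borel_measurable borel"
proof (cases "d = 0")
  case True
  then have "Kop \<rho> d f = f" by (simp add: Kop_def fun_eq_iff)
  then show ?thesis by simp
next
  case False
  then have "Kop \<rho> d f = (\<lambda>t. LBINT u. gamma_kernel \<rho> d u * f (t + u))" by (simp add: Kop_eq fun_eq_iff)
  then show ?thesis by simp
qed

text \<open>Translation by \<open>u\<close> multiplies the exponential integral by
  \<open>exp (- x * u)\<close>; by Fubini, averaging over \<open>u\<close> gives the Laplace
  transform of the Gamma density as multiplier, which needs \<open>x > - rho\<close>.\<close>

lemma Kop_exp_integral:
  assumes \<rho>: "\<rho> > 0" and d: "d \<ge> 0" and x: "x > - \<rho>"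
    and f[measurable]: "f \<in> borel_measurable borel" and int: "integrable lborel (\<lambda>t. exp (x * t) * f t)"
  shows "integrable lborel (\<lambda>t. exp (x * t) * Kop \<rho> d f t)"
    and "(LBINT t. exp (x * t) * Kop \<rho> d f t) = (\<rho> / (\<rho> + x)) powr d * (LBINT t. exp (x * t) * f t)"
proof (atomize (full), cases "d = 0")
  case True
  then show "integrable lborel (\<lambda>t. exp (x * t) * Kop \<rho> d f t) \<and>
    (LBINT t. exp (x * t) * Kop \<rho> d f t) = (\<rho> / (\<rho> + x)) powr d * (LBINT t. exp (x * t) * f t)"
    using \<rho> x int by (simp add: Kop_def)
next
  case False
  then have d0: "d > 0" using d by simp
  define g where "g u t = gamma_kernel \<rho> d u * (exp (x * t) * f (t + u))" for u t
  have shift: "has_bochner_integral lborel (\<lambda>t. exp (x * t) * h (t + u)) (exp (- x * u) * (LBINT t. exp (x * t) * h t))"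
    if "integrable lborel (\<lambda>t. exp (x * t) * h t)" for h u
  proof -
    have "has_bochner_integral lborel (\<lambda>t. exp (x * t) * h t) (LBINT t. exp (x * t) * h t)"
      using that by (rule has_bochner_integral_integrable)
    then have "has_bochner_integral lborel (\<lambda>t. exp (x * (u + 1 * t)) * h (u + 1 * t)) ((LBINT t. exp (x * t) * h t) /\<^sub>R \<bar>1\<bar>)"
      by (subst (asm) lborel_has_bochner_integral_real_affine_iff[of 1 _ _ u]) auto
    then have "has_bochner_integral lborel (\<lambda>t. exp (- x * u) * (exp (x * (u + t)) * h (u + t))) (exp (- x * u) * (LBINT t. exp (x * t) * h t))"
      by (intro has_bochner_integral_mult_right) simp_all
    moreover have "exp (- x * u) * (exp (x * (u + t)) * h (u + t)) = exp (x * t) * h (t + u)" for t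
      by (simp add: distrib_left exp_add exp_minus add.commute)
    ultimately show ?thesis by simp
  qed
  have gi: "has_bochner_integral lborel (g u) (gamma_kernel \<rho> d u * exp (- x * u) * (LBINT t. exp (x * t) * f t))" for u
    unfolding g_def mult.assoc by (intro has_bochner_integral_mult_right shift int)
  have iabs: "integrable lborel (\<lambda>t. exp (x * t) * \<bar>f t\<bar>)"
    using integrable_abs[OF int] by (simp add: abs_mult)
  have ga: "(LBINT t. norm (g u t)) = gamma_kernel \<rho> d u * exp (- x * u) * (LBINT t. exp (x * t) * \<bar>f t\<bar>)" for u
  proof -
    have "has_bochner_integral lborel (\<lambda>t. gamma_kernel \<rho> d u * (exp (x * t) * \<bar>f (t + u)\<bar>))
        (gamma_kernel \<rho> d u * (exp (- x * u) * (LBINT t. exp (x * t) * \<bar>f t\<bar>)))"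
      by (intro has_bochner_integral_mult_right shift iabs)
    then show ?thesis
      using gamma_kernel_nonneg[OF d0, of \<rho> u]
      by (simp add: g_def abs_mult has_bochner_integral_iff mult.assoc)
  qed
  note k = has_bochner_integral_gamma_kernel[OF \<rho> d0 x]
  have prod: "integrable (lborel \<Otimes>\<^sub>M lborel) (case_prod g)"
  proof (rule lborel_pair.Fubini_integrable)
    show "case_prod g \<in> borel_measurable (lborel \<Otimes>\<^sub>M lborel)"
      unfolding g_def by measurable
    show "integrable lborel (\<lambda>u. LBINT t. norm (case_prod g (u, t)))"
      using k by (simp add: ga[unfolded real_norm_def] has_bochner_integral_iff)
    show "AE u in lborel. integrable lborel (\<lambda>t. case_prod g (u, t))"
      using gi by (auto simp: has_bochner_integral_iff)
  qed
  have inner: "(LBINT u. g u t) = exp (x * t) * Kop \<rho> d f t" for t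
    using False by (simp add: g_def Kop_eq mult.left_commute[of _ "exp (x * t)"])
  have "integrable lborel (\<lambda>t. exp (x * t) * Kop \<rho> d f t)"
    using lborel_pair.integrable_snd[OF prod] by (simp add: inner)
  moreover have "(LBINT t. exp (x * t) * Kop \<rho> d f t) = (LBINT u. LBINT t. g u t)"
    using lborel_pair.Fubini_integral[OF prod] by (simp add: inner)
  moreover have "\<dots> = (\<rho> / (\<rho> + x)) powr d * (LBINT t. exp (x * t) * f t)"
    using gi k by (simp add: has_bochner_integral_iff)
  ultimately show "integrable lborel (\<lambda>t. exp (x * t) * Kop \<rho> d f t) \<and>
    (LBINT t. exp (x * t) * Kop \<rho> d f t) = (\<rho> / (\<rho> + x)) powr d * (LBINT t. exp (x * t) * f t)" by simp
qed

text \<open>Averaging against a probability density preserves a bound, and the bound serves as the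
  dominating constant when continuity is passed through the integral.\<close>

lemma Kop_continuous_bounded:
  assumes \<rho>: "\<rho> > 0" and d: "d \<ge> 0"
    and f: "continuous_on UNIV f" and M: "\<And>t. \<bar>f t\<bar> \<le> M"
  shows "continuous_on UNIV (Kop \<rho> d f)" "\<bar>Kop \<rho> d f t\<bar> \<le> M"
proof (atomize (full), cases "d = 0")
  case True
  then show "continuous_on UNIV (Kop \<rho> d f) \<and> \<bar>Kop \<rho> d f t\<bar> \<le> M" using f M by (simp add: Kop_def[abs_def])
next
  case False
  then have d0: "d > 0" using d by simp
  have [measurable]: "f \<in> borel_measurable borel" using f by (rule borel_measurable_continuous_onI)
  have k: "has_bochner_integral lborel (gamma_kernel \<rho> d) 1"
    using has_bochner_integral_gamma_kernel[OF \<rho> d0, of 0] \<rho> by simp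
  then have kM: "integrable lborel (\<lambda>u. M * gamma_kernel \<rho> d u)" by (auto simp: has_bochner_integral_iff)
  note nn = gamma_kernel_nonneg[OF d0, of \<rho>]
  have bnd: "norm (gamma_kernel \<rho> d u * f (s + u)) \<le> M * gamma_kernel \<rho> d u" for s u
    using mult_right_mono[OF M[of "s + u"] nn[of u]] nn[of u] by (simp add: abs_mult mult.commute)
  have K: "Kop \<rho> d f t = (LBINT u. gamma_kernel \<rho> d u * f (t + u))" for t
    using False by (simp add: Kop_eq)
  have "(Kop \<rho> d f \<circ> s) \<longlonglongrightarrow> Kop \<rho> d f l" if s: "s \<longlonglongrightarrow> l" for s l
    unfolding K comp_def
  proof (rule integral_dominated_convergence[where w = "\<lambda>u. M * gamma_kernel \<rho> d u"])
    have "(\<lambda>n. f (s n + u)) \<longlonglongrightarrow> f (l + u)" for u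
      by (rule continuous_on_tendsto_compose[OF f]) (auto intro: tendsto_intros s)
    then show "AE u in lborel. (\<lambda>n. gamma_kernel \<rho> d u * f (s n + u)) \<longlonglongrightarrow> gamma_kernel \<rho> d u * f (l + u)"
      by (intro AE_I2 tendsto_intros)
    show "AE u in lborel. norm (gamma_kernel \<rho> d u * f (s n + u)) \<le> M * gamma_kernel \<rho> d u" for n
      using bnd by (intro AE_I2)
  qed (use kM in auto)
  then have "continuous_on UNIV (Kop \<rho> d f)" unfolding continuous_on_sequentially by blast
  moreover have "\<bar>Kop \<rho> d f t\<bar> \<le> (LBINT u. M * gamma_kernel \<rho> d u)"
  proof -
    have "\<bar>Kop \<rho> d f t\<bar> \<le> (LBINT u. norm (gamma_kernel \<rho> d u * f (t + u)))"
      unfolding K using integral_norm_bound[of lborel "\<lambda>u. gamma_kernel \<rho> d u * f (t + u)"] by simp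
    also have "\<dots> \<le> (LBINT u. M * gamma_kernel \<rho> d u)"
    proof (rule integral_mono)
      show "integrable lborel (\<lambda>u. norm (gamma_kernel \<rho> d u * f (t + u)))"
        using bnd by (intro integrable_norm Bochner_Integration.integrable_bound[OF kM])
          (auto intro: order_trans[OF _ abs_ge_self])
    qed (rule kM bnd)+
    finally show ?thesis .
  qed
  ultimately show "continuous_on UNIV (Kop \<rho> d f) \<and> \<bar>Kop \<rho> d f t\<bar> \<le> M"
    using k by (simp add: has_bochner_integral_iff)
qed

text \<open>The operator with exponent one is \<open>\<rho> exp (\<rho> t)\<close> times an antiderivative, so that no smoothness
  of \<open>f\<close> is needed.\<close>

lemma Kop_1_has_real_derivative:
  assumes \<rho>: "\<rho> > 0" and f: "continuous_on UNIV f" "integrable lborel f"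
  shows "(Kop \<rho> 1 f has_real_derivative \<rho> * (Kop \<rho> 1 f t - f t)) (at t)"
proof -
  define h where "h v = exp (- \<rho> * v) * f v" for v
  have hc: "continuous_on S h" for S
    unfolding h_def by (intro continuous_intros continuous_on_subset[OF f(1)]) auto
  have [measurable]: "f \<in> borel_measurable borel" "h \<in> borel_measurable borel"
    using f(1) hc by (auto intro: borel_measurable_continuous_onI)
  have hi: "set_integrable lborel {s<..} h" for s
    unfolding set_integrable_def
  proof (rule Bochner_Integration.integrable_bound)
    show "integrable lborel (\<lambda>v. exp (- \<rho> * s) * f v)" using f(2) by simp
    show "AE v in lborel. norm (indicator {s<..} v *\<^sub>R h v) \<le> norm (exp (- \<rho> * s) * f v)"
      using \<rho> by (intro AE_I2) (auto simp: h_def abs_mult indicator_def intro!: mult_right_mono)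
  qed measurable
  define J where "J s = (LBINT v:{s<..}. h v)" for s
  have K: "Kop \<rho> 1 f s = \<rho> * exp (\<rho> * s) * J s" for s
  proof -
    have "Kop \<rho> 1 f s = (LBINT u. gamma_kernel \<rho> 1 u * f (s + u))" by (simp add: Kop_eq)
    also have "\<dots> = (LBINT u. \<rho> * exp (\<rho> * s) * (indicator {s<..} (s + 1 * u) *\<^sub>R h (s + 1 * u)))"
    proof (intro Bochner_Integration.integral_cong refl)
      fix u show "gamma_kernel \<rho> 1 u * f (s + u) = \<rho> * exp (\<rho> * s) * (indicator {s<..} (s + 1 * u) *\<^sub>R h (s + 1 * u))"
        using \<rho> by (auto simp: gamma_kernel_def h_def indicator_def distrib_left exp_add[symmetric] mult_exp_exp)
    qed
    also have "\<dots> = \<rho> * exp (\<rho> * s) * (LBINT v. indicator {s<..} v *\<^sub>R h v)"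
      using lborel_integral_real_affine[of 1 "\<lambda>v. indicator {s<..} v *\<^sub>R h v" s] by simp
    finally show ?thesis by (simp add: J_def set_lebesgue_integral_def)
  qed
  have Jd: "(J has_real_derivative - h t) (at t)"
  proof -
    \<comment> \<open>Any base point left of \<open>t\<close> would do: near \<open>t\<close> the
      tail integral \<open>J\<close> becomes a constant minus an ordinary integral with variable
      upper limit.\<close>
    define c where "c = t - 1"
    have Jeq: "J s = J c - integral {c..s} h" if s: "s > c" for s
    proof -
      have i: "set_integrable lborel {c..s} h" by (rule borel_integrable_atLeastAtMost') (rule hc)
      then have i': "set_integrable lborel {c<..s} h" by (rule set_integrable_subset) auto
      have "J c = (LBINT v:{c<..s} \<union> {s<..}. h v)"
        unfolding J_def using s by (simp add: ivl_disj_un_one)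
      also have "\<dots> = (LBINT v:{c<..s}. h v) + J s"
        unfolding J_def by (intro set_integral_Un i' hi) auto
      also have "(LBINT v:{c<..s}. h v) = (LBINT v:{c..s}. h v)"
        unfolding set_lebesgue_integral_def
        by (intro integral_cong_AE) (auto intro!: eventually_mono[OF AE_lborel_singleton[of c]] simp: indicator_def)
      also have "\<dots> = integral {c..s} h" by (rule set_borel_integral_eq_integral(2)[OF i])
      finally show ?thesis by simp
    qed
    have "((\<lambda>s. integral {c..s} h) has_real_derivative h t) (at t within {c..t+1})"
      by (rule integral_has_real_derivative[OF hc]) (simp add: c_def)
    then have "((\<lambda>s. integral {c..s} h) has_real_derivative h t) (at t)"
      by (subst (asm) at_within_interior) (auto simp: c_def interior_atLeastAtMost_real)
    then have "((\<lambda>s. J c - integral {c..s} h) has_real_derivative - h t) (at t)"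
      by (auto intro!: derivative_eq_intros)
    then show ?thesis
      by (rule has_field_derivative_transform_within_open[of _ _ _ "{c<..}"]) (auto simp: Jeq c_def)
  qed
  have "((\<lambda>s. \<rho> * exp (\<rho> * s) * J s) has_real_derivative \<rho> * (\<rho> * exp (\<rho> * t) * J t - f t)) (at t)"
    by (rule derivative_eq_intros Jd refl | simp)+
       (simp add: h_def algebra_simps exp_minus)
  then show ?thesis by (simp add: K[abs_def])
qed

section \<open>The Laplace transforms of the rows\<close>

text \<open>Polynomials stay real throughout, because the solution spaces are real; only their
  evaluation is complex.\<close>

definition cpoly :: "real poly \<Rightarrow> complex \<Rightarrow> complex" where
  "cpoly p z = poly (map_poly of_real p) z"

lemma cpoly_0 [simp]: "cpoly 0 z = 0"
  by (simp add: cpoly_def)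

lemma cpoly_1 [simp]: "cpoly 1 z = 1"
  by (simp add: cpoly_def)

lemma cpoly_pCons [simp]: "cpoly (pCons c p) z = of_real c + z * cpoly p z"
  by (simp add: cpoly_def map_poly_pCons)

lemma cpoly_add [simp]: "cpoly (p + q) z = cpoly p z + cpoly q z"
  by (induction p q rule: poly_induct2) (auto simp: algebra_simps)

lemma cpoly_smult [simp]: "cpoly (smult c p) z = of_real c * cpoly p z"
  by (induction p) (auto simp: algebra_simps)

lemma cpoly_minus [simp]: "cpoly (- p) z = - cpoly p z"
  using cpoly_smult[of "-1" p z] by simp

lemma cpoly_diff [simp]: "cpoly (p - q) z = cpoly p z - cpoly q z"
  using cpoly_add[of p "- q" z] by simp

lemma cpoly_mult [simp]: "cpoly (p * q) z = cpoly p z * cpoly q z"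
  by (induction p) (auto simp: algebra_simps)

lemma cpoly_power [simp]: "cpoly (p ^ n) z = cpoly p z ^ n"
  by (induction n) auto

lemma cpoly_sum: "cpoly (\<Sum>i\<in>I. f i) z = (\<Sum>i\<in>I. cpoly (f i) z)"
  by (induction I rule: infinite_finite_induct) auto

lemma cpoly_prod: "cpoly (\<Prod>i\<in>I. f i) z = (\<Prod>i\<in>I. cpoly (f i) z)"
  by (induction I rule: infinite_finite_induct) auto

lemma cpoly_of_real: "cpoly p (of_real x) = of_real (poly p x)"
  by (induction p) auto

lemma has_field_derivative_cpoly [derivative_intros]:
  "(cpoly p has_field_derivative cpoly (pderiv p) z) (at z)"
proof (induction p)
  case (pCons c p)
  have "((\<lambda>z. of_real c + z * cpoly p z) has_field_derivative cpoly p z + z * cpoly (pderiv p) z) (at z)"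
    by (auto intro!: derivative_eq_intros pCons.IH)
  then show ?case by (simp add: pderiv_pCons cpoly_pCons[abs_def] fun_eq_iff)
qed (simp add: cpoly_0[abs_def])

lemma cpoly_holomorphic [holomorphic_intros]: "cpoly p holomorphic_on S"
  unfolding holomorphic_on_def field_differentiable_def
  using has_field_derivative_cpoly has_field_derivative_at_within by blast

lemma prod_list_upt: "(\<Prod>h\<leftarrow>[1..<Suc n]. g h) = (\<Prod>h=1..n. (g h :: 'a::comm_monoid_mult))"
  by (induction n) (simp_all add: mult.commute)

text \<open>The properties that \<open>K\<close> preserves together: the bound is used for
  continuity, transformability for the transform, and continuity for recovering a function from its
  transform.\<close>

definition tame :: "real set \<Rightarrow> (real \<Rightarrow> real) \<Rightarrow> bool" where
  "tame X f \<longleftrightarrow> continuous_on UNIV f \<and> (\<exists>M. \<forall>t. \<bar>f t\<bar> \<le> M) \<and> transformable X f"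

lemma gaussian_eq: "gaussian a t = normal_density a (1 / sqrt 2) t"
  by (simp add: gaussian_def normal_density_def field_simps power_divide real_sqrt_divide)

lemma has_bochner_integral_gaussian: "has_bochner_integral lborel (gaussian a) 1"
  using integrable_normal_density[of "1 / sqrt 2" a] integral_normal_density[of "1 / sqrt 2" a]
  by (simp add: has_bochner_integral_iff gaussian_eq[abs_def])

text \<open>Completing the square: the factor \<open>exp (x * t)\<close> moves the centre of the
  Gaussian from \<open>a\<close> to \<open>a + x / 2\<close>.\<close>

lemma has_bochner_integral_exp_gaussian:
  "has_bochner_integral lborel (\<lambda>t. exp (x * t) * gaussian a t) (exp (a * x + x\<^sup>2 / 4))"
proof -
  have "has_bochner_integral lborel (\<lambda>t. exp (a * x + x\<^sup>2 / 4) * gaussian (a + x / 2) t) (exp (a * x + x\<^sup>2 / 4) * 1)"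
    by (intro has_bochner_integral_mult_right has_bochner_integral_gaussian)
  moreover have "exp (a * x + x\<^sup>2 / 4) * gaussian (a + x / 2) t = exp (x * t) * gaussian a t" for t
    by (simp add: gaussian_def mult_exp_exp field_simps power2_eq_square)
  ultimately show ?thesis by simp
qed

lemma tame_gaussian: "tame X (gaussian a)"
proof -
  have "\<bar>gaussian a t\<bar> \<le> 1 / sqrt pi" for t
    by (simp add: gaussian_def divide_right_mono)
  moreover have "continuous_on UNIV (gaussian a)" unfolding gaussian_def by (intro continuous_intros) auto
  moreover have "integrable lborel (\<lambda>t. exp (x * t) * gaussian a t)" for x
    using has_bochner_integral_exp_gaussian by (auto simp: has_bochner_integral_iff)
  ultimately show ?thesis
    by (auto simp: tame_def transformable_def intro: borel_measurable_continuous_onI)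
qed

lemma tame_scale: "tame X f \<Longrightarrow> tame X (\<lambda>t. c * f t)"
  unfolding tame_def
proof (intro conjI; elim conjE exE)
  fix M assume "\<forall>t. \<bar>f t\<bar> \<le> M"
  then show "\<exists>M. \<forall>t. \<bar>c * f t\<bar> \<le> M" by (intro exI[of _ "\<bar>c\<bar> * M"]) (auto simp: abs_mult mult_left_mono)
qed (auto intro: continuous_intros transformable_scale)

context hermite_system
begin

text \<open>The real trace of the half-plane of convergence; for \<open>r = 0\<close> it is the
  whole line.\<close>

definition reals where "reals = {x. \<forall>h\<in>{1..r}. - rho h < x}"

abbreviation "half_plane \<equiv> strip reals"

lemma open_reals: "open reals"
proof -
  have "reals = (\<Inter>h\<in>{1..r}. {- rho h<..})" by (auto simp: reals_def)
  then show ?thesis by auto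
qed

lemma convex_reals: "convex reals"
proof -
  have "reals = (\<Inter>h\<in>{1..r}. {- rho h<..})" by (auto simp: reals_def)
  then show ?thesis by (auto intro: convex_INT)
qed

lemma zero_reals: "0 \<in> reals"
  using rho_pos by (force simp: reals_def)

lemma reals_gt: "x \<in> reals \<Longrightarrow> h \<in> {1..r} \<Longrightarrow> x + rho h > 0"
  unfolding reals_def by force

lemma open_half_plane: "open half_plane"
  by (rule open_strip[OF open_reals])

lemma tame_Kop:
  assumes h: "h \<in> {1..r}" and e: "e \<ge> 0" and f: "tame reals f"
  shows "tame reals (Kop (rho h) e f)"
    and "x \<in> reals \<Longrightarrow> transform (Kop (rho h) e f) (of_real x) =
      of_real ((rho h / (rho h + x)) powr e) * transform f (of_real x)"
proof -
  note K = Kop_exp_integral[OF rho_pos[OF h] e _ transformable_measurable transformable_integrable, of _ reals f]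
  have x: "- rho h < x" if "x \<in> reals" for x using that h by (auto simp: reals_def)
  have tf: "transformable reals f" using f by (simp add: tame_def)
  obtain M where M: "\<And>t. \<bar>f t\<bar> \<le> M" using f by (auto simp: tame_def)
  have "continuous_on UNIV f" using f by (simp add: tame_def)
  note cb = Kop_continuous_bounded[OF rho_pos[OF h] e this M]
  show "tame reals (Kop (rho h) e f)"
    using cb K(1)[OF x tf tf] Kop_measurable[OF transformable_measurable[OF tf]]
    by (auto simp: tame_def transformable_def)
  show "transform (Kop (rho h) e f) (of_real x) = of_real ((rho h / (rho h + x)) powr e) * transform f (of_real x)"
    if "x \<in> reals" using K(2)[OF x tf tf] that by (simp add: transform_of_real)
qed

text \<open>The scalars \<open>c h\<close> let one induction serve both the generator
  \<open>F\<close> (scalars 1, exponents \<open>d\<close>) and the inner part of the Rodrigues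
  function (scalars \<open>1 / rho h ^ lam h\<close>, exponents \<open>lam\<close>).\<close>

lemma tame_foldr_Kop:
  assumes f: "tame reals f" and e: "\<And>h. h \<in> {1..r} \<Longrightarrow> e h \<ge> 0" and hs: "set hs \<subseteq> {1..r}"
  shows "tame reals (foldr (\<lambda>h g t. c h * Kop (rho h) (e h) g t) hs f) \<and>
    (\<forall>x\<in>reals. transform (foldr (\<lambda>h g t. c h * Kop (rho h) (e h) g t) hs f) (of_real x) =
      (\<Prod>h\<leftarrow>hs. of_real (c h * (rho h / (rho h + x)) powr e h)) * transform f (of_real x))"
  using hs
proof (induction hs)
  case (Cons h hs)
  then have h: "h \<in> {1..r}" by simp
  let ?g = "foldr (\<lambda>h g t. c h * Kop (rho h) (e h) g t) hs f"
  have IH: "tame reals ?g" using Cons by simp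
  show ?case
    using tame_scale[OF tame_Kop(1)[OF h e[OF h] IH], of "c h"] tame_Kop(2)[OF h e[OF h] IH] Cons
    by (simp add: transform_scale mult_ac)
qed (use f in simp)

text \<open>The closed form of \<open>L_F\<close>. The principal logarithms are holomorphic on the
  half-plane because \<open>1 + z / rho h\<close> has positive real part there, and an exponential
  has no zeros, so division by \<open>L\<close> is always harmless.\<close>

definition L :: "complex \<Rightarrow> complex" where
  "L z = exp (of_real a * z + z\<^sup>2 / 4 - (\<Sum>h=1..r. of_real (d h) * Ln (1 + z / of_real (rho h))))"

abbreviation "F \<equiv> generatorF r rho d a"
abbreviation "U \<equiv> hermite_row r rho d a"

lemma L_nonzero [simp]: "L z \<noteq> 0"
  by (simp add: L_def)

lemma half_plane_nonzero:
  assumes "z \<in> half_plane" "h \<in> {1..r}"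
  shows "of_real (rho h) + z \<noteq> 0"
proof
  assume "of_real (rho h) + z = 0"
  then have "Re z = - rho h" by (simp add: complex_eq_iff)
  then show False using assms by (auto simp: strip_def reals_def)
qed

lemma slit_half_plane:
  assumes "z \<in> half_plane" "h \<in> {1..r}"
  shows "1 + z / of_real (rho h) \<notin> \<real>\<^sub>\<le>\<^sub>0"
proof -
  have "Re (1 + z / of_real (rho h)) > 0"
    using assms rho_pos[OF assms(2)] reals_gt[of "Re z" h] by (simp add: strip_def field_simps)
  then show ?thesis using complex_nonpos_Reals_iff by force
qed

lemma has_field_derivative_L:
  assumes z: "z \<in> half_plane"
  shows "(L has_field_derivative L z * (of_real a + z / 2 - (\<Sum>h=1..r. of_real (d h) / (of_real (rho h) + z)))) (at z)"
proof -
  have D: "((\<lambda>z. of_real (d h) * Ln (1 + z / of_real (rho h))) has_field_derivative of_real (d h) / (of_real (rho h) + z)) (at z)"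
    if h: "h \<in> {1..r}" for h
  proof -
    have "1 + z / of_real (rho h) \<noteq> 0" using slit_half_plane[OF z h] by auto
    moreover have "of_real (rho h) + z \<noteq> 0" by (rule half_plane_nonzero[OF z h])
    moreover have "rho h \<noteq> 0" using rho_pos[OF h] by simp
    ultimately show ?thesis
      using slit_half_plane[OF z h]
      by (auto intro!: derivative_eq_intros simp: field_simps)
  qed
  have DS: "((\<lambda>z. \<Sum>h=1..r. of_real (d h) * Ln (1 + z / of_real (rho h))) has_field_derivative
      (\<Sum>h=1..r. of_real (d h) / (of_real (rho h) + z))) (at z)"
    by (rule DERIV_sum[OF D])
  have "((\<lambda>z. of_real a * z + z\<^sup>2 / 4) has_field_derivative of_real a + z / 2) (at z)"
    by (auto intro!: derivative_eq_intros)
  from DERIV_diff[OF this DS] show ?thesis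
    unfolding L_def[abs_def] by (rule DERIV_fun_exp)
qed

lemma L_holomorphic: "L holomorphic_on half_plane"
  using has_field_derivative_L unfolding holomorphic_on_def
  by (meson field_differentiable_at_within field_differentiable_def)

lemma L_of_real:
  assumes x: "x \<in> reals"
  shows "L (of_real x) = of_real (exp (a * x + x\<^sup>2 / 4) * (\<Prod>h=1..r. (rho h / (rho h + x)) powr d h))"
proof -
  have pos: "1 + x / rho h > 0" "rho h + x > 0" "rho h > 0" if "h \<in> {1..r}" for h
    using reals_gt[OF x that] rho_pos[OF that] by (auto simp: field_simps)
  have "Ln (1 + of_real x / of_real (rho h)) = of_real (ln (1 + x / rho h))" if "h \<in> {1..r}" for h
    using Ln_of_real[OF pos(1)[OF that]] by simp
  then have "L (of_real x) = of_real (exp (a * x + x\<^sup>2 / 4 - (\<Sum>h=1..r. d h * ln (1 + x / rho h))))"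
    by (simp add: L_def exp_of_real[symmetric])
  also have "exp (a * x + x\<^sup>2 / 4 - (\<Sum>h=1..r. d h * ln (1 + x / rho h))) =
      exp (a * x + x\<^sup>2 / 4) * (\<Prod>h=1..r. exp (- (d h * ln (1 + x / rho h))))"
  proof -
    have "a * x + x\<^sup>2 / 4 - (\<Sum>h=1..r. d h * ln (1 + x / rho h)) =
        a * x + x\<^sup>2 / 4 + (\<Sum>h=1..r. - (d h * ln (1 + x / rho h)))" by (simp add: sum_negf)
    then show ?thesis by (simp only: exp_add exp_sum[OF finite_atLeastAtMost])
  qed
  also have "(\<Prod>h=1..r. exp (- (d h * ln (1 + x / rho h)))) = (\<Prod>h=1..r. (rho h / (rho h + x)) powr d h)"
  proof (intro prod.cong refl)
    fix h assume h: "h \<in> {1..r}"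
    have "ln (rho h / (rho h + x)) = - ln (1 + x / rho h)"
      using pos[OF h] by (subst ln_inverse[symmetric]) (auto simp: field_simps)
    then show "exp (- (d h * ln (1 + x / rho h))) = (rho h / (rho h + x)) powr d h"
      using pos[OF h] by (simp add: powr_def)
  qed
  finally show ?thesis .
qed

lemma tame_F: "tame reals F"
  and transform_F: "z \<in> half_plane \<Longrightarrow> transform F z = L z"
proof -
  have F: "F = foldr (\<lambda>h g t. 1 * Kop (rho h) (d h) g t) [1..<Suc r] (gaussian a)"
    by (simp add: generatorF_def)
  have *: "tame reals F \<and> (\<forall>x\<in>reals. transform F (of_real x) =
     (\<Prod>h\<leftarrow>[1..<Suc r]. of_real (1 * (rho h / (rho h + x)) powr d h)) * transform (gaussian a) (of_real x))"
    unfolding F by (rule tame_foldr_Kop) (auto simp: tame_gaussian d_nonneg)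
  then show t: "tame reals F" ..
  have "transform F (of_real x) = L (of_real x)" if "x \<in> reals" for x
    using * that has_bochner_integral_exp_gaussian[of x a]
    by (simp add: L_of_real prod_list_upt[unfolded One_nat_def] transform_of_real has_bochner_integral_iff del: upt_Suc)
  moreover have "transform F holomorphic_on half_plane"
    using t by (intro transform_holomorphic open_reals) (simp add: tame_def)
  ultimately show "transform F z = L z" if "z \<in> half_plane"
    by (intro identity_on_strip[OF open_reals convex_reals zero_reals _ L_holomorphic _ that])
qed

lemma laplaceF_eq: "z \<in> half_plane \<Longrightarrow> laplaceF r rho d a z = L z"
  using transform_F by (simp add: laplaceF_def transform_def)

lemma cpoly_row_pole: "cpoly (row_pole j) z = (if j \<le> r then of_real (rho j) + z else 1)"
  by (simp add: row_pole_def)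

lemma row_pole_nonzero: "z \<in> half_plane \<Longrightarrow> j \<ge> 1 \<Longrightarrow> cpoly (row_pole j) z \<noteq> 0"
  using half_plane_nonzero[of z j] by (auto simp: cpoly_row_pole)

lemma pole_poly_nonzero: "z \<in> half_plane \<Longrightarrow> cpoly pole_poly z \<noteq> 0"
  using half_plane_nonzero by (simp add: pole_poly_def cpoly_prod)

lemma tame_U: "j \<ge> 1 \<Longrightarrow> tame reals (U j)"
  using tame_Kop(1)[of j 1, OF _ _ tame_F] tame_F by (simp add: hermite_row_def[abs_def])

lemma transformable_U: "j \<ge> 1 \<Longrightarrow> transformable reals (U j)"
  using tame_U by (simp add: tame_def)

lemma transform_U:
  assumes j: "j \<ge> 1" and z: "z \<in> half_plane"
  shows "transform (U j) z = of_real (row_const j) * L z / cpoly (row_pole j) z"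
proof (rule identity_on_strip[OF open_reals convex_reals zero_reals _ _ _ z])
  show "transform (U j) holomorphic_on half_plane"
    by (rule transform_holomorphic[OF open_reals transformable_U[OF j]])
  show "(\<lambda>z. of_real (row_const j) * L z / cpoly (row_pole j) z) holomorphic_on half_plane"
    using row_pole_nonzero j by (intro holomorphic_intros L_holomorphic) auto
  fix x assume x: "x \<in> reals"
  then have xz: "of_real x \<in> half_plane" by (simp add: strip_def)
  show "transform (U j) (of_real x) = of_real (row_const j) * L (of_real x) / cpoly (row_pole j) (of_real x)"
  proof (cases "j \<le> r")
    case True
    then have jr: "j \<in> {1..r}" using j by simp
    have "rho j + x > 0" using reals_gt[OF x jr] by simp
    then have "(rho j / (rho j + x)) powr 1 = rho j / (rho j + x)" using rho_pos[OF jr] by simp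
    then show ?thesis
      using tame_Kop(2)[OF jr _ tame_F x, of 1] transform_F[OF xz] True
      by (simp add: hermite_row_def[abs_def] row_const_def cpoly_row_pole)
  next
    case False
    then show ?thesis using transform_F[OF xz] by (simp add: hermite_row_def[abs_def] row_const_def cpoly_row_pole)
  qed
qed

lemma cpoly_log_deriv:
  assumes z: "z \<in> half_plane"
  shows "cpoly log_deriv_poly z =
    cpoly pole_poly z * (of_real a + z / 2 - (\<Sum>h=1..r. of_real (d h) / (of_real (rho h) + z)))"
proof -
  have "(\<Sum>h=1..r. of_real (d h) * cpoly (pole_cofactor h) z) =
      (\<Sum>h=1..r. cpoly pole_poly z * (of_real (d h) / (of_real (rho h) + z)))"
  proof (intro sum.cong refl)
    fix h assume h: "h \<in> {1..r}"
    show "of_real (d h) * cpoly (pole_cofactor h) z = cpoly pole_poly z * (of_real (d h) / (of_real (rho h) + z))"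
      unfolding pole_poly_split[OF h] cpoly_mult using half_plane_nonzero[OF z h] by simp
  qed
  then show ?thesis
    by (simp add: log_deriv_poly_def cpoly_sum right_diff_distrib sum_distrib_left algebra_simps)
qed

text \<open>The recursion of \<open>deriv_numerator\<close> is the quotient rule: each derivative
  adds one factor \<open>pole_poly\<close> to the denominator, which clears the poles of the
  logarithmic derivative of \<open>L\<close>.\<close>

lemma transform_power_U:
  assumes j: "j \<ge> 1" and z: "z \<in> half_plane"
  shows "transform (\<lambda>t. t ^ k * U j t) z =
    of_real (row_const j) * L z * cpoly (deriv_numerator j k) z / (cpoly (row_pole j) z * cpoly pole_poly z ^ k)"
  using z
proof (induction k arbitrary: z)
  case (Suc k)
  have tr: "transformable reals (\<lambda>t. t ^ k * U j t)"
    using transform_power_eq_higher_deriv[OF open_reals transformable_U[OF j]] by blast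
  have D1: "(transform (\<lambda>t. t ^ k * U j t) has_field_derivative transform (\<lambda>t. t * (t ^ k * U j t)) z) (at z)"
    using Suc.prems by (intro has_field_derivative_transform[OF open_reals tr]) (simp add: strip_def)
  define l where "l = of_real a + z / 2 - (\<Sum>h=1..r. of_real (d h) / (of_real (rho h) + z))"
  define R where "R = cpoly (deriv_numerator j k) z"
  define R' where "R' = cpoly (pderiv (deriv_numerator j k)) z"
  define e where "e = cpoly (row_pole j) z"
  define e' where "e' = cpoly (pderiv (row_pole j)) z"
  define W where "W = cpoly pole_poly z"
  define W' where "W' = cpoly (pderiv pole_poly) z"
  define P where "P = W ^ k"
  define w where "w = cpoly (if j \<le> r then pole_cofactor j else 0) z"
  have nz: "e \<noteq> 0" "W \<noteq> 0" "P \<noteq> 0"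
    using row_pole_nonzero[OF Suc.prems j] pole_poly_nonzero[OF Suc.prems] by (auto simp: e_def W_def P_def)
  \<comment> \<open>The cofactor in the recursion is \<open>pole_poly\<close> times the logarithmic
    derivative of \<open>row_pole j\<close>; for the last row both sides are 0.\<close>
  have we: "w * e = e' * W"
  proof (cases "j \<le> r")
    case True
    then have "pole_poly = row_pole j * pole_cofactor j"
      using pole_poly_split[of j] j by (simp only: row_pole_def) simp
    then have "W = e * w" using True by (simp add: W_def e_def w_def del: mult_pCons_left)
    moreover have "e' = 1" using True by (simp add: e'_def row_pole_def pderiv_pCons)
    ultimately show ?thesis by simp
  qed (simp add: w_def e'_def row_pole_def)
  have DW: "((\<lambda>z. cpoly pole_poly z ^ k) has_field_derivative of_nat k * P * W' / W) (at z)"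
  proof -
    have "((\<lambda>z. cpoly pole_poly z ^ k) has_field_derivative of_nat k * (W' * W ^ (k - 1))) (at z)"
      using DERIV_power[OF has_field_derivative_cpoly[of pole_poly z], where n = k] by (simp add: W_def W'_def mult.commute)
    moreover have "of_nat k * (W' * W ^ (k - 1)) = of_nat k * P * W' / W"
      using nz by (cases k) (auto simp: P_def)
    ultimately show ?thesis by simp
  qed
  have "((\<lambda>z. of_real (row_const j) * L z * cpoly (deriv_numerator j k) z / (cpoly (row_pole j) z * cpoly pole_poly z ^ k))
     has_field_derivative
      ((of_real (row_const j) * (L z * l) * R + of_real (row_const j) * L z * R') * (e * P)
        - of_real (row_const j) * L z * R * (e' * P + e * (of_nat k * P * W' / W))) / ((e * P) * (e * P))) (at z)"
  proof -
    have DN: "((\<lambda>z. of_real (row_const j) * L z * cpoly (deriv_numerator j k) z) has_field_derivative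
        of_real (row_const j) * (L z * l) * R + of_real (row_const j) * L z * R') (at z)"
      using DERIV_mult[OF DERIV_cmult[OF has_field_derivative_L[OF Suc.prems], of "of_real (row_const j)"]
          has_field_derivative_cpoly[of "deriv_numerator j k"]]
      by (simp add: l_def R_def R'_def mult.commute mult.left_commute)
    have DD: "((\<lambda>z. cpoly (row_pole j) z * cpoly pole_poly z ^ k) has_field_derivative
        e' * P + e * (of_nat k * P * W' / W)) (at z)"
      using DERIV_mult[OF has_field_derivative_cpoly[of "row_pole j"] DW]
      by (simp add: e_def e'_def P_def W_def mult.commute)
    have "cpoly (row_pole j) z * cpoly pole_poly z ^ k \<noteq> 0" using nz by (simp add: e_def W_def P_def)
    from DERIV_divide[OF DN DD this] show ?thesis by (simp only: R_def e_def P_def W_def)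
  qed
  moreover have "((of_real (row_const j) * (L z * l) * R + of_real (row_const j) * L z * R') * (e * P)
        - of_real (row_const j) * L z * R * (e' * P + e * (of_nat k * P * W' / W))) / ((e * P) * (e * P))
     = of_real (row_const j) * L z * (W * R' + (W * l - w - of_nat k * W') * R) / (e * (W * P))"
  proof -
    have w: "w = e' * W / e" using we nz by (simp add: field_simps)
    show ?thesis using nz unfolding w by (simp add: field_simps)
  qed
  moreover have "cpoly (deriv_numerator j (Suc k)) z = W * R' + (W * l - w - of_nat k * W') * R"
    using cpoly_log_deriv[OF Suc.prems] by (simp add: W_def R'_def w_def l_def W'_def R_def)
  ultimately have D2: "((\<lambda>z. of_real (row_const j) * L z * cpoly (deriv_numerator j k) z / (cpoly (row_pole j) z * cpoly pole_poly z ^ k))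
     has_field_derivative of_real (row_const j) * L z * cpoly (deriv_numerator j (Suc k)) z / (cpoly (row_pole j) z * cpoly pole_poly z ^ Suc k)) (at z)"
    by (simp add: e_def W_def P_def)
  have "(transform (\<lambda>t. t ^ k * U j t) has_field_derivative
      of_real (row_const j) * L z * cpoly (deriv_numerator j (Suc k)) z / (cpoly (row_pole j) z * cpoly pole_poly z ^ Suc k)) (at z)"
    using Suc.IH by (intro has_field_derivative_transform_within_open[OF D2 open_half_plane Suc.prems]) auto
  from DERIV_unique[OF D1 this] show ?case by (simp add: mult.assoc)
qed (use transform_U[OF j] in simp)

end

section \<open>Orders of zeros, combinations of rows, and the connection matrix\<close>

lemma higher_deriv_cpoly: "(deriv ^^ n) (cpoly P) = cpoly ((pderiv ^^ n) P)"
proof (induction n)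
  case (Suc n)
  then have "(deriv ^^ Suc n) (cpoly P) = deriv (cpoly ((pderiv ^^ n) P))" by simp
  also have "\<dots> = cpoly ((pderiv ^^ Suc n) P)"
    by (rule ext, simp, rule DERIV_imp_deriv, rule has_field_derivative_cpoly)
  finally show ?case .
qed simp

lemma higher_deriv_cpoly_0: "(deriv ^^ n) (cpoly P) 0 / fact n = of_real (coeff P n)"
proof -
  have "cpoly Q 0 = of_real (coeff Q 0)" for Q
    using cpoly_of_real[of Q 0] by (simp add: poly_0_coeff_0)
  then show ?thesis by (simp add: higher_deriv_cpoly coeff_higher_pderiv pochhammer_fact[symmetric])
qed

text \<open>Differentiation lowers the order of a root by exactly one, so the induction passes from
  \<open>P\<close> to \<open>pderiv P\<close>.\<close>

lemma roots_upto_iff_dvd: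
  "(\<forall>k<m. poly ((pderiv ^^ k) P) x = 0) \<longleftrightarrow> [:- x, 1:] ^ m dvd (P :: real poly)"
proof (induction m arbitrary: P)
  case (Suc m)
  have "(\<forall>k<Suc m. poly ((pderiv ^^ k) P) x = 0) \<longleftrightarrow>
      poly P x = 0 \<and> (\<forall>k<m. poly ((pderiv ^^ k) (pderiv P)) x = 0)"
    unfolding All_less_Suc2 by (simp add: funpow_swap1)
  also have "\<dots> \<longleftrightarrow> poly P x = 0 \<and> [:- x, 1:] ^ m dvd pderiv P" by (simp only: Suc.IH)
  also have "\<dots> \<longleftrightarrow> [:- x, 1:] ^ Suc m dvd P"
  proof (cases "P = 0 \<or> poly P x \<noteq> 0")
    case True
    then show ?thesis by (auto simp: order_divides order_root simp del: power_Suc)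
  next
    case False
    then have o: "order x P = Suc (order x (pderiv P))" by (intro order_pderiv) auto
    have "pderiv P \<noteq> 0"
    proof
      assume "pderiv P = 0"
      then obtain c where "P = [:c:]" by (metis degree_eq_zeroE pderiv_eq_0_iff)
      then show False using False by auto
    qed
    then show ?thesis using False o by (simp add: order_divides del: power_Suc)
  qed
  finally show ?case .
qed simp

text \<open>By the Leibniz rule a holomorphic factor cannot lower the order of a zero. Applied to
  \<open>L / D_n\<close> and to its inverse, this moves zeros between transforms and
  polynomials.\<close>

lemma higher_deriv_mult_zero:
  assumes "f holomorphic_on S" "g holomorphic_on S" "open S" "z \<in> S"
    and "\<And>k. k < m \<Longrightarrow> (deriv ^^ k) g z = 0" and "k < m"
  shows "(deriv ^^ k) (\<lambda>z. f z * g z) z = (0::complex)"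
  using assms by (subst higher_deriv_mult[OF assms(1-4)]) (auto intro!: sum.neutral)

context hermite_system
begin

definition combination :: "(nat \<Rightarrow> real poly) \<Rightarrow> real \<Rightarrow> real" where
  "combination B t = (\<Sum>j=1..Suc r. poly (B j) t * U j t)"

lemma cpoly_eq_imp_eq:
  assumes "\<And>z. z \<in> half_plane \<Longrightarrow> cpoly P z = cpoly Q z"
  shows "P = Q"
proof -
  have "poly (P - Q) x = 0" if "x > 0" for x
  proof -
    have "of_real x \<in> half_plane" using that rho_pos by (force simp: strip_def reals_def)
    from assms[OF this] show ?thesis by (simp add: cpoly_of_real)
  qed
  then have "{0<..} \<subseteq> {x. poly (P - Q) x = 0}" by auto
  moreover have "infinite {0::real<..}" by (rule infinite_Ioi)
  ultimately have "P - Q = 0" using poly_roots_finite[of "P - Q"] finite_subset by blast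
  then show ?thesis by simp
qed

text \<open>The imaginary axis lies in the half-plane because the rates are positive, so
  \<open>transform_injective\<close> applies to the difference.\<close>

lemma transform_eq_imp_eq:
  assumes "continuous_on UNIV f" "continuous_on UNIV g" "transformable reals f" "transformable reals g"
    and "\<And>z. z \<in> half_plane \<Longrightarrow> transform f z = transform g z"
  shows "f = g"
proof
  fix t
  have tr: "transformable reals (\<lambda>t. f t + (-1) * g t)"
    by (intro transformable_add transformable_scale assms)
  have "f t + (-1) * g t = 0"
  proof (rule transform_injective[where f = "\<lambda>t. f t + (-1) * g t"])
    show "continuous_on UNIV (\<lambda>t. f t + (-1) * g t)" by (intro continuous_intros assms)
    show "integrable lborel (\<lambda>t. f t + (-1) * g t)"
      using transformable_integrable[OF tr zero_reals] by simp
    fix y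
    have z: "\<i> * of_real y \<in> half_plane" using zero_reals by (simp add: strip_def)
    then show "transform (\<lambda>t. f t + (-1) * g t) (\<i> * of_real y) = 0"
      using transform_add[OF assms(3) transformable_scale[OF assms(4), of "-1"], of "\<i> * of_real y"] assms(5)[OF z]
      by (simp add: transform_scale[where c = "-1", simplified] strip_def)
  qed
  then show "f t = g t" by simp
qed

end

context hermite_index
begin

lemma poly_eq_sum_lam:
  assumes "B \<in> poly_vectors row_indices lam"
  shows "poly (B j) t = (\<Sum>k<lam j. coeff (B j) k * t ^ k)"
proof (cases "B j = 0")
  case False
  then have "degree (B j) < lam j" using assms by (auto simp: poly_vectors_def)
  then show ?thesis
    unfolding poly_altdef by (intro sum.mono_neutral_left) (auto simp: coeff_eq_0)
qed simp

lemma combination_eq: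
  assumes "B \<in> poly_vectors row_indices lam"
  shows "combination B = (\<lambda>t. \<Sum>j\<in>row_indices. \<Sum>k<lam j. coeff (B j) k * (t ^ k * U j t))"
  unfolding combination_def[abs_def] poly_eq_sum_lam[OF assms] by (simp add: sum_distrib_right mult.assoc)

lemma transformable_power_U: "j \<in> row_indices \<Longrightarrow> transformable reals (\<lambda>t. t ^ k * U j t)"
  using transform_power_eq_higher_deriv[OF open_reals transformable_U] by simp

lemma transformable_combination:
  assumes "B \<in> poly_vectors row_indices lam"
  shows "transformable reals (combination B)"
  unfolding combination_eq[OF assms]
  by (intro transformable_sum transformable_scale transformable_power_U)

lemma index_poly_nonzero_half_plane: "z \<in> half_plane \<Longrightarrow> cpoly index_poly z \<noteq> 0"
  using half_plane_nonzero by (simp add: index_poly_def cpoly_prod)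

lemma transform_power_U_row_poly:
  assumes jk: "j \<in> row_indices" "k < lam j" and z: "z \<in> half_plane"
  shows "transform (\<lambda>t. t ^ k * U j t) z = L z / cpoly index_poly z * cpoly (row_poly j k) z"
proof -
  have D: "cpoly index_poly z = cpoly (index_cofactor j k) z * (cpoly (row_pole j) z * cpoly pole_poly z ^ k)"
    unfolding index_cofactor_mult[OF jk, symmetric] by simp
  have j: "j \<ge> 1" using jk by simp
  have "cpoly (index_cofactor j k) z \<noteq> 0" "cpoly (row_pole j) z * cpoly pole_poly z ^ k \<noteq> 0"
    using index_poly_nonzero_half_plane[OF z] unfolding D by auto
  then show ?thesis unfolding transform_power_U[OF j z] D by (simp add: row_poly_def)
qed

lemma transform_combination:
  assumes B: "B \<in> poly_vectors row_indices lam" and z: "z \<in> half_plane"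
  shows "transform (combination B) z = L z / cpoly index_poly z * cpoly (Psi B) z"
proof -
  have rz: "Re z \<in> reals" using z by (simp add: strip_def)
  have "transform (combination B) z =
      (\<Sum>j\<in>row_indices. \<Sum>k<lam j. of_real (coeff (B j) k) * transform (\<lambda>t. t ^ k * U j t) z)"
    unfolding combination_eq[OF B]
    apply (subst transform_sum[OF _ rz])
     apply (intro transformable_sum transformable_scale transformable_power_U, assumption)
    apply (rule sum.cong[OF refl])
    apply (subst transform_sum[OF _ rz])
     apply (intro transformable_scale transformable_power_U, assumption)
    apply (simp only: transform_scale)
    done
  also have "\<dots> = (\<Sum>j\<in>row_indices. \<Sum>k<lam j. L z / cpoly index_poly z * (of_real (coeff (B j) k) * cpoly (row_poly j k) z))"
    by (intro sum.cong refl) (simp add: transform_power_U_row_poly[OF _ _ z] del: atLeastAtMost_iff)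
  also have "\<dots> = L z / cpoly index_poly z * cpoly (Psi B) z"
    by (simp only: Psi_def cpoly_sum cpoly_smult sum_distrib_left)
  finally show ?thesis .
qed

lemma Dpoly_eq: "Dpoly r rho lam z = cpoly index_poly z"
  by (simp add: Dpoly_def index_poly_def cpoly_prod)

lemma Lambda_eq:
  assumes "j \<in> row_indices" "z \<in> half_plane"
  shows "Lambda r rho d a j z = transform (U j) z"
  using assms transform_U[of j z] laplaceF_eq[of z]
  by (simp add: Lambda_def cpoly_row_pole row_const_def)

lemma Phi_eq:
  assumes j: "j \<in> row_indices" and k: "k < lam j" and z: "z \<in> half_plane"
  shows "Phi r rho d a lam j k z = cpoly (row_map j (hermite_real k)) z"
proof -
  have j1: "j \<ge> 1" using j by simp
  have D: "(deriv ^^ l) (Lambda r rho d a j) z = transform (\<lambda>t. t ^ l * U j t) z" for l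
  proof -
    have "(deriv ^^ l) (Lambda r rho d a j) z = (deriv ^^ l) (transform (U j)) z"
      using Lambda_eq[OF j] z open_half_plane by (intro higher_deriv_cong_ev) (auto simp: eventually_nhds)
    then show ?thesis using transform_power_eq_higher_deriv[OF open_reals transformable_U[OF j1]] z by simp
  qed
  have deg: "degree (hermite k) = k"
    by (simp add: hermite_of_real hermite_real_monic degree_map_poly)
  have "diff_op (hermite k) (Lambda r rho d a j) z =
      (\<Sum>l\<le>k. of_real (coeff (hermite_real k) l) * (L z / cpoly index_poly z * cpoly (row_poly j l) z))"
    unfolding diff_op_def deg D
    by (intro sum.cong refl) (use k in \<open>simp add: hermite_of_real coeff_map_poly transform_power_U_row_poly[OF j _ z]\<close>)
  also have "\<dots> = (\<Sum>l<lam j. of_real (coeff (hermite_real k) l) * (L z / cpoly index_poly z * cpoly (row_poly j l) z))"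
    by (rule sum.mono_neutral_left) (use k hermite_real_monic[of k] in \<open>auto simp: coeff_eq_0\<close>)
  also have "\<dots> = L z / cpoly index_poly z * cpoly (row_map j (hermite_real k)) z"
    by (simp add: row_map_def cpoly_sum sum_distrib_left mult_ac)
  finally show ?thesis
    using index_poly_nonzero_half_plane[OF z] laplaceF_eq[OF z] by (simp add: Phi_def Dpoly_eq)
qed

text \<open>On the half-plane, a neighbourhood of 0, the function \<open>Phi_{j,k}\<close> agrees
  with a real polynomial; its Taylor coefficients at 0 are therefore the coefficients of that
  polynomial.\<close>

lemma connection_matrix_eq: "connection_matrix r rho d a lam = map_mat of_real real_matrix"
proof (rule eq_matI)
  fix \<nu> c assume "\<nu> < dim_row (map_mat complex_of_real real_matrix)" "c < dim_col (map_mat complex_of_real real_matrix)"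
  then have nu: "\<nu> < N" and c: "c < (\<Sum>j\<in>row_indices. lam j)" by (simp_all add: real_matrix_def N_def)
  obtain j k where jk: "j \<in> row_indices" "k < lam j" "c = column_pos lam j k"
    using column_pos_surj[OF c] by blast
  then have lex: "lex_columns (Suc r) lam ! c = (j, k)" using lex_columns_nth_column_pos by simp
  have "fps_nth (fps_expansion (Phi r rho d a lam j k) 0) \<nu> = (deriv ^^ \<nu>) (cpoly (row_map j (hermite_real k))) 0 / fact \<nu>"
  proof -
    have "0 \<in> half_plane" using zero_reals by (simp add: strip_def)
    then have "(deriv ^^ \<nu>) (Phi r rho d a lam j k) 0 = (deriv ^^ \<nu>) (cpoly (row_map j (hermite_real k))) 0"
      using Phi_eq[OF jk(1,2)] open_half_plane by (intro higher_deriv_cong_ev) (auto simp: eventually_nhds)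
    then show ?thesis by (simp add: fps_expansion_def)
  qed
  also have "\<dots> = of_real (coeff (row_map j (hermite_real k)) \<nu>)" by (rule higher_deriv_cpoly_0)
  finally have "fps_nth (fps_expansion (Phi r rho d a lam j k) 0) \<nu> = of_real (coeff (row_map j (hermite_real k)) \<nu>)" .
  then show "connection_matrix r rho d a lam $$ (\<nu>, c) = map_mat of_real real_matrix $$ (\<nu>, c)"
    using nu c lex by (simp add: connection_matrix_def real_matrix_def N_def Let_def del: sum.cl_ivl_Suc)
qed (simp_all add: connection_matrix_def real_matrix_def N_def Let_def)

definition node_poly :: "nat \<Rightarrow> (nat \<Rightarrow> real) \<Rightarrow> (nat \<Rightarrow> nat) \<Rightarrow> real poly" where
  "node_poly p xi m = (\<Prod>i=1..p. [:xi i, -1:] ^ m i)"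

lemma p_vector_eq: "p_vector N p xi m = map_vec of_real (Matrix.vec N (coeff (node_poly p xi m)))"
proof -
  have "(\<Prod>i=1..p. [:of_real (xi i), -1:] ^ m i) = map_poly complex_of_real (node_poly p xi m)"
  proof -
    have "map_poly complex_of_real (x * y) = map_poly of_real x * map_poly of_real y" for x y
      by (rule poly_eq_poly_eq_iff[THEN iffD1]) (simp add: fun_eq_iff cpoly_def[symmetric])
    moreover from this have "map_poly complex_of_real (x ^ n) = map_poly of_real x ^ n" for x n
      by (induction n) simp_all
    moreover have "map_poly complex_of_real [:x, -1:] = [:of_real x, -1:]" for x
      by (simp add: map_poly_pCons)
    ultimately have "map_poly complex_of_real (\<Prod>i\<in>S. [:xi i, -1:] ^ m i) = (\<Prod>i\<in>S. [:of_real (xi i), -1:] ^ m i)" for S :: "nat set"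
      by (induction S rule: infinite_finite_induct) simp_all
    then show ?thesis by (simp add: node_poly_def)
  qed
  then show ?thesis by (intro eq_vecI) (simp_all add: p_vector_def coeff_map_poly)
qed

lemma det_replace_col_connection_matrix:
  assumes B: "B \<in> poly_vectors row_indices lam" "Psi B = node_poly p xi m"
    and j: "j \<in> row_indices" "lam j > 0"
  shows "det (replace_col (connection_matrix r rho d a lam) (p_vector N p xi m) (column_pos lam j (lam j - 1))) \<noteq> 0
    \<longleftrightarrow> coeff (B j) (lam j - 1) \<noteq> 0"
proof -
  have "replace_col (connection_matrix r rho d a lam) (p_vector N p xi m) (column_pos lam j (lam j - 1)) =
    map_mat of_real (replace_col real_matrix (Matrix.vec N (coeff (Psi B))) (column_pos lam j (lam j - 1)))"
    unfolding connection_matrix_eq p_vector_eq B(2)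
    by (rule eq_matI) (auto simp: replace_col_def real_matrix_def)
  then show ?thesis
    using det_replace_col_real_matrix[OF B(1) j] det_real_matrix by (simp add: of_real_hom.hom_det)
qed

end

section \<open>Derivatives of the rows and the Rodrigues function\<close>

lemma transformable_mono: "transformable X f \<Longrightarrow> Y \<subseteq> X \<Longrightarrow> transformable Y f"
  by (auto simp: transformable_def)

context hermite_system
begin

text \<open>The rule for the transform of the derivative is carried along with the derivative
  itself; this replaces partial integration, which would call for decay at infinity.\<close>

definition derivative_pair :: "(real \<Rightarrow> real) \<Rightarrow> (real \<Rightarrow> real) \<Rightarrow> bool" where
  "derivative_pair f f' \<longleftrightarrow> transformable reals f \<and> transformable reals f' \<and>
     (\<forall>t. (f has_real_derivative f' t) (at t)) \<and> (\<forall>z\<in>half_plane. transform f' z = - z * transform f z)"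

text \<open>The module over the polynomials in \<open>t\<close> generated by the rows. Its closure
  under differentiation (\<open>derivative_pair_exists\<close>) allows the operators
  \<open>xi i + d/dt\<close> to be iterated.\<close>

inductive_set row_module :: "(real \<Rightarrow> real) set" where
  row: "j \<in> {1..Suc r} \<Longrightarrow> U j \<in> row_module"
| add: "f \<in> row_module \<Longrightarrow> g \<in> row_module \<Longrightarrow> (\<lambda>t. f t + g t) \<in> row_module"
| scale: "f \<in> row_module \<Longrightarrow> (\<lambda>t. c * f t) \<in> row_module"
| times: "f \<in> row_module \<Longrightarrow> (\<lambda>t. t * f t) \<in> row_module"

lemma row_module_zero: "(\<lambda>t. 0) \<in> row_module"
  using row_module.scale[OF row_module.row, of 1 0] by simp

lemma row_module_sum: "(\<And>i. i \<in> I \<Longrightarrow> f i \<in> row_module) \<Longrightarrow> (\<lambda>t. \<Sum>i\<in>I. f i t) \<in> row_module"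
  by (induction I rule: infinite_finite_induct) (auto intro: row_module.add row_module_zero)

lemma row_module_poly: "f \<in> row_module \<Longrightarrow> (\<lambda>t. poly P t * f t) \<in> row_module"
proof (induction P)
  case (pCons c P)
  then have "(\<lambda>t. c * f t + t * (poly P t * f t)) \<in> row_module"
    by (intro row_module.add row_module.scale row_module.times) auto
  then show ?case by (simp add: distrib_right mult.assoc)
qed (simp add: row_module_zero)

lemma combination_in_row_module: "combination B \<in> row_module"
  unfolding combination_def[abs_def] by (intro row_module_sum row_module_poly row_module.row)

lemma F_in_row_module: "F \<in> row_module"
  using row_module.row[of "Suc r"] by (simp add: hermite_row_def[abs_def])

lemma transformable_row_module: "f \<in> row_module \<Longrightarrow> transformable reals f"
  by (induction rule: row_module.induct)
     (auto intro: transformable_U transformable_add transformable_scale transformable_times[OF open_reals])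

lemma continuous_row_module: "f \<in> row_module \<Longrightarrow> continuous_on UNIV f"
proof (induction rule: row_module.induct)
  case (row j)
  then show ?case using tame_U[of j] by (simp add: tame_def)
qed (auto intro: continuous_intros)

text \<open>Found by solving \<open>L' = L * (a + z / 2 - sum of d h / (rho h + z))\<close> for
  \<open>- z * L\<close>, the transform that a derivative of \<open>F\<close> must have:
  \<open>L'\<close> is the transform of \<open>t * F t\<close>, and \<open>L / (rho h + z)\<close>
  that of \<open>U h / rho h\<close>.\<close>

definition F_deriv :: "real \<Rightarrow> real" where
  "F_deriv t = 2 * a * F t + (-2) * (t * F t) + (\<Sum>h=1..r. (- 2 * d h / rho h) * U h t)"

lemma F_deriv_in_row_module: "F_deriv \<in> row_module"
  unfolding F_deriv_def[abs_def]
  by (intro row_module.add row_module_sum row_module.scale row_module.times F_in_row_module row_module.row) auto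

lemma transform_F_deriv:
  assumes z: "z \<in> half_plane"
  shows "transform F_deriv z = - z * L z"
proof -
  have rz: "Re z \<in> reals" using z by (simp add: strip_def)
  have tF: "transformable reals F" using tame_F by (simp add: tame_def)
  have tU: "transformable reals (U h)" if "h \<in> {1..r}" for h using transformable_U that by simp
  define S where "S = (\<Sum>h=1..r. of_real (d h) / (of_real (rho h) + z))"
  have "(transform F has_field_derivative L z * (of_real a + z / 2 - S)) (at z)"
    unfolding S_def by (rule has_field_derivative_transform_within_open[OF has_field_derivative_L[OF z] open_half_plane z])
      (simp add: transform_F)
  from DERIV_unique[OF has_field_derivative_transform[OF open_reals tF rz] this]
  have tt: "transform (\<lambda>t. t * F t) z = L z * (of_real a + z / 2 - S)" .
  have row: "of_real (- 2 * d h / rho h) * transform (U h) z = (- 2 * L z) * (of_real (d h) / (of_real (rho h) + z))"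
    if h: "h \<in> {1..r}" for h
    using transform_U[of h z] z h rho_pos[OF h] by (simp add: row_const_def cpoly_row_pole)
  have "transform F_deriv z = of_real (2 * a) * L z + of_real (-2) * (L z * (of_real a + z / 2 - S))
      + (\<Sum>h=1..r. of_real (- 2 * d h / rho h) * transform (U h) z)"
    unfolding F_deriv_def[abs_def]
    apply (subst transform_add[OF _ _ rz])
      apply (intro transformable_add transformable_scale transformable_times open_reals tF)
     apply (intro transformable_sum transformable_scale tU, assumption)
    apply (subst transform_add[OF _ _ rz])
      apply (intro transformable_scale tF)
     apply (intro transformable_scale transformable_times open_reals tF)
    apply (subst transform_sum[OF _ rz])
     apply (intro transformable_scale tU, assumption)
    apply (simp only: transform_scale tt transform_F[OF z])
    done
  also have "(\<Sum>h=1..r. of_real (- 2 * d h / rho h) * transform (U h) z) = (- 2 * L z) * S"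
    unfolding S_def sum_distrib_left by (intro sum.cong refl row)
  finally show ?thesis by (simp add: algebra_simps)
qed

text \<open>With \<open>s = F - F_deriv\<close> one has \<open>F = K\<^sub>1\<^sub>,\<^sub>1 s\<close>, because the transform of \<open>s\<close> is \<open>(1 + z) L z\<close>;
  hence \<open>F' = F - s\<close>.\<close>

lemma F_has_derivative: "(F has_real_derivative F_deriv t) (at t)"
proof -
  define s where "s t = F t + (-1) * F_deriv t" for t
  have sm: "s \<in> row_module"
    unfolding s_def[abs_def] by (intro row_module.add row_module.scale F_in_row_module F_deriv_in_row_module)
  note s_tr = transformable_row_module[OF sm] and s_cont = continuous_row_module[OF sm]
  note F_tr = transformable_row_module[OF F_in_row_module] and F_cont = continuous_row_module[OF F_in_row_module]
  have s_int: "integrable lborel s" using transformable_integrable[OF s_tr zero_reals] by simp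
  have s_trans: "transform s z = (1 + z) * L z" if z: "z \<in> half_plane" for z
    unfolding s_def[abs_def]
    apply (subst transform_add[OF F_tr])
      apply (intro transformable_scale transformable_row_module F_deriv_in_row_module)
    using z apply (simp add: strip_def)
    using transform_scale[of "-1" F_deriv z] transform_F_deriv[OF z] transform_F[OF z]
    apply (simp add: algebra_simps)
    done
  \<comment> \<open>The multiplier \<open>1 / (1 + z)\<close> of this auxiliary operator requires
    \<open>Re z > -1\<close>; the smaller strip still contains the imaginary axis, which suffices
    for injectivity.\<close>
  define Y where "Y = reals \<inter> {-1<..}"
  have Y: "open Y" "convex Y" "0 \<in> Y" "Y \<subseteq> reals"
    using open_reals convex_reals zero_reals by (auto simp: Y_def intro: convex_Int)
  define K where "K = Kop 1 1 s"
  have Kd: "(K has_real_derivative K t - s t) (at t)" for t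
    using Kop_1_has_real_derivative[OF _ s_cont s_int, of 1 t] by (simp add: K_def)
  then have Kc: "continuous_on UNIV K"
    by (meson DERIV_isCont continuous_at_imp_continuous_on)
  have Kx: "integrable lborel (\<lambda>t. exp (x * t) * K t)"
    "(LBINT t. exp (x * t) * K t) = (1 / (1 + x)) * (LBINT t. exp (x * t) * s t)" if "x \<in> Y" for x
    using Kop_exp_integral[of 1 1 x s] transformable_integrable[OF s_tr, of x] transformable_measurable[OF s_tr] that
    by (auto simp: Y_def K_def)
  have Kt: "transformable Y K"
    using Kx(1) Kop_measurable[OF transformable_measurable[OF s_tr]] by (auto simp: transformable_def K_def)
  have "transform K z = L z" if z: "z \<in> strip Y" for z
  proof (rule identity_on_strip[OF Y(1-3) _ _ _ z])
    show "transform K holomorphic_on strip Y" by (rule transform_holomorphic[OF Y(1) Kt])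
    show "L holomorphic_on strip Y"
      by (rule holomorphic_on_subset[OF L_holomorphic]) (use Y(4) in \<open>auto simp: strip_def\<close>)
    fix x assume x: "x \<in> Y"
    then have xz: "of_real x \<in> half_plane" and x1: "1 + x > 0" using Y(4) by (auto simp: strip_def Y_def)
    have "transform K (of_real x) = of_real (1 / (1 + x)) * transform s (of_real x)"
      using Kx(2)[OF x] by (simp add: transform_of_real)
    also have "\<dots> = L (of_real x)"
    proof -
      have "1 + complex_of_real x \<noteq> 0" using x1 by (simp add: complex_eq_iff)
      then show ?thesis by (simp add: s_trans[OF xz])
    qed
    finally show "transform K (of_real x) = L (of_real x)" .
  qed
  then have eq: "K t = F t" for t
  proof -
    have FY: "transformable Y F" by (rule transformable_mono[OF F_tr Y(4)])
    have tr: "transformable Y (\<lambda>t. K t + (-1) * F t)" by (intro transformable_add transformable_scale Kt FY)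
    have "K t + (-1) * F t = 0"
    proof (rule transform_injective[where f = "\<lambda>t. K t + (-1) * F t"])
      show "continuous_on UNIV (\<lambda>t. K t + (-1) * F t)" by (intro continuous_intros Kc F_cont)
      show "integrable lborel (\<lambda>t. K t + (-1) * F t)" using transformable_integrable[OF tr Y(3)] by simp
      fix y
      have zY: "\<i> * of_real y \<in> strip Y" using Y(3) by (simp add: strip_def)
      then have zh: "\<i> * of_real y \<in> half_plane" using Y(4) by (auto simp: strip_def)
      show "transform (\<lambda>t. K t + (-1) * F t) (\<i> * of_real y) = 0"
        using transform_add[OF Kt transformable_scale[OF FY, of "-1"], of "\<i> * of_real y"] Y(3)
          transform_scale[of "-1" F] transform_F[OF zh] \<open>\<And>z. z \<in> strip Y \<Longrightarrow> transform K z = L z\<close>[OF zY]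
        by simp
    qed
    then show ?thesis by simp
  qed
  then have "K = F" by auto
  then show ?thesis using Kd[of t] by (simp add: s_def)
qed

text \<open>For a row \<open>h\<close> with \<open>h\<close> at most \<open>r\<close> the derivative
  is \<open>rho h * (U h - F)\<close>; the last row is \<open>F\<close> itself. For
  \<open>t * f\<close>, differentiating \<open>- z * transform f\<close> in \<open>z\<close>
  produces \<open>- transform f\<close>, which cancels the summand \<open>f\<close> of the product
  rule.\<close>

lemma derivative_pair_exists:
  assumes "f \<in> row_module"
  shows "\<exists>f'\<in>row_module. derivative_pair f f'"
  using assms
proof (induction rule: row_module.induct)
  case (row j)
  have pF: "derivative_pair F F_deriv"
    using F_has_derivative transform_F_deriv transform_F transformable_row_module F_in_row_module F_deriv_in_row_module
    by (simp add: derivative_pair_def)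
  show ?case
  proof (cases "j \<le> r")
    case True
    then have jr: "j \<in> {1..r}" using row by simp
    define f' where "f' t = rho j * U j t + (- rho j) * F t" for t
    have m: "f' \<in> row_module"
      unfolding f'_def[abs_def] by (intro row_module.add row_module.scale row_module.row F_in_row_module row)
    have Uj: "U j = Kop (rho j) 1 F" using True by (simp add: hermite_row_def[abs_def])
    have "integrable lborel F"
      using transformable_integrable[OF transformable_row_module[OF F_in_row_module] zero_reals] by simp
    then have "(U j has_real_derivative f' t) (at t)" for t
      using Kop_1_has_real_derivative[OF rho_pos[OF jr] continuous_row_module[OF F_in_row_module], of t]
      by (simp add: f'_def Uj algebra_simps)
    moreover have "transform f' z = - z * transform (U j) z" if z: "z \<in> half_plane" for z
    proof -
      have "transform f' z = of_real (rho j) * transform (U j) z + of_real (- rho j) * transform F z"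
        unfolding f'_def[abs_def]
        apply (subst transform_add[of reals])
           apply (intro transformable_scale transformable_row_module row_module.row row)
          apply (intro transformable_scale transformable_row_module F_in_row_module)
        using z apply (simp add: strip_def)
        apply (simp only: transform_scale)
        done
      also have "\<dots> = - z * transform (U j) z"
        using transform_U[of j z] transform_F[OF z] z half_plane_nonzero[OF z jr] True jr
        by (simp add: row_const_def cpoly_row_pole field_simps)
      finally show ?thesis .
    qed
    ultimately show ?thesis
      using m transformable_row_module row_module.row[OF row] by (auto simp: derivative_pair_def)
  next
    case False
    then have "U j = F" by (simp add: hermite_row_def[abs_def])
    then show ?thesis using pF F_deriv_in_row_module by auto
  qed
next
  case (add f g)
  then obtain f' g' where m: "f' \<in> row_module" "g' \<in> row_module" and p: "derivative_pair f f'" "derivative_pair g g'" by blast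
  have "derivative_pair (\<lambda>t. f t + g t) (\<lambda>t. f' t + g' t)"
    using p transform_add[of reals f g] transform_add[of reals f' g']
    by (auto simp: derivative_pair_def transformable_add strip_def algebra_simps intro!: derivative_eq_intros)
  then show ?case using m row_module.add by blast
next
  case (scale f c)
  then obtain f' where m: "f' \<in> row_module" and p: "derivative_pair f f'" by blast
  have "derivative_pair (\<lambda>t. c * f t) (\<lambda>t. c * f' t)"
    using p by (auto simp: derivative_pair_def transformable_scale transform_scale intro!: derivative_eq_intros)
  then show ?case using m row_module.scale by blast
next
  case (times f)
  then obtain f' where m: "f' \<in> row_module" and p: "derivative_pair f f'" by blast
  have f: "transformable reals f" and f': "transformable reals f'"
    and d: "(f has_real_derivative f' t) (at t)" and t: "z \<in> half_plane \<Longrightarrow> transform f' z = - z * transform f z" for t z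
    using p by (auto simp: derivative_pair_def)
  have "transform (\<lambda>t. f t + t * f' t) z = - z * transform (\<lambda>t. t * f t) z" if z: "z \<in> half_plane" for z
  proof -
    have rz: "Re z \<in> reals" using z by (simp add: strip_def)
    have D: "(transform f has_field_derivative transform (\<lambda>t. t * f t) z) (at z)"
      by (rule has_field_derivative_transform[OF open_reals f rz])
    have "((\<lambda>z. - z * transform f z) has_field_derivative - transform f z - z * transform (\<lambda>t. t * f t) z) (at z)"
      by (rule derivative_eq_intros D refl | simp)+
    then have "(transform f' has_field_derivative - transform f z - z * transform (\<lambda>t. t * f t) z) (at z)"
      by (rule has_field_derivative_transform_within_open[OF _ open_half_plane z]) (simp add: t)
    from DERIV_unique[OF has_field_derivative_transform[OF open_reals f' rz] this]
    show ?thesis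
      using transform_add[OF f transformable_times[OF open_reals f'] rz] by simp
  qed
  moreover have "((\<lambda>t. t * f t) has_real_derivative f t + t * f' t) (at t)" for t
    by (rule derivative_eq_intros d refl | simp)+
  ultimately have "derivative_pair (\<lambda>t. t * f t) (\<lambda>t. f t + t * f' t)"
    using f f' by (simp add: derivative_pair_def transformable_add transformable_times open_reals)
  then show ?case using m row_module.add[OF times.hyps(1) row_module.times[OF m]] by blast
qed

lemma shifted_deriv_row_module:
  assumes "f \<in> row_module"
  shows "(\<lambda>t. c * f t + deriv f t) \<in> row_module"
    and "z \<in> half_plane \<Longrightarrow> transform (\<lambda>t. c * f t + deriv f t) z = (of_real c - z) * transform f z"
proof -
  obtain f' where m: "f' \<in> row_module" and p: "derivative_pair f f'" using derivative_pair_exists[OF assms] by blast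
  have e: "(\<lambda>t. c * f t + deriv f t) = (\<lambda>t. c * f t + f' t)"
    using p by (auto simp: derivative_pair_def fun_eq_iff intro: DERIV_imp_deriv)
  show "(\<lambda>t. c * f t + deriv f t) \<in> row_module"
    unfolding e by (intro row_module.add row_module.scale assms m)
  assume z: "z \<in> half_plane"
  then show "transform (\<lambda>t. c * f t + deriv f t) z = (of_real c - z) * transform f z"
    unfolding e using p transform_add[of reals "\<lambda>t. c * f t" f' z]
    by (simp add: derivative_pair_def transformable_scale transform_scale strip_def algebra_simps)
qed

lemma shifted_deriv_iterate:
  assumes "f \<in> row_module"
  shows "((\<lambda>f t. c * f t + deriv f t) ^^ n) f \<in> row_module \<and>
    (\<forall>z\<in>half_plane. transform (((\<lambda>f t. c * f t + deriv f t) ^^ n) f) z = (of_real c - z) ^ n * transform f z)"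
  by (induction n) (use assms shifted_deriv_row_module in \<open>auto simp: mult.assoc\<close>)

lemma shifted_deriv_foldr:
  fixes xi :: "nat \<Rightarrow> real"
  assumes "f \<in> row_module"
  shows "foldr (\<lambda>i. (\<lambda>f t. xi i * f t + deriv f t) ^^ m i) hs f \<in> row_module \<and>
    (\<forall>z\<in>half_plane. transform (foldr (\<lambda>i. (\<lambda>f t. xi i * f t + deriv f t) ^^ m i) hs f) z =
      (\<Prod>i\<leftarrow>hs. (of_real (xi i) - z) ^ m i) * transform f z)"
proof (induction hs)
  case (Cons i hs)
  then show ?case
    using shifted_deriv_iterate[where f = "foldr (\<lambda>i. (\<lambda>f t. xi i * f t + deriv f t) ^^ m i) hs f" and c = "xi i" and n = "m i"]
    by (simp add: mult.assoc)
qed (use assms in simp)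

end

context hermite_index
begin

lemma cpoly_node_poly: "cpoly (node_poly p xi m) z = (\<Prod>i=1..p. (of_real (xi i) - z) ^ m i)"
  by (simp add: node_poly_def cpoly_prod)

lemma degree_node_poly: "degree (node_poly p xi m) = (\<Sum>i=1..p. m i)"
  unfolding node_poly_def by (subst degree_prod_eq_sum_degree) (auto simp: degree_power_eq)

lemma node_poly_nonzero: "node_poly p xi m \<noteq> 0"
  by (auto simp: node_poly_def)

text \<open>\<open>G\<close> is built from operators \<open>K\<close> of order \<open>lam h\<close>
  and is not a row, but its transform is \<open>L / D_n\<close>. A vector \<open>B\<close> with
  \<open>Psi B = 1\<close>, which exists because \<open>N\<close> is positive, gives a combination
  of rows with the same transform; hence \<open>G\<close> lies in the module and may be
  differentiated.\<close>

lemma rodrigues_base: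
  assumes N: "N \<ge> 1"
  defines "G \<equiv> foldr (\<lambda>h f t. Kop (rho h) (real (lam h)) f t / rho h ^ lam h) [1..<Suc r] F"
  shows "G \<in> row_module" "z \<in> half_plane \<Longrightarrow> transform G z = L z / cpoly index_poly z"
proof -
  have G: "G = foldr (\<lambda>h f t. (1 / rho h ^ lam h) * Kop (rho h) (real (lam h)) f t) [1..<Suc r] F"
    by (simp add: G_def)
  have *: "tame reals G \<and> (\<forall>x\<in>reals. transform G (of_real x) =
     (\<Prod>h\<leftarrow>[1..<Suc r]. of_real (1 / rho h ^ lam h * (rho h / (rho h + x)) powr real (lam h))) * transform F (of_real x))"
    unfolding G by (rule tame_foldr_Kop) (auto simp: tame_F)
  then have t: "transformable reals G" and c: "continuous_on UNIV G" by (auto simp: tame_def)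
  have tr: "transform G z = L z / cpoly index_poly z" if z: "z \<in> half_plane" for z
  proof (rule identity_on_strip[OF open_reals convex_reals zero_reals _ _ _ z])
    show "transform G holomorphic_on half_plane" by (rule transform_holomorphic[OF open_reals t])
    show "(\<lambda>z. L z / cpoly index_poly z) holomorphic_on half_plane"
      using index_poly_nonzero_half_plane by (intro holomorphic_intros L_holomorphic) auto
    fix x assume x: "x \<in> reals"
    have "1 / rho h ^ lam h * (rho h / (rho h + x)) powr real (lam h) = 1 / (rho h + x) ^ lam h" if h: "h \<in> {1..r}" for h
      using reals_gt[OF x h] rho_pos[OF h] by (simp add: powr_realpow power_divide add.commute)
    then have "(\<Prod>h\<leftarrow>[1..<Suc r]. complex_of_real (1 / rho h ^ lam h * (rho h / (rho h + x)) powr real (lam h)))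
       = (\<Prod>h=1..r. complex_of_real (1 / (rho h + x) ^ lam h))"
      unfolding prod_list_upt by (intro prod.cong refl) simp
    also have "\<dots> = 1 / cpoly index_poly (of_real x)"
      by (simp add: index_poly_def cpoly_prod prod_dividef)
    finally show "transform G (of_real x) = L (of_real x) / cpoly index_poly (of_real x)"
      using * x transform_F[of "of_real x"] by (simp add: strip_def)
  qed
  obtain B where B: "B \<in> poly_vectors row_indices lam" "Psi B = 1"
    using Psi_surj[of 1] N by auto
  have "G = combination B"
    using transform_combination[OF B(1)] B(2) tr
    by (intro transform_eq_imp_eq c t continuous_row_module transformable_row_module combination_in_row_module) simp
  then show "G \<in> row_module" using combination_in_row_module by simp
  show "z \<in> half_plane \<Longrightarrow> transform G z = L z / cpoly index_poly z" by (rule tr)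
qed

text \<open>Equality with the Rodrigues function can be tested on transforms, where cancelling the
  nonzero factor \<open>L / D_n\<close> leaves an equation for \<open>Psi B\<close>.\<close>

lemma rodrigues_components_iff:
  assumes N: "N \<ge> 1" and Bs: "Bs \<in> poly_vectors row_indices lam" "Psi Bs = node_poly p xi m"
  shows "rodrigues_components r rho d a lam p xi m B \<longleftrightarrow> B = Bs"
proof -
  define R where "R = rodrigues r rho d a lam p xi m"
  have Rm: "R \<in> row_module" and Rt: "z \<in> half_plane \<Longrightarrow> transform R z = cpoly (node_poly p xi m) z * (L z / cpoly index_poly z)" for z
    using shifted_deriv_foldr[OF rodrigues_base(1)[OF N], where xi = xi and m = m and hs = "[1..<Suc p]"] rodrigues_base(2)[OF N, of z]
    by (simp_all add: R_def rodrigues_def cpoly_node_poly prod_list_upt[unfolded One_nat_def] del: upt_Suc)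
  have tr: "transform (combination B) z = transform R z \<longleftrightarrow> cpoly (Psi B) z = cpoly (node_poly p xi m) z"
    if "B \<in> poly_vectors row_indices lam" "z \<in> half_plane" for B z
  proof -
    have "L z / cpoly index_poly z \<noteq> 0" using index_poly_nonzero_half_plane[OF that(2)] by simp
    then show ?thesis
      unfolding transform_combination[OF that] Rt[OF that(2)] mult.commute[of _ "L z / cpoly index_poly z"]
      by (rule mult_left_cancel)
  qed
  have eq: "combination Bs = R"
    using tr[OF Bs(1)] Bs(2)
    by (intro transform_eq_imp_eq continuous_row_module transformable_row_module combination_in_row_module Rm) simp
  have "B = Bs" if B: "B \<in> poly_vectors row_indices lam" "combination B = R" for B
  proof -
    have "Psi B = node_poly p xi m" using tr[OF B(1)] B(2) by (intro cpoly_eq_imp_eq) simp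
    then show ?thesis using Psi_inj[OF B(1) Bs(1)] Bs(2) by simp
  qed
  moreover have "rodrigues_components r rho d a lam p xi m B \<longleftrightarrow> B \<in> poly_vectors row_indices lam \<and> combination B = R"
    by (auto simp: rodrigues_components_def R_def combination_def[abs_def] fun_eq_iff simp del: sum.cl_ivl_Suc)
  ultimately show ?thesis using eq Bs(1) by blast
qed

end

section \<open>The \<open>B\<close>-problem\<close>

lemma has_bochner_integral_real_zero_iff:
  "integrable M f \<Longrightarrow> has_bochner_integral M f 0 \<longleftrightarrow> integral\<^sup>L M f = 0"
  by (auto simp: has_bochner_integral_iff)

lemma span_singleton_eq: "poly_vec.span {B} = range (\<lambda>c i. smult c (B i))"
  by (rule poly_vec.span_singleton)

lemma weakly_normal_span: "B \<noteq> 0 \<Longrightarrow> weakly_normal (poly_vec.span {B})"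
  using poly_vec.dim_eq_card_independent[of "{B}"] by (simp add: weakly_normal_def)

lemma strongly_normal_span_iff:
  assumes B: "B \<in> poly_vectors I m" "B \<noteq> 0"
  shows "strongly_normal I m (poly_vec.span {B}) \<longleftrightarrow> (\<forall>j\<in>I. m j > 0 \<longrightarrow> coeff (B j) (m j - 1) \<noteq> 0)"
proof -
  have top: "B j \<noteq> 0 \<and> degree (B j) = m j - 1 \<longleftrightarrow> coeff (B j) (m j - 1) \<noteq> 0" if "m j > 0" for j
  proof
    assume "coeff (B j) (m j - 1) \<noteq> 0"
    then have "B j \<noteq> 0" "m j - 1 \<le> degree (B j)" by (auto intro: le_degree)
    moreover have "degree (B j) < m j" using B(1) \<open>B j \<noteq> 0\<close> by (auto simp: poly_vectors_def)
    ultimately show "B j \<noteq> 0 \<and> degree (B j) = m j - 1" by auto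
  qed (metis leading_coeff_0_iff)
  have "(\<forall>A\<in>poly_vec.span {B}. A \<noteq> 0 \<longrightarrow> (\<forall>j\<in>I. m j > 0 \<longrightarrow> A j \<noteq> 0 \<and> degree (A j) = m j - 1)) \<longleftrightarrow>
      (\<forall>j\<in>I. m j > 0 \<longrightarrow> B j \<noteq> 0 \<and> degree (B j) = m j - 1)"
  proof
    assume "\<forall>A\<in>poly_vec.span {B}. A \<noteq> 0 \<longrightarrow> (\<forall>j\<in>I. m j > 0 \<longrightarrow> A j \<noteq> 0 \<and> degree (A j) = m j - 1)"
    then show "\<forall>j\<in>I. m j > 0 \<longrightarrow> B j \<noteq> 0 \<and> degree (B j) = m j - 1"
      using B(2) poly_vec.span_base[of B "{B}"] by blast
  next
    assume R: "\<forall>j\<in>I. m j > 0 \<longrightarrow> B j \<noteq> 0 \<and> degree (B j) = m j - 1"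
    show "\<forall>A\<in>poly_vec.span {B}. A \<noteq> 0 \<longrightarrow> (\<forall>j\<in>I. m j > 0 \<longrightarrow> A j \<noteq> 0 \<and> degree (A j) = m j - 1)"
    proof (intro ballI impI)
      fix A j assume A: "A \<in> poly_vec.span {B}" "A \<noteq> 0" and j: "j \<in> I" "m j > 0"
      then obtain c where "A = (\<lambda>i. smult c (B i))" unfolding span_singleton_eq by blast
      moreover from this have "c \<noteq> 0" using A(2) by (auto simp: fun_eq_iff)
      ultimately show "A j \<noteq> 0 \<and> degree (A j) = m j - 1" using R j by simp
    qed
  qed
  then show ?thesis
    unfolding strongly_normal_def using weakly_normal_span[OF B(2)] top by auto
qed

locale hermite_nodes = hermite_index +
  fixes p :: nat and xi :: "nat \<Rightarrow> real"
  assumes xi_reals: "\<And>i. i \<in> {1..p} \<Longrightarrow> xi i \<in> reals"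
    and xi_inj: "inj_on xi {1..p}"
begin

lemma xi_half_plane: "i \<in> {1..p} \<Longrightarrow> of_real (xi i) \<in> half_plane"
  using xi_reals by (simp add: strip_def)

text \<open>The integrals are the derivatives at \<open>x\<close> of the transform
  \<open>(L / D_n) * Psi B\<close>. The factor \<open>L / D_n\<close> is holomorphic and nonzero
  there, so the order of vanishing is that of \<open>Psi B\<close>.\<close>

lemma B_orthogonal_iff:
  assumes B: "B \<in> poly_vectors row_indices lam" and x: "x \<in> reals"
  shows "(\<forall>k<m. has_bochner_integral lborel (\<lambda>t. t ^ k * exp (x * t) * combination B t) 0) \<longleftrightarrow>
    [:- x, 1:] ^ m dvd Psi B"
proof -
  define c where "c = complex_of_real x"
  have c: "c \<in> half_plane" using x by (simp add: c_def strip_def)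
  note tB = transformable_combination[OF B]
  have 1: "has_bochner_integral lborel (\<lambda>t. t ^ k * exp (x * t) * combination B t) 0 \<longleftrightarrow>
      (deriv ^^ k) (transform (combination B)) c = 0" for k
  proof -
    note tk = transform_power_eq_higher_deriv[OF open_reals tB, of k]
    have e: "t ^ k * exp (x * t) * combination B t = exp (x * t) * (t ^ k * combination B t)" for t by simp
    have "integrable lborel (\<lambda>t. exp (x * t) * (t ^ k * combination B t))"
      using transformable_integrable[OF conjunct1[OF tk] x] .
    moreover have "(deriv ^^ k) (transform (combination B)) c = of_real (LBINT t. exp (x * t) * (t ^ k * combination B t))"
      using tk c by (simp add: transform_of_real[symmetric] c_def)
    ultimately show ?thesis unfolding e by (simp add: has_bochner_integral_real_zero_iff)
  qed
  have h1: "transform (combination B) holomorphic_on half_plane" by (rule transform_holomorphic[OF open_reals tB])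
  have h2: "(\<lambda>z. L z / cpoly index_poly z) holomorphic_on half_plane"
    using index_poly_nonzero_half_plane by (intro holomorphic_intros L_holomorphic) auto
  have h3: "(\<lambda>z. cpoly index_poly z / L z) holomorphic_on half_plane"
    by (intro holomorphic_intros L_holomorphic) auto
  have e1: "(deriv ^^ k) (transform (combination B)) c = (deriv ^^ k) (\<lambda>z. L z / cpoly index_poly z * cpoly (Psi B) z) c" for k
    using transform_combination[OF B] open_half_plane c by (intro higher_deriv_cong_ev) (auto simp: eventually_nhds)
  have e2: "(deriv ^^ k) (cpoly (Psi B)) c = (deriv ^^ k) (\<lambda>z. cpoly index_poly z / L z * transform (combination B) z) c" for k
  proof (rule higher_deriv_cong_ev[OF _ refl])
    have "cpoly (Psi B) z = cpoly index_poly z / L z * transform (combination B) z" if "z \<in> half_plane" for z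
      using transform_combination[OF B that] index_poly_nonzero_half_plane[OF that] by simp
    then show "\<forall>\<^sub>F z in nhds c. cpoly (Psi B) z = cpoly index_poly z / L z * transform (combination B) z"
      using open_half_plane c by (auto simp: eventually_nhds)
  qed
  have "(\<forall>k<m. (deriv ^^ k) (transform (combination B)) c = 0) \<longleftrightarrow> (\<forall>k<m. (deriv ^^ k) (cpoly (Psi B)) c = 0)"
  proof
    assume "\<forall>k<m. (deriv ^^ k) (transform (combination B)) c = 0"
    then show "\<forall>k<m. (deriv ^^ k) (cpoly (Psi B)) c = 0"
      unfolding e2 using higher_deriv_mult_zero[OF h3 h1 open_half_plane c] by blast
  next
    assume "\<forall>k<m. (deriv ^^ k) (cpoly (Psi B)) c = 0"
    then show "\<forall>k<m. (deriv ^^ k) (transform (combination B)) c = 0"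
      unfolding e1 using higher_deriv_mult_zero[OF h2 cpoly_holomorphic open_half_plane c] by blast
  qed
  also have "\<dots> \<longleftrightarrow> (\<forall>k<m. poly ((pderiv ^^ k) (Psi B)) x = 0)"
    by (simp add: higher_deriv_cpoly c_def cpoly_of_real)
  also have "\<dots> \<longleftrightarrow> [:- x, 1:] ^ m dvd Psi B" by (rule roots_upto_iff_dvd)
  finally show ?thesis by (simp only: 1)
qed

text \<open>Distinct nodes make the factors coprime: the product over the other nodes has order 0 at
  \<open>xi i\<close>, so the whole order of \<open>P\<close> at \<open>xi i\<close> remains in the
  quotient.\<close>

lemma node_poly_dvd_iff:
  "node_poly p xi m dvd P \<longleftrightarrow> (\<forall>i\<in>{1..p}. [:- xi i, 1:] ^ m i dvd P)"
proof -
  have fac: "[:xi i, -1:] ^ m i = smult ((-1) ^ m i) ([:- xi i, 1:] ^ m i)" for i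
  proof -
    have "[:xi i, -1:] = smult (-1) [:- xi i, 1:]" by simp
    then show ?thesis by (simp only: smult_power)
  qed
  have dvd: "[:xi i, -1:] ^ m i dvd Q \<longleftrightarrow> [:- xi i, 1:] ^ m i dvd Q" for i Q
    unfolding fac by (simp add: smult_dvd_iff)
  have "(\<Prod>i\<in>S. [:xi i, -1:] ^ m i) dvd P \<longleftrightarrow> (\<forall>i\<in>S. [:- xi i, 1:] ^ m i dvd P)" if "S \<subseteq> {1..p}" "finite S" for S
    using that(2,1)
  proof (induction S rule: finite_induct)
    case (insert i S)
    define R where "R = (\<Prod>j\<in>S. [:xi j, -1:] ^ m j)"
    have "xi j \<noteq> xi i" if "j \<in> S" for j using insert that inj_onD[OF xi_inj, of j i] by auto
    then have R: "poly R (xi i) \<noteq> 0" using insert.hyps(1) by (auto simp: R_def poly_prod)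
    have "[:xi i, -1:] ^ m i * R dvd P" if dvdP: "[:xi i, -1:] ^ m i dvd P" "R dvd P"
    proof (cases "P = 0")
      case False
      obtain Q where Q: "P = R * Q" using dvdP(2) by (elim dvdE)
      have "m i \<le> order (xi i) P" using dvdP(1) False unfolding dvd by (simp add: order_divides)
      also have "\<dots> = order (xi i) R + order (xi i) Q" using False unfolding Q by (rule order_mult)
      also have "order (xi i) R = 0" using R by (simp add: order_root)
      finally have "[:xi i, -1:] ^ m i dvd Q" unfolding dvd by (simp add: order_divides)
      then show ?thesis unfolding Q by (subst mult.commute[of R]) (rule mult_dvd_mono[OF _ dvd_refl])
    qed simp
    then have "[:xi i, -1:] ^ m i * R dvd P \<longleftrightarrow> [:xi i, -1:] ^ m i dvd P \<and> R dvd P"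
      using dvd_mult_left dvd_mult_right by blast
    then have "[:xi i, -1:] ^ m i * (\<Prod>j\<in>S. [:xi j, -1:] ^ m j) dvd P \<longleftrightarrow>
        [:xi i, -1:] ^ m i dvd P \<and> (\<Prod>j\<in>S. [:xi j, -1:] ^ m j) dvd P"
      by (simp only: R_def)
    moreover have "(\<Prod>j\<in>S. [:xi j, -1:] ^ m j) dvd P \<longleftrightarrow> (\<forall>i\<in>S. [:- xi i, 1:] ^ m i dvd P)"
      by (rule insert.IH) (use insert.prems in auto)
    ultimately show ?case
      unfolding prod.insert[OF insert.hyps(1,2)] ball_simps by (simp only: dvd) blast
  qed simp
  then show ?thesis unfolding node_poly_def by blast
qed

lemma B_solutions_eq:
  "B_solutions (Suc r) U lam p xi m = {B \<in> poly_vectors row_indices lam. node_poly p xi m dvd Psi B}"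
  unfolding B_solutions_def node_poly_dvd_iff combination_def[symmetric]
  using B_orthogonal_iff xi_reals by blast

lemma B_problem:
  assumes N: "N \<ge> 1" and m: "(\<Sum>i=1..p. m i) = N - 1"
  obtains Bs where "Bs \<in> poly_vectors row_indices lam" "Psi Bs = node_poly p xi m" "Bs \<noteq> 0"
    "B_solutions (Suc r) U lam p xi m = poly_vec.span {Bs}"
proof -
  have deg: "degree (node_poly p xi m) < N" using N m by (simp add: degree_node_poly)
  then obtain Bs where Bs: "Bs \<in> poly_vectors row_indices lam" "Psi Bs = node_poly p xi m"
    using Psi_surj[of "node_poly p xi m"] by (metis coeff_eq_0 order_less_le_trans)
  have nz: "Bs \<noteq> 0"
  proof
    assume "Bs = 0"
    then have "Psi Bs = 0" by (simp add: Psi_def)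
    then show False using Bs(2) node_poly_nonzero by simp
  qed
  have sc: "(\<lambda>i. smult c (Bs i)) \<in> poly_vectors row_indices lam" for c
    using Bs(1) by (auto simp: poly_vectors_def)
  have "\<exists>c. B = (\<lambda>i. smult c (Bs i))"
    if B: "B \<in> poly_vectors row_indices lam" and dvd: "node_poly p xi m dvd Psi B" for B
  proof -
    obtain Q where Q: "Psi B = node_poly p xi m * Q" using dvd by (elim dvdE)
    have "degree Q = 0"
    proof (cases "Q = 0")
      case False
      then have "degree (Psi B) = N - 1 + degree Q"
        using Q node_poly_nonzero m by (simp add: degree_mult_eq degree_node_poly)
      then show ?thesis using degree_Psi_less[OF N, of B] by simp
    qed simp
    then obtain c where "Q = [:c:]" by (rule degree_eq_zeroE)
    then have "Psi B = Psi (\<lambda>i. smult c (Bs i))" using Q Bs(2) by (simp add: Psi_smult)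
    then show ?thesis using Psi_inj[OF B sc] by blast
  qed
  moreover have "node_poly p xi m dvd Psi (\<lambda>i. smult c (Bs i))" for c
    unfolding Psi_smult Bs(2) by (rule dvd_smult) simp
  ultimately have "B_solutions (Suc r) U lam p xi m = poly_vec.span {Bs}"
    unfolding B_solutions_eq span_singleton_eq using sc by auto
  then show ?thesis using that Bs nz by blast
qed

end

section \<open>The \<open>A\<close>-problem\<close>

text \<open>A derivative at a real point is a limit of difference quotients with real increments
  \<open>1 / Suc k\<close>, and the reals are closed. This makes the components of the contour form
  real.\<close>

lemma higher_deriv_real:
  assumes "f holomorphic_on S" "open S" "\<And>x. of_real x \<in> S \<Longrightarrow> f (of_real x) \<in> \<real>" "of_real x \<in> S"
  shows "(deriv ^^ n) f (of_real x) \<in> \<real>"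
  using assms(4)
proof (induction n arbitrary: x)
  case (Suc n)
  let ?g = "(deriv ^^ n) f"
  have "?g field_differentiable at (of_real x)"
    using holomorphic_higher_deriv[OF assms(1,2)] Suc.prems assms(2) holomorphic_on_imp_differentiable_at by blast
  then have "(?g has_field_derivative deriv ?g (of_real x)) (at (of_real x))"
    by (simp add: field_differentiable_derivI)
  then have lim: "((\<lambda>h. (?g (of_real x + h) - ?g (of_real x)) / h) \<longlongrightarrow> deriv ?g (of_real x)) (at 0)"
    by (simp add: DERIV_def)
  define s where "s k = complex_of_real (inverse (real (Suc k)))" for k
  have "s \<longlonglongrightarrow> of_real 0" unfolding s_def by (rule tendsto_of_real[OF LIMSEQ_inverse_real_of_nat])
  then have s: "s \<longlonglongrightarrow> 0" by simp
  have "filterlim s (at 0) sequentially"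
    unfolding filterlim_at using s by (simp add: s_def del: of_nat_Suc)
  with lim have L1: "((\<lambda>k. (?g (of_real x + s k) - ?g (of_real x)) / s k) \<longlongrightarrow> deriv ?g (of_real x)) sequentially"
    by (rule filterlim_compose)
  have L2: "\<forall>\<^sub>F k in sequentially. (?g (of_real x + s k) - ?g (of_real x)) / s k \<in> \<real>"
  proof -
    have "(\<lambda>k. of_real x + s k) \<longlonglongrightarrow> of_real x + 0" by (intro tendsto_intros s)
    then have "\<forall>\<^sub>F k in sequentially. of_real x + s k \<in> S"
      using assms(2) Suc.prems by (intro topological_tendstoD) auto
    then show ?thesis
    proof eventually_elim
      case (elim k)
      have e: "of_real x + s k = of_real (x + inverse (real (Suc k)))" by (simp add: s_def)
      have "?g (of_real x + s k) \<in> \<real>" using elim unfolding e by (rule Suc.IH)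
      then show ?case using Suc.IH[OF Suc.prems] by (auto simp: s_def intro!: Reals_divide Reals_diff)
    qed
  qed
  have "deriv ?g (of_real x) \<in> \<real>"
    by (rule Lim_in_closed_set[OF closed_complex_Reals L2 _ L1]) simp
  then show ?case by simp
qed (use assms in auto)

lemma higher_deriv_mult_top:
  assumes "f holomorphic_on S" "g holomorphic_on S" "open S" "z \<in> S"
    and "\<And>k. k < n \<Longrightarrow> (deriv ^^ k) g z = 0"
  shows "(deriv ^^ n) (\<lambda>z. f z * g z) z = f z * (deriv ^^ n) g (z::complex)"
proof -
  have "(deriv ^^ n) (\<lambda>z. f z * g z) z =
      (\<Sum>i = 0..n. of_nat (n choose i) * (deriv ^^ i) f z * (deriv ^^ (n - i)) g z)"
    by (rule higher_deriv_mult[OF assms(1-4)])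
  also have "\<dots> = (\<Sum>i\<in>{0}. of_nat (n choose i) * (deriv ^^ i) f z * (deriv ^^ (n - i)) g z)"
    using assms(5) by (intro sum.mono_neutral_right) auto
  finally show ?thesis by simp
qed

lemma higher_deriv_exp: "(deriv ^^ l) (\<lambda>z. exp (z * c)) z = c ^ l * exp (z * (c::complex))"
proof (induction l arbitrary: z)
  case (Suc l)
  have "((\<lambda>z. c ^ l * exp (z * c)) has_field_derivative c ^ Suc l * exp (z * c)) (at z)"
    by (auto intro!: derivative_eq_intros)
  then have "deriv (\<lambda>z. c ^ l * exp (z * c)) z = c ^ Suc l * exp (z * c)" by (rule DERIV_imp_deriv)
  moreover have "(deriv ^^ l) (\<lambda>z. exp (z * c)) = (\<lambda>z. c ^ l * exp (z * c))" using Suc.IH by auto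
  ultimately show ?case by simp
qed simp

context hermite_nodes
begin

definition exp_sum :: "(nat \<Rightarrow> real poly) \<Rightarrow> real \<Rightarrow> real" where
  "exp_sum A t = (\<Sum>i=1..p. poly (A i) t * exp (xi i * t))"

definition node_functional :: "(nat \<Rightarrow> real poly) \<Rightarrow> (complex \<Rightarrow> complex) \<Rightarrow> complex" where
  "node_functional A f =
     (\<Sum>i=1..p. \<Sum>l\<le>degree (A i). of_real (coeff (A i) l) * (deriv ^^ l) f (of_real (xi i)))"

definition kernel :: "(nat \<Rightarrow> nat) \<Rightarrow> complex \<Rightarrow> complex" where
  "kernel m z = cpoly index_poly z / (L z * cpoly (node_poly p xi m) z)"

text \<open>The kernel with its pole at \<open>xi i\<close> removed, that is
  \<open>kernel m z * (z - xi i) ^ m i\<close> off the pole; the sign turns \<open>xi i - z\<close>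
  into \<open>z - xi i\<close>.\<close>

definition node_cofactor :: "(nat \<Rightarrow> nat) \<Rightarrow> nat \<Rightarrow> complex \<Rightarrow> complex" where
  "node_cofactor m i z = (-1) ^ m i * cpoly index_poly z / (L z * (\<Prod>i'\<in>{1..p}-{i}. (of_real (xi i') - z) ^ m i'))"

text \<open>The coefficient of the \<open>k\<close>-th derivative of \<open>f\<close> in the residue
  of \<open>f * kernel\<close> at \<open>xi i\<close>: the residue is the derivative of order
  \<open>m i - 1\<close> of \<open>f * node_cofactor\<close>, divided by a factorial and expanded by
  the Leibniz rule.\<close>

definition contour_coeff :: "(nat \<Rightarrow> nat) \<Rightarrow> nat \<Rightarrow> nat \<Rightarrow> complex" where
  "contour_coeff m i k = of_nat (m i - 1 choose k) *
     (deriv ^^ (m i - 1 - k)) (node_cofactor m i) (of_real (xi i)) / fact (m i - 1)"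

text \<open>\<open>Re\<close> only changes the type, since the coefficients are real by
  \<open>contour_coeff_real\<close>.\<close>

definition contour_vector :: "(nat \<Rightarrow> nat) \<Rightarrow> nat \<Rightarrow> real poly" where
  "contour_vector m i = (if i \<in> {1..p} then \<Sum>k<m i. monom (Re (contour_coeff m i k)) k else 0)"

definition cofactor_domain :: "nat \<Rightarrow> complex set" where
  "cofactor_domain i = half_plane - (\<lambda>i. of_real (xi i)) ` ({1..p} - {i})"

lemma exp_sum_integral:
  assumes f: "transformable reals f"
  shows "integrable lborel (\<lambda>t. f t * exp_sum A t)"
    and "of_real (LBINT t. f t * exp_sum A t) = node_functional A (transform f)"
proof -
  have integral_term: "has_bochner_integral lborel (\<lambda>t. exp (xi i * t) * (t ^ l * f t)) (LBINT t. exp (xi i * t) * (t ^ l * f t))"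
    if "i \<in> {1..p}" for i l
    using transform_power_eq_higher_deriv[OF open_reals f, of l] xi_reals[OF that]
    by (intro has_bochner_integral_integrable) (auto intro: transformable_integrable)
  have eq: "f t * exp_sum A t = (\<Sum>i=1..p. \<Sum>l\<le>degree (A i). coeff (A i) l * (exp (xi i * t) * (t ^ l * f t)))" for t
    by (simp add: exp_sum_def poly_altdef sum_distrib_left sum_distrib_right mult_ac)
  have *: "has_bochner_integral lborel (\<lambda>t. f t * exp_sum A t)
      (\<Sum>i=1..p. \<Sum>l\<le>degree (A i). coeff (A i) l * (LBINT t. exp (xi i * t) * (t ^ l * f t)))"
    unfolding eq by (intro has_bochner_integral_sum has_bochner_integral_mult_right integral_term)
  show "integrable lborel (\<lambda>t. f t * exp_sum A t)" using * by (simp add: has_bochner_integral_iff)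
  have "complex_of_real (LBINT t. exp (xi i * t) * (t ^ l * f t)) = (deriv ^^ l) (transform f) (of_real (xi i))"
    if "i \<in> {1..p}" for i l
    using transform_power_eq_higher_deriv[OF open_reals f, of l] xi_half_plane[OF that]
    by (simp add: transform_of_real[symmetric])
  then show "of_real (LBINT t. f t * exp_sum A t) = node_functional A (transform f)"
    unfolding has_bochner_integral_integral_eq[OF *] node_functional_def of_real_sum of_real_mult
    by (intro sum.cong refl) simp
qed

lemma A_relation_iff:
  assumes "j \<in> row_indices"
  shows "has_bochner_integral lborel (\<lambda>t. t ^ k * U j t * exp_sum A t) 0 \<longleftrightarrow>
    node_functional A (transform (\<lambda>t. t ^ k * U j t)) = 0"
proof -
  note E = exp_sum_integral[OF transformable_power_U[OF assms, of k], of A]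
  show ?thesis
    unfolding has_bochner_integral_real_zero_iff[OF E(1)] E(2)[symmetric] by simp
qed

lemma node_functional_combination:
  assumes rel: "\<And>j k. j \<in> row_indices \<Longrightarrow> k < lam j \<Longrightarrow> has_bochner_integral lborel (\<lambda>t. t ^ k * U j t * exp_sum A t) 0"
    and B: "B \<in> poly_vectors row_indices lam"
  shows "node_functional A (transform (combination B)) = 0"
proof -
  have "has_bochner_integral lborel (\<lambda>t. \<Sum>j\<in>row_indices. \<Sum>k<lam j. coeff (B j) k * (t ^ k * U j t * exp_sum A t))
      (\<Sum>j\<in>row_indices. \<Sum>k<lam j. coeff (B j) k * 0)"
    by (intro has_bochner_integral_sum has_bochner_integral_mult_right rel) auto
  moreover have "(\<Sum>j\<in>row_indices. \<Sum>k<lam j. coeff (B j) k * (t ^ k * U j t * exp_sum A t)) = combination B t * exp_sum A t" for t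
    by (simp only: combination_eq[OF B] sum_distrib_right mult.assoc)
  ultimately have "(LBINT t. combination B t * exp_sum A t) = 0"
    by (simp add: has_bochner_integral_iff del: sum.cl_ivl_Suc)
  then show ?thesis
    using exp_sum_integral(2)[OF transformable_combination[OF B], of A] by simp
qed

text \<open>If the components of \<open>A\<close> have at most \<open>N\<close> coefficients altogether, the test polynomial \<open>P\<close> vanishing
  to the right order at every node isolates the leading coefficient of one component.\<close>

lemma A_relations_imp_zero:
  assumes supp: "\<And>i. i \<notin> {1..p} \<Longrightarrow> A i = 0"
    and rel: "\<And>j k. j \<in> row_indices \<Longrightarrow> k < lam j \<Longrightarrow> has_bochner_integral lborel (\<lambda>t. t ^ k * U j t * exp_sum A t) 0"
    and small: "(\<Sum>i=1..p. if A i = 0 then 0 else Suc (degree (A i))) \<le> N"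
  shows "A = 0"
proof (rule ccontr)
  assume "A \<noteq> 0"
  then obtain i0 where i0: "A i0 \<noteq> 0" by (auto simp: fun_eq_iff)
  then have i0p: "i0 \<in> {1..p}" using supp by blast
  \<comment> \<open>As many zeros as each component has coefficients, but one fewer at
    \<open>i0\<close>: of all the derivatives that \<open>A\<close> tests, only the
    \<open>n\<close>-th one at \<open>xi i0\<close> survives, and the missing zero brings the degree
    of \<open>P\<close> below \<open>N\<close>.\<close>
  define e where "e i = (if A i = 0 then 0 else if i = i0 then degree (A i) else Suc (degree (A i)))" for i
  define P where "P = (\<Prod>i=1..p. [:- xi i, 1:] ^ e i)"
  define n where "n = degree (A i0)"
  have "degree P = (\<Sum>i=1..p. e i)"
    unfolding P_def by (subst degree_prod_eq_sum_degree) (auto simp: degree_power_eq)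
  also have "\<dots> < (\<Sum>i=1..p. if A i = 0 then 0 else Suc (degree (A i)))"
    by (rule sum_strict_mono_ex1) (use i0 i0p in \<open>auto simp: e_def\<close>)
  finally have degP: "degree P < N" using small by simp
  then obtain B where B: "B \<in> poly_vectors row_indices lam" "Psi B = P"
    using Psi_surj[of P] by (metis coeff_eq_0 order_less_le_trans)
  define h where "h z = L z / cpoly index_poly z" for z
  have hh: "h holomorphic_on half_plane"
    unfolding h_def using index_poly_nonzero_half_plane by (intro holomorphic_intros L_holomorphic) auto
  have D: "(deriv ^^ l) (transform (combination B)) (of_real (xi i)) = (deriv ^^ l) (\<lambda>z. h z * cpoly P z) (of_real (xi i))"
    if "i \<in> {1..p}" for i l
    using transform_combination[OF B(1)] B(2) open_half_plane xi_half_plane[OF that]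
    by (intro higher_deriv_cong_ev) (auto simp: eventually_nhds h_def)
  have low: "(deriv ^^ l) (cpoly P) (of_real (xi i)) = 0" if "i \<in> {1..p}" "l < e i" for i l
  proof -
    have "[:- xi i, 1:] ^ e i dvd P" unfolding P_def by (rule dvd_prodI) (use that in auto)
    then have "poly ((pderiv ^^ l) P) (xi i) = 0" using roots_upto_iff_dvd that(2) by blast
    then show ?thesis by (simp add: higher_deriv_cpoly cpoly_of_real)
  qed
  have zero: "(deriv ^^ l) (transform (combination B)) (of_real (xi i)) = 0" if "i \<in> {1..p}" "l < e i" for i l
    unfolding D[OF that(1)]
    by (rule higher_deriv_mult_zero[OF hh cpoly_holomorphic open_half_plane xi_half_plane[OF that(1)] low[OF that(1)] that(2)])
  have top: "(deriv ^^ n) (transform (combination B)) (of_real (xi i0)) \<noteq> 0"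
  proof -
    have e0: "e i0 = n" using i0 by (simp add: e_def n_def)
    have "(deriv ^^ n) (transform (combination B)) (of_real (xi i0)) = h (of_real (xi i0)) * (deriv ^^ n) (cpoly P) (of_real (xi i0))"
      unfolding D[OF i0p]
      by (rule higher_deriv_mult_top[OF hh cpoly_holomorphic open_half_plane xi_half_plane[OF i0p]]) (use low[OF i0p] e0 in auto)
    moreover have "h (of_real (xi i0)) \<noteq> 0"
      using index_poly_nonzero_half_plane[OF xi_half_plane[OF i0p]] by (simp add: h_def)
    \<comment> \<open>The order of \<open>P\<close> at \<open>xi i0\<close> is exactly
      \<open>n\<close>: a further zero would have to come from the factors of the other, distinct
      nodes.\<close>
    moreover have "poly ((pderiv ^^ n) P) (xi i0) \<noteq> 0"
    proof
      assume "poly ((pderiv ^^ n) P) (xi i0) = 0"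
      moreover have "poly ((pderiv ^^ l) P) (xi i0) = 0" if "l < n" for l
        using low[OF i0p, of l] that e0 by (simp add: higher_deriv_cpoly cpoly_of_real)
      ultimately have "[:- xi i0, 1:] ^ Suc n dvd P"
        unfolding roots_upto_iff_dvd[symmetric] by (auto simp: less_Suc_eq)
      moreover define R where "R = (\<Prod>i\<in>{1..p}-{i0}. [:- xi i, 1:] ^ e i)"
      have "P = [:- xi i0, 1:] ^ n * R"
        unfolding P_def R_def e0[symmetric] by (rule prod.remove[OF _ i0p]) simp
      ultimately have "[:- xi i0, 1:] ^ n * [:- xi i0, 1:] dvd [:- xi i0, 1:] ^ n * R"
        by (simp only: power_Suc2)
      then have "[:- xi i0, 1:] dvd R" by (subst (asm) dvd_mult_cancel_left) simp
      then have "poly R (xi i0) = 0" by (simp only: poly_eq_0_iff_dvd)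
      moreover have "poly R (xi i0) \<noteq> 0"
      proof -
        have "xi i0 \<noteq> xi i" if "i \<in> {1..p} - {i0}" for i using inj_onD[OF xi_inj, of i0 i] that i0p by auto
        then show ?thesis by (auto simp: R_def poly_prod)
      qed
      ultimately show False by simp
    qed
    ultimately show ?thesis by (simp add: higher_deriv_cpoly cpoly_of_real)
  qed
  have "node_functional A (transform (combination B)) =
      (\<Sum>l\<le>n. of_real (coeff (A i0) l) * (deriv ^^ l) (transform (combination B)) (of_real (xi i0)))"
  proof -
    have "(\<Sum>l\<le>degree (A i). of_real (coeff (A i) l) * (deriv ^^ l) (transform (combination B)) (of_real (xi i))) = 0"
      if "i \<in> {1..p} - {i0}" for i
    proof (cases "A i = 0")
      case False
      then show ?thesis using that zero[of i] by (intro sum.neutral) (auto simp: e_def)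
    qed simp
    then show ?thesis
      unfolding node_functional_def n_def sum.remove[OF finite_atLeastAtMost i0p] by (simp add: sum.neutral)
  qed
  also have "\<dots> = of_real (coeff (A i0) n) * (deriv ^^ n) (transform (combination B)) (of_real (xi i0))"
  proof -
    have split: "(\<Sum>l\<le>n. g l) = (\<Sum>l<n. g l) + g n" for g :: "nat \<Rightarrow> complex"
      by (simp flip: lessThan_Suc_atMost)
    have "(deriv ^^ l) (transform (combination B)) (of_real (xi i0)) = 0" if "l < n" for l
      using zero[OF i0p, of l] that i0 by (simp add: e_def n_def)
    then show ?thesis unfolding split by (simp add: sum.neutral)
  qed
  finally show False
    using node_functional_combination[OF rel B(1)] top i0 by (simp add: n_def)
qed

lemma open_cofactor_domain: "open (cofactor_domain i)"
  unfolding cofactor_domain_def by (intro open_Diff open_half_plane finite_imp_closed) auto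

lemma xi_cofactor_domain: "i \<in> {1..p} \<Longrightarrow> of_real (xi i) \<in> cofactor_domain i"
  using xi_half_plane inj_onD[OF xi_inj, of i] by (auto simp: cofactor_domain_def)

lemma node_cofactor_denominator_nonzero:
  "z \<in> cofactor_domain i \<Longrightarrow> (\<Prod>i'\<in>{1..p}-{i}. (of_real (xi i') - z) ^ m i') \<noteq> 0"
  by (auto simp: cofactor_domain_def)

lemma node_cofactor_holomorphic: "node_cofactor m i holomorphic_on cofactor_domain i"
  unfolding node_cofactor_def
  using node_cofactor_denominator_nonzero
  by (intro holomorphic_intros holomorphic_on_subset[OF L_holomorphic]) (auto simp: cofactor_domain_def)

lemma contour_coeff_real:
  assumes i: "i \<in> {1..p}"
  shows "contour_coeff m i k \<in> \<real>"
proof -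
  have "node_cofactor m i (of_real x) \<in> \<real>" if "of_real x \<in> cofactor_domain i" for x
  proof -
    have "x \<in> reals" using that by (simp add: cofactor_domain_def strip_def)
    then show ?thesis
      unfolding node_cofactor_def L_of_real[OF \<open>x \<in> reals\<close>] cpoly_of_real
      by (auto intro!: Reals_divide Reals_mult Reals_power prod_in_Reals)
  qed
  then have "(deriv ^^ n) (node_cofactor m i) (of_real (xi i)) \<in> \<real>" for n
    by (rule higher_deriv_real[OF node_cofactor_holomorphic open_cofactor_domain _ xi_cofactor_domain[OF i]])
  moreover have "fact (m i - 1) \<in> (\<real> :: complex set)" by (metis Reals_of_nat of_nat_fact)
  ultimately show ?thesis unfolding contour_coeff_def by (intro Reals_divide Reals_mult) auto
qed

lemma residue_kernel:
  assumes f: "f holomorphic_on half_plane" and i: "i \<in> {1..p}"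
  shows "residue (\<lambda>z. f z * kernel m z) (of_real (xi i)) =
    (\<Sum>k<m i. contour_coeff m i k * (deriv ^^ k) f (of_real (xi i)))"
proof -
  define x where "x = complex_of_real (xi i)"
  note dom = open_cofactor_domain xi_cofactor_domain[OF i, folded x_def]
  have fh: "f holomorphic_on cofactor_domain i"
    by (rule holomorphic_on_subset[OF f]) (auto simp: cofactor_domain_def)
  have fc: "(\<lambda>z. f z * node_cofactor m i z) holomorphic_on cofactor_domain i"
    by (intro holomorphic_intros fh node_cofactor_holomorphic)
  have eq: "f z * kernel m z = f z * node_cofactor m i z / (z - x) ^ m i" for z
  proof -
    have "cpoly (node_poly p xi m) z = (x - z) ^ m i * (\<Prod>i'\<in>{1..p}-{i}. (of_real (xi i') - z) ^ m i')"
      unfolding cpoly_node_poly x_def by (rule prod.remove) (use i in auto)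
    moreover have "(x - z) ^ m i = (-1) ^ m i * (z - x) ^ m i"
      by (metis minus_diff_eq power_minus)
    moreover have "(-1) ^ m i * ((-1) ^ m i :: complex) = 1" by (simp flip: power_mult_distrib)
    then have "1 / ((-1) ^ m i :: complex) = (-1) ^ m i" by (simp add: field_simps)
    ultimately show ?thesis
      by (simp add: kernel_def node_cofactor_def divide_inverse mult_ac flip: inverse_eq_divide)
  qed
  show ?thesis
  proof (cases "m i")
    \<comment> \<open>Without a pole the residue is 0, which matches the empty sum.\<close>
    case 0
    then show ?thesis using residue_holo[OF dom fc] by (simp add: eq x_def[symmetric])
  next
    case (Suc n)
    have "residue (\<lambda>z. f z * kernel m z) x = (deriv ^^ n) (\<lambda>z. f z * node_cofactor m i z) x / fact n"
      unfolding eq Suc by (rule residue_holomorphic_over_power[OF dom fc])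
    also have "(deriv ^^ n) (\<lambda>z. f z * node_cofactor m i z) x =
        (\<Sum>k = 0..n. of_nat (n choose k) * (deriv ^^ k) f x * (deriv ^^ (n - k)) (node_cofactor m i) x)"
      by (rule higher_deriv_mult[OF fh node_cofactor_holomorphic dom])
    finally show ?thesis
      unfolding x_def[symmetric] contour_coeff_def Suc lessThan_Suc_atMost atLeast0AtMost sum_divide_distrib
      by (simp add: mult_ac)
  qed
qed

lemma coeff_contour_vector:
  "i \<in> {1..p} \<Longrightarrow> coeff (contour_vector m i) k = (if k < m i then Re (contour_coeff m i k) else 0)"
  by (simp add: contour_vector_def coeff_sum sum.delta cong: if_cong)

lemma node_functional_contour_vector:
  assumes f: "f holomorphic_on half_plane"
  shows "node_functional (contour_vector m) f = (\<Sum>i=1..p. residue (\<lambda>z. f z * kernel m z) (of_real (xi i)))"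
  unfolding node_functional_def
proof (intro sum.cong refl)
  fix i assume i: "i \<in> {1..p}"
  show "(\<Sum>l\<le>degree (contour_vector m i). of_real (coeff (contour_vector m i) l) * (deriv ^^ l) f (of_real (xi i)))
      = residue (\<lambda>z. f z * kernel m z) (of_real (xi i))"
    unfolding residue_kernel[OF f i]
  proof (rule sum.mono_neutral_cong)
    fix k assume "k \<in> {..<m i} - {..degree (contour_vector m i)}"
    then have "Re (contour_coeff m i k) = 0" using coeff_contour_vector[OF i, of m k] coeff_eq_0[of "contour_vector m i" k] by simp
    then have "contour_coeff m i k = 0" using of_real_Re[OF contour_coeff_real[OF i]] by (metis of_real_0)
    then show "contour_coeff m i k * (deriv ^^ k) f (of_real (xi i)) = 0" by simp
  next
    fix k assume "k \<in> {..degree (contour_vector m i)} \<inter> {..<m i}"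
    then show "of_real (coeff (contour_vector m i) k) * (deriv ^^ k) f (of_real (xi i)) =
        contour_coeff m i k * (deriv ^^ k) f (of_real (xi i))"
      using of_real_Re[OF contour_coeff_real[OF i]] by (simp add: coeff_contour_vector[OF i])
  qed (auto simp: coeff_contour_vector[OF i])
qed

lemma contour_vector_in: "contour_vector m \<in> poly_vectors {1..p} m"
  unfolding poly_vectors_def
proof (clarify, intro conjI)
  fix i assume nz: "contour_vector m i \<noteq> 0"
  then show i: "i \<in> {1..p}" unfolding contour_vector_def by presburger
  have "coeff (contour_vector m i) (degree (contour_vector m i)) \<noteq> 0" using nz by simp
  then show "degree (contour_vector m i) < m i" unfolding coeff_contour_vector[OF i] by presburger
qed

text \<open>The top coefficient at node \<open>i\<close> is the value of
  \<open>node_cofactor\<close> at the node, up to a factorial, and this value is not 0.\<close>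

lemma contour_vector_nonzero:
  assumes "i \<in> {1..p}" "m i > 0"
  shows "contour_vector m \<noteq> 0"
proof
  assume "contour_vector m = 0"
  then have "coeff (contour_vector m i) (m i - 1) = 0" by simp
  then have "Re (contour_coeff m i (m i - 1)) = 0" using assms by (simp add: coeff_contour_vector)
  then have "contour_coeff m i (m i - 1) = 0" using of_real_Re[OF contour_coeff_real[OF assms(1)]] by (metis of_real_0)
  then have "node_cofactor m i (of_real (xi i)) = 0" by (simp add: contour_coeff_def)
  then show False
    using node_cofactor_denominator_nonzero[OF xi_cofactor_domain[OF assms(1)], of m]
      index_poly_nonzero_half_plane[OF xi_half_plane[OF assms(1)]]
    by (simp add: node_cofactor_def)
qed

lemma sum_over_nodes: "(\<Sum>z\<in>(\<lambda>i. complex_of_real (xi i)) ` {1..p}. g z) = (\<Sum>i=1..p. g (of_real (xi i)))"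
proof -
  have "inj_on (\<lambda>i. complex_of_real (xi i)) {1..p}"
    using xi_inj unfolding inj_on_def of_real_eq_iff .
  then show ?thesis by (simp only: sum.reindex o_def)
qed

lemma cpoly_node_poly_nonzero:
  "z \<notin> (\<lambda>i. complex_of_real (xi i)) ` {1..p} \<Longrightarrow> cpoly (node_poly p xi m) z \<noteq> 0"
  by (auto simp: cpoly_node_poly)

text \<open>A circle around all nodes has integral \<open>2 * pi * i\<close> times the sum of the
  residues, while the decay makes this integral arbitrarily small for large radius.\<close>

lemma sum_residue_rational:
  assumes deg: "degree P + 2 \<le> degree (node_poly p xi m)"
  shows "(\<Sum>i=1..p. residue (\<lambda>z. cpoly P z / cpoly (node_poly p xi m) z) (of_real (xi i))) = 0"
proof -
  define Q where "Q = node_poly p xi m"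
  define f where "f z = cpoly P z / cpoly Q z" for z
  define pts where "pts = (\<lambda>i. complex_of_real (xi i)) ` {1..p}"
  define S where "S = (\<Sum>i=1..p. residue f (of_real (xi i)))"
  have fhol: "f holomorphic_on UNIV - pts"
    unfolding f_def Q_def pts_def using cpoly_node_poly_nonzero by (intro holomorphic_intros) auto
  have "norm S \<le> e" if e: "e > 0" for e
  proof -
    \<comment> \<open>\<open>pCons 0 P\<close> is \<open>z * P\<close>: the degree gap of 2 leaves
      \<open>z * f z\<close> tending to 0, which beats the length of the circle.\<close>
    have "((\<lambda>z. poly (map_poly complex_of_real (pCons 0 P)) z / poly (map_poly of_real Q) z) \<longlongrightarrow> 0) at_infinity"
      by (rule poly_divide_tendsto_0_at_infinity) (use deg in \<open>simp add: degree_map_poly Q_def\<close>)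
    then have "\<forall>\<^sub>F z in at_infinity. norm (cpoly (pCons 0 P) z / cpoly Q z) < e"
      using e unfolding cpoly_def tendsto_iff by (simp add: dist_norm)
    then obtain b where b: "\<And>z. norm z \<ge> b \<Longrightarrow> norm (cpoly (pCons 0 P) z / cpoly Q z) < e"
      unfolding eventually_at_infinity by blast
    define R where "R = \<bar>b\<bar> + 1 + (\<Sum>i=1..p. \<bar>xi i\<bar>)"
    have "(\<Sum>i=1..p. \<bar>xi i\<bar>) \<ge> 0" by (rule sum_nonneg) simp
    then have R0: "R > 0" "R \<ge> b" unfolding R_def by linarith+
    have Rxi: "\<bar>xi i\<bar> < R" if "i \<in> {1..p}" for i
    proof -
      have "\<bar>xi i\<bar> \<le> (\<Sum>i=1..p. \<bar>xi i\<bar>)" by (rule member_le_sum) (use that in auto)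
      then show ?thesis unfolding R_def by linarith
    qed
    have img: "path_image (circlepath 0 R) \<subseteq> UNIV - pts"
    proof
      fix z assume z: "z \<in> path_image (circlepath 0 R)"
      have "z \<noteq> of_real (xi i)" if "i \<in> {1..p}" for i
        using Rxi[OF that] z R0 by auto
      then show "z \<in> UNIV - pts" unfolding pts_def by blast
    qed
    have "contour_integral (circlepath 0 R) f = 2 * pi * \<i> * (\<Sum>z\<in>pts. winding_number (circlepath 0 R) z * residue f z)"
      by (rule Residue_theorem) (use fhol img in \<open>auto simp: pts_def\<close>)
    also have "(\<Sum>z\<in>pts. winding_number (circlepath 0 R) z * residue f z) = S"
      unfolding pts_def sum_over_nodes S_def
      by (intro sum.cong refl) (use Rxi in \<open>simp add: winding_number_circlepath\<close>)
    finally have I: "contour_integral (circlepath 0 R) f = 2 * pi * \<i> * S" .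
    have "f contour_integrable_on circlepath 0 R"
      by (rule contour_integrable_holomorphic_simple[OF fhol _ _ img]) (auto simp: pts_def intro!: open_Diff finite_imp_closed)
    then have "(f has_contour_integral 2 * pi * \<i> * S) (circlepath 0 R)"
      unfolding I[symmetric] by (rule has_contour_integral_integral)
    then have "norm (2 * pi * \<i> * S) \<le> e / R * (2 * pi * R)"
    proof (rule has_contour_integral_bound_circlepath)
      fix z :: complex assume z: "norm (z - 0) = R"
      have "R * norm (f z) < e"
        using b[of z] z R0 by (simp add: f_def norm_mult norm_divide)
      then show "norm (f z) \<le> e / R" using R0 by (simp add: field_simps)
    qed (use e R0 in auto)
    then show ?thesis using R0 by (simp add: norm_mult field_simps)
  qed
  then have "norm S \<le> 0 + e" if "e > 0" for e using that by simp
  then have "norm S \<le> 0" by (rule field_le_epsilon)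
  then show ?thesis by (simp add: S_def f_def[abs_def] Q_def)
qed

lemma A_solutions_eq:
  "A_solutions (Suc r) U lam p xi m = {A \<in> poly_vectors {1..p} m.
     \<forall>j\<in>row_indices. \<forall>k<lam j. has_bochner_integral lborel (\<lambda>t. t ^ k * U j t * exp_sum A t) 0}"
  by (simp only: A_solutions_def exp_sum_def)

lemma contour_vector_solution:
  assumes m: "(\<Sum>i=1..p. m i) = N + 1"
  shows "contour_vector m \<in> A_solutions (Suc r) U lam p xi m"
proof -
  have "node_functional (contour_vector m) (transform (\<lambda>t. t ^ k * U j t)) = 0"
    if j: "j \<in> row_indices" and k: "k < lam j" for j k
  proof -
    have hol: "transform (\<lambda>t. t ^ k * U j t) holomorphic_on half_plane"
      by (rule transform_holomorphic[OF open_reals transformable_power_U[OF j]])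
    have "residue (\<lambda>z. transform (\<lambda>t. t ^ k * U j t) z * kernel m z) (of_real (xi i)) =
        residue (\<lambda>z. cpoly (row_poly j k) z / cpoly (node_poly p xi m) z) (of_real (xi i))" if i: "i \<in> {1..p}" for i
    proof (rule residue_cong[OF _ refl])
      have "transform (\<lambda>t. t ^ k * U j t) z * kernel m z = cpoly (row_poly j k) z / cpoly (node_poly p xi m) z"
        if "z \<in> half_plane" for z
        using index_poly_nonzero_half_plane[OF that]
        by (simp add: transform_power_U_row_poly[OF j k that] kernel_def)
      moreover have "\<forall>\<^sub>F z in at (of_real (xi i)). z \<in> half_plane"
        using open_half_plane xi_half_plane[OF i] by (rule eventually_at_in_open')
      ultimately show "\<forall>\<^sub>F z in at (of_real (xi i)). transform (\<lambda>t. t ^ k * U j t) z * kernel m z =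
          cpoly (row_poly j k) z / cpoly (node_poly p xi m) z"
        by (auto elim: eventually_mono)
    qed
    then have "node_functional (contour_vector m) (transform (\<lambda>t. t ^ k * U j t)) =
        (\<Sum>i=1..p. residue (\<lambda>z. cpoly (row_poly j k) z / cpoly (node_poly p xi m) z) (of_real (xi i)))"
      unfolding node_functional_contour_vector[OF hol] by (intro sum.cong refl)
    \<comment> \<open>The numerator has degree at most \<open>N - 1\<close> and the node polynomial
      degree \<open>N + 1\<close>, which is the gap of two that the residue sum requires.\<close>
    also have "\<dots> = 0"
      using degree_row_poly_less[OF j k] m by (intro sum_residue_rational) (simp add: degree_node_poly)
    finally show ?thesis .
  qed
  then show ?thesis unfolding A_solutions_eq using A_relation_iff contour_vector_in by blast
qed

lemma A_solution_top_coeff: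
  assumes m: "(\<Sum>i=1..p. m i) = N + 1" and A: "A \<in> A_solutions (Suc r) U lam p xi m" "A \<noteq> 0"
    and i: "i \<in> {1..p}" "m i > 0"
  shows "coeff (A i) (m i - 1) \<noteq> 0"
proof
  assume c: "coeff (A i) (m i - 1) = 0"
  have Ain: "A \<in> poly_vectors {1..p} m" using A(1) by (simp add: A_solutions_eq)
  have le: "(if A i' = 0 then 0 else Suc (degree (A i'))) \<le> m i'" for i'
    using Ain by (auto simp: poly_vectors_def)
  have lt: "(if A i = 0 then 0 else Suc (degree (A i))) < m i"
  proof (cases "A i = 0")
    case False
    then have "degree (A i) < m i" using Ain by (auto simp: poly_vectors_def)
    moreover have "degree (A i) \<noteq> m i - 1" using c False leading_coeff_0_iff[of "A i"] by metis
    ultimately show ?thesis using False by simp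
  qed (use i in simp)
  have "(\<Sum>i=1..p. if A i = 0 then 0 else Suc (degree (A i))) < (\<Sum>i=1..p. m i)"
    by (rule sum_strict_mono_ex1[OF finite_atLeastAtMost]) (use le lt i(1) in blast)+
  then have "A = 0"
    using A(1) Ain m by (intro A_relations_imp_zero) (auto simp: A_solutions_eq poly_vectors_def)
  with A(2) show False by simp
qed

lemma A_solutions_span:
  assumes m: "(\<Sum>i=1..p. m i) = N + 1"
  shows "contour_vector m \<noteq> 0" "A_solutions (Suc r) U lam p xi m = poly_vec.span {contour_vector m}"
    "strongly_normal {1..p} m (A_solutions (Suc r) U lam p xi m)"
proof -
  have "\<exists>i\<in>{1..p}. m i > 0"
  proof (rule ccontr)
    assume "\<not> ?thesis"
    then have "(\<Sum>i=1..p. m i) = 0" by (intro sum.neutral) auto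
    then show False using m by simp
  qed
  then obtain i0 where i0: "i0 \<in> {1..p}" "m i0 > 0" by blast
  let ?C = "contour_vector m" and ?S = "A_solutions (Suc r) U lam p xi m"
  show nz: "?C \<noteq> 0" by (rule contour_vector_nonzero[of i0]) (use i0 in auto)
  have CS: "?C \<in> ?S" by (rule contour_vector_solution[OF m])
  have diff: "(\<lambda>i. smult c (A i) + smult c' (A' i)) \<in> ?S" if A: "A \<in> ?S" "A' \<in> ?S" for A A' c c'
  proof -
    have E: "exp_sum (\<lambda>i. smult c (A i) + smult c' (A' i)) t = c * exp_sum A t + c' * exp_sum A' t" for t
      by (simp add: exp_sum_def sum.distrib sum_distrib_left distrib_right mult.assoc)
    have "smult c (A i) + smult c' (A' i) \<noteq> 0 \<Longrightarrow> i \<in> {1..p} \<and> degree (smult c (A i) + smult c' (A' i)) < m i" for i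
    proof -
      assume nz: "smult c (A i) + smult c' (A' i) \<noteq> 0"
      have P: "\<And>A i. A \<in> ?S \<Longrightarrow> A i \<noteq> 0 \<Longrightarrow> i \<in> {1..p} \<and> degree (A i) < m i"
        by (auto simp: A_solutions_eq poly_vectors_def)
      from nz have i: "i \<in> {1..p}" "0 < m i" using P[OF A(1), of i] P[OF A(2), of i] by fastforce+
      moreover have "degree (smult c (A i)) < m i" "degree (smult c' (A' i)) < m i"
        using P[OF A(1), of i] P[OF A(2), of i] i by (metis degree_smult_le degree_0 le_less_trans smult_0_right)+
      ultimately show ?thesis by (simp add: degree_add_less)
    qed
    moreover have "has_bochner_integral lborel (\<lambda>t. t ^ k * U j t * exp_sum (\<lambda>i. smult c (A i) + smult c' (A' i)) t) 0"
      if "j \<in> row_indices" "k < lam j" for j k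
    proof -
      have "has_bochner_integral lborel (\<lambda>t. c * (t ^ k * U j t * exp_sum A t) + c' * (t ^ k * U j t * exp_sum A' t)) (c * 0 + c' * 0)"
        by (intro has_bochner_integral_add has_bochner_integral_mult_right) (use A that in \<open>auto simp: A_solutions_eq\<close>)
      moreover have "c * (t ^ k * U j t * exp_sum A t) + c' * (t ^ k * U j t * exp_sum A' t) =
          t ^ k * U j t * exp_sum (\<lambda>i. smult c (A i) + smult c' (A' i)) t" for t
        unfolding E by (simp add: algebra_simps)
      ultimately show ?thesis by simp
    qed
    ultimately show ?thesis by (auto simp: A_solutions_eq poly_vectors_def)
  qed
  have "A \<in> poly_vec.span {?C}" if A: "A \<in> ?S" for A
  proof -
    \<comment> \<open>Chosen to cancel the top coefficient at \<open>i0\<close>; a solution that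
      lacks it is zero, so the solution space is a line.\<close>
    define c where "c = coeff (A i0) (m i0 - 1) / coeff (?C i0) (m i0 - 1)"
    have c0: "coeff (?C i0) (m i0 - 1) \<noteq> 0" by (rule A_solution_top_coeff[OF m CS nz i0])
    let ?D = "\<lambda>i. smult 1 (A i) + smult (- c) (?C i)"
    have "?D \<in> ?S" by (rule diff[OF A CS])
    moreover have "coeff (?D i0) (m i0 - 1) = 0" using c0 by (simp add: c_def)
    ultimately have "?D = 0" using A_solution_top_coeff[OF m _ _ i0] by blast
    then have "A = (\<lambda>i. smult c (?C i))" by (auto simp: fun_eq_iff)
    then show ?thesis unfolding span_singleton_eq by blast
  qed
  moreover have "(\<lambda>i. smult c (?C i)) \<in> ?S" for c using diff[OF CS CS, of c 0] by simp
  ultimately show eq: "?S = poly_vec.span {?C}" unfolding span_singleton_eq by auto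
  have "\<forall>i\<in>{1..p}. m i > 0 \<longrightarrow> coeff (?C i) (m i - 1) \<noteq> 0"
    using A_solution_top_coeff[OF m CS nz] by blast
  then show "strongly_normal {1..p} m ?S"
    unfolding eq strongly_normal_span_iff[OF contour_vector_in nz] .
qed

section \<open>Uniqueness of the components and evaluation of the contour form\<close>

lemma exp_sum_eq_zero_imp:
  assumes supp: "\<And>i. i \<notin> {1..p} \<Longrightarrow> A i = 0" and zero: "\<And>t. exp_sum A t = 0"
  shows "A = 0"
proof -
  define n where "n = (\<Sum>i=1..p. if A i = 0 then 0 else Suc (degree (A i)))"
  \<comment> \<open>An auxiliary system with a single row of length \<open>n\<close>, the number of
    coefficients of \<open>A\<close>. A vanishing exponential sum satisfies all its relations
    trivially, so \<open>A_relations_imp_zero\<close> gives independence without any prescribed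
    degrees.\<close>
  interpret H: hermite_index 0 rho d a "\<lambda>j. n"
    by unfold_locales (auto simp: laguerre_admissible_def)
  interpret H: hermite_nodes 0 rho d a "\<lambda>j. n" p xi
    by unfold_locales (auto simp: H.reals_def intro: xi_inj[unfolded One_nat_def])
  show ?thesis
  proof (rule H.A_relations_imp_zero[OF supp])
    show "(\<Sum>i=1..p. if A i = 0 then 0 else Suc (degree (A i))) \<le> H.N"
      unfolding n_def[symmetric] by (simp add: H.N_def)
    show "has_bochner_integral lborel (\<lambda>t. t ^ k * hermite_row 0 rho d a j t * H.exp_sum A t) 0" for j k
      using zero by (simp add: H.exp_sum_def exp_sum_def has_bochner_integral_zero)
  qed
qed

text \<open>\<open>contour_components\<close> quantifies over all contours, so uniqueness would be
  empty without at least one. A circle with a real diameter containing all nodes and lying in the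
  half-plane serves.\<close>

lemma positive_contour_exists:
  assumes "p \<ge> 1"
  shows "\<exists>\<gamma>. positive_contour r rho p xi \<gamma>"
proof -
  have fin: "finite (xi ` {1..p})" "xi ` {1..p} \<noteq> {}" using assms by auto
  define lo0 where "lo0 = Min (xi ` {1..p})"
  define hi where "hi = Max (xi ` {1..p}) + 1"
  have "lo0 \<in> xi ` {1..p}" unfolding lo0_def by (rule Min_in[OF fin])
  then have "lo0 \<in> reals" using xi_reals by auto
  then obtain e where e: "e > 0" "cball lo0 e \<subseteq> reals" using open_reals by (auto simp: open_contains_cball)
  \<comment> \<open>Strictly left of the smallest node and still right of every
    \<open>- rho h\<close>, as \<open>reals\<close> is open.\<close>
  define lo where "lo = lo0 - e"
  have lo: "lo \<in> reals" using e by (auto simp: lo_def dist_real_def subset_iff)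
  have xi: "lo < xi i" "xi i < hi" if "i \<in> {1..p}" for i
    using Min_le[OF fin(1) imageI[OF that]] Max_ge[OF fin(1) imageI[OF that]] e(1)
    unfolding lo_def lo0_def hi_def by linarith+
  define c R where "c = (lo + hi) / 2" and "R = (hi - lo) / 2"
  have R: "R > 0" using xi[of 1] assms by (simp add: R_def)
  have "positive_contour r rho p xi (circlepath (of_real c) R)"
    unfolding positive_contour_def
  proof (intro conjI ballI)
    show "path_image (circlepath (of_real c) R) \<subseteq> {z. \<forall>h\<in>{1..r}. - rho h < Re z}"
    proof clarify
      fix z h assume z: "z \<in> path_image (circlepath (of_real c) R)" and h: "h \<in> {1..r}"
      then have "norm (z - of_real c) = R" using R by (auto simp: dist_norm norm_minus_commute)
      then have "\<bar>Re z - c\<bar> \<le> R" using abs_Re_le_cmod[of "z - of_real c"] by simp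
      then have "Re z \<ge> lo" by (simp add: c_def R_def field_simps abs_le_iff)
      moreover have "lo > - rho h" using lo h by (auto simp: reals_def)
      ultimately show "- rho h < Re z" by simp
    qed
    fix i assume i: "i \<in> {1..p}"
    have "norm (complex_of_real (xi i) - of_real c) < R"
      using xi[OF i] unfolding of_real_diff[symmetric] norm_of_real by (auto simp: c_def R_def abs_less_iff field_simps)
    then show "of_real (xi i) \<notin> path_image (circlepath (of_real c) R)"
      "winding_number (circlepath (of_real c) R) (of_real (xi i)) = 1"
      using R by (auto simp: winding_number_circlepath dist_norm norm_minus_commute)
  qed (use R in \<open>auto simp: simple_path_circlepath\<close>)
  then show ?thesis by blast
qed

text \<open>With \<open>f z = exp (z * t)\<close> the derivatives at the nodes are
  \<open>t ^ l * exp (xi i * t)\<close>, so the sum of residues, read as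
  \<open>node_functional\<close>, is the exponential sum itself.\<close>

lemma contour_form_eq:
  assumes g: "positive_contour r rho p xi \<gamma>"
  shows "contour_form r rho d a lam p xi m \<gamma> t = of_real (exp_sum (contour_vector m) t)"
proof -
  let ?f = "\<lambda>z. exp (z * complex_of_real t)"
  define pts where "pts = (\<lambda>i. complex_of_real (xi i)) ` {1..p}"
  have sub: "path_image \<gamma> \<subseteq> half_plane" using g by (auto simp: positive_contour_def strip_def reals_def)
  have img: "path_image \<gamma> \<subseteq> half_plane - pts" using g sub by (auto simp: positive_contour_def pts_def)
  have fh: "?f holomorphic_on half_plane" by (intro holomorphic_intros)
  have "contour_integral \<gamma> (\<lambda>z. exp (z * of_real t) * Dpoly r rho lam z /
      (laplaceF r rho d a z * (\<Prod>i=1..p. (of_real (xi i) - z) ^ m i))) = contour_integral \<gamma> (\<lambda>z. ?f z * kernel m z)"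
    using sub by (intro contour_integral_eq) (auto simp: Dpoly_eq laplaceF_eq kernel_def cpoly_node_poly)
  also have "\<dots> = 2 * pi * \<i> * (\<Sum>z\<in>pts. winding_number \<gamma> z * residue (\<lambda>z. ?f z * kernel m z) z)"
  proof (rule Residue_theorem[OF open_half_plane _ _ _ _ _ img])
    show "connected half_plane" by (intro convex_connected convex_strip convex_reals)
    show "(\<lambda>z. ?f z * kernel m z) holomorphic_on half_plane - pts"
      unfolding kernel_def pts_def using cpoly_node_poly_nonzero
      by (intro holomorphic_intros holomorphic_on_subset[OF L_holomorphic]) auto
    \<comment> \<open>The half-plane is convex, so a closed path inside it does not wind around a
      point outside.\<close>
    show "\<forall>z. z \<notin> half_plane \<longrightarrow> winding_number \<gamma> z = 0"
      using g sub convex_strip[OF convex_reals]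
      by (auto simp: positive_contour_def intro!: winding_number_zero_outside[of _ half_plane] valid_path_imp_path)
  qed (use g in \<open>auto simp: positive_contour_def pts_def\<close>)
  also have "(\<Sum>z\<in>pts. winding_number \<gamma> z * residue (\<lambda>z. ?f z * kernel m z) z) =
      (\<Sum>i=1..p. residue (\<lambda>z. ?f z * kernel m z) (of_real (xi i)))"
    unfolding pts_def sum_over_nodes
    by (intro sum.cong refl) (use g in \<open>simp add: positive_contour_def\<close>)
  also have "\<dots> = node_functional (contour_vector m) ?f"
    by (rule node_functional_contour_vector[OF fh, symmetric])
  also have "\<dots> = of_real (exp_sum (contour_vector m) t)"
    by (simp add: node_functional_def exp_sum_def higher_deriv_exp poly_altdef sum_distrib_right mult.assoc exp_of_real[symmetric])
  finally show ?thesis unfolding contour_form_def by simp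
qed

lemma contour_components_exp_sum:
  "contour_components r rho d a lam p xi m A \<longleftrightarrow> (\<forall>i. i \<notin> {1..p} \<longrightarrow> A i = 0) \<and>
    (\<forall>\<gamma>. positive_contour r rho p xi \<gamma> \<longrightarrow>
      (\<forall>t. contour_form r rho d a lam p xi m \<gamma> t = of_real (exp_sum A t)))"
  by (simp only: contour_components_def exp_sum_def)

lemma contour_components_iff:
  assumes "p \<ge> 1"
  shows "contour_components r rho d a lam p xi m A \<longleftrightarrow> A = contour_vector m"
proof -
  have supp: "contour_vector m i = 0" if "i \<notin> {1..p}" for i
    using that unfolding contour_vector_def by presburger
  show ?thesis
  proof
    assume C: "contour_components r rho d a lam p xi m A"
    obtain \<gamma> where g: "positive_contour r rho p xi \<gamma>" using positive_contour_exists[OF assms] by blast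
    have "exp_sum A t = exp_sum (contour_vector m) t" for t
    proof -
      have "contour_form r rho d a lam p xi m \<gamma> t = of_real (exp_sum A t)"
        using C[unfolded contour_components_exp_sum, THEN conjunct2, rule_format, OF g] .
      then show ?thesis unfolding contour_form_eq[OF g] by (simp only: of_real_eq_iff)
    qed
    then have "exp_sum (\<lambda>i. A i - contour_vector m i) t = 0" for t
      by (simp add: exp_sum_def left_diff_distrib sum_subtractf)
    moreover have "A i - contour_vector m i = 0" if "i \<notin> {1..p}" for i
      using C that supp[OF that] unfolding contour_components_exp_sum by simp
    ultimately have "(\<lambda>i. A i - contour_vector m i) = 0" by (intro exp_sum_eq_zero_imp)
    then show "A = contour_vector m" by (auto simp: fun_eq_iff)
  next
    assume A: "A = contour_vector m"
    show "contour_components r rho d a lam p xi m A"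
      unfolding contour_components_exp_sum A
    proof (intro conjI allI impI)
      show "contour_form r rho d a lam p xi m \<gamma> t = of_real (exp_sum (contour_vector m) t)"
        if "positive_contour r rho p xi \<gamma>" for \<gamma> t by (rule contour_form_eq[OF that])
    qed (rule supp)
  qed
qed

end

theorem corollary5p14:
  fixes r q p N :: nat
    and rho d xi :: "nat \<Rightarrow> real"
    and a :: real
    and lam :: "nat \<Rightarrow> nat"
    and U :: "nat \<Rightarrow> real \<Rightarrow> real"
  assumes q: "q = Suc r"
    and p: "p \<ge> 1"
    and rho_pos: "\<forall>h\<in>{1..r}. rho h > 0"
    and d_nonneg: "\<forall>h\<in>{1..r}. d h \<ge> 0"
    and xi_distinct: "inj_on xi {1..p}"
    and xi_rho: "\<forall>i\<in>{1..p}. \<forall>h\<in>{1..r}. xi i + rho h > 0"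
    and admissible: "laguerre_admissible q lam"
    and rho_distinct: "inj_on rho {h \<in> {1..r}. lam h > 0}"
    and N: "N = (\<Sum>j=1..q. lam j)"
    and U: "U = hermite_row r rho d a"
  shows "(\<forall>m :: nat \<Rightarrow> nat. (\<Sum>i=1..p. m i) = N + 1 \<longrightarrow>
            strongly_normal {1..p} m (A_solutions q U lam p xi m) \<and>
            (\<exists>!A. contour_components r rho d a lam p xi m A) \<and>
            (\<forall>A. contour_components r rho d a lam p xi m A \<longrightarrow>
               A \<noteq> 0 \<and> A_solutions q U lam p xi m = poly_vec.span {A})) \<and>
         (\<forall>m :: nat \<Rightarrow> nat. N \<ge> 1 \<and> (\<Sum>i=1..p. m i) = N - 1 \<longrightarrow>
            weakly_normal (B_solutions q U lam p xi m) \<and>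
            (\<exists>!B. rodrigues_components r rho d a lam p xi m B) \<and>
            (\<forall>B. rodrigues_components r rho d a lam p xi m B \<longrightarrow>
               B \<noteq> 0 \<and> B_solutions q U lam p xi m = poly_vec.span {B}) \<and>
            (strongly_normal {1..q} lam (B_solutions q U lam p xi m) \<longleftrightarrow>
               (\<forall>j\<in>{1..q}. lam j > 0 \<longrightarrow>
                  Determinant.det (replace_col (connection_matrix r rho d a lam)
                    (p_vector N p xi m) (column_pos lam j (lam j - 1))) \<noteq> 0)))"
proof -
  interpret hermite_nodes r rho d a lam p xi
  proof unfold_locales
    show "\<And>h. h \<in> {1..r} \<Longrightarrow> rho h > 0" "\<And>h. h \<in> {1..r} \<Longrightarrow> d h \<ge> 0"
      using rho_pos d_nonneg by auto
    show "laguerre_admissible (Suc r) lam" using admissible q by simp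
    show "inj_on rho {h \<in> {1..r}. lam h > 0}" by (rule rho_distinct)
    show "inj_on xi {1..p}" by (rule xi_distinct)
    show "\<And>i. i \<in> {1..p} \<Longrightarrow> xi i \<in> hermite_system.reals r rho"
      using xi_rho rho_pos d_nonneg by (subst hermite_system.reals_def) (auto simp: hermite_system_def, smt (verit) atLeastAtMost_iff One_nat_def)
  qed
  have N': "N = hermite_index.N r lam" unfolding N q N_def ..
  show ?thesis
    unfolding N' q U
  proof (intro conjI allI impI; (elim conjE)?)
    fix m assume m: "(\<Sum>i=1..p. m i) = hermite_index.N r lam + 1"
    note A = A_solutions_span[OF m] and C = contour_components_iff[OF p, of m]
    show "strongly_normal {1..p} m (A_solutions (Suc r) (hermite_row r rho d a) lam p xi m)" by (rule A(3))
    show "\<exists>!A. contour_components r rho d a lam p xi m A" unfolding C by blast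
    fix A assume "contour_components r rho d a lam p xi m A"
    then have "A = contour_vector m" by (simp only: C)
    then show "A \<noteq> 0" "A_solutions (Suc r) (hermite_row r rho d a) lam p xi m = poly_vec.span {A}"
      using A(1,2) by simp_all
  next
    fix m assume N1: "1 \<le> hermite_index.N r lam" and m: "(\<Sum>i=1..p. m i) = hermite_index.N r lam - 1"
    obtain Bs where Bs: "Bs \<in> poly_vectors {1..Suc r} lam" "Psi Bs = node_poly p xi m" "Bs \<noteq> 0"
      and S: "B_solutions (Suc r) (hermite_row r rho d a) lam p xi m = poly_vec.span {Bs}"
      using B_problem[OF N1 m] by blast
    note R = rodrigues_components_iff[OF N1 Bs(1,2)]
    show "weakly_normal (B_solutions (Suc r) (hermite_row r rho d a) lam p xi m)"
      unfolding S by (rule weakly_normal_span[OF Bs(3)])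
    show "\<exists>!B. rodrigues_components r rho d a lam p xi m B" unfolding R by blast
    show "B \<noteq> 0" "B_solutions (Suc r) (hermite_row r rho d a) lam p xi m = poly_vec.span {B}"
      if "rodrigues_components r rho d a lam p xi m B" for B
      using that Bs(3) S unfolding R by simp_all
    show "strongly_normal {1..Suc r} lam (B_solutions (Suc r) (hermite_row r rho d a) lam p xi m) \<longleftrightarrow>
      (\<forall>j\<in>{1..Suc r}. lam j > 0 \<longrightarrow> Determinant.det (replace_col (connection_matrix r rho d a lam)
         (p_vector (hermite_index.N r lam) p xi m) (column_pos lam j (lam j - 1))) \<noteq> 0)"
      unfolding S strongly_normal_span_iff[OF Bs(1,3)]
      using det_replace_col_connection_matrix[OF Bs(1,2)] by blast
  qed
qed

end
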